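(* Let $n\ge1$, let $\lambda,\mu,\nu,\rho$ be partitions of length $n$, let $\kappa$ be a partition, and let $k$ be an integer with $1\le|k|\le n$. Then the Littlewood--Richardson coefficient $c_{\lambda/\mu,\nu/\rho}^{\kappa}$ equals the number of $(\lambda/\mu)\circledast_k(\nu/\rho)$-peelable tableaux of shape $\kappa$.
   Context: A partition of length $n$ is a weakly decreasing sequence of $n$ nonnegative integers. $c_{\lambda/\mu,\nu/\rho}^\kappa$ is the coefficient of $s_\kappa$ in the product $s_{\lambda/\mu}s_{\nu/\rho}$ of skew Schur functions ($s_{\lambda/\mu}=0$ if $\mu\not\subseteq\lambda$). For $1\le k\le n$ let $P_k$ be the word $W^k(NW)^{n-k}N^k$ and $P_{-k}$ the word $N^k(WN)^{n-k}W^k$; each has $2n$ letters, $n$ of them $N$ and $n$ of them $W$. Let $N_{P,i}$ (resp. $W_{P,i}$) be the position in the word $P$ of the $i$th $N$ (resp. $i$th $W$). A $(\lambda/\mu)\circledast_k(\nu/\rho)$-peelable tableau is a semistandard Young tableau $T$ with entries in $\{1,\ldots,2n\}$ whose number of entries equal to $W_{P_k,i}$ is $\lambda_i-\mu_i$ and whose number of entries equal to $N_{P_k,i}$ is $\nu_i-\rho_i$ for $1\le i\le n$ (so for $k>0$ the content is $(\lambda_1-\mu_1,\ldots,\lambda_k-\mu_k,\nu_1-\rho_1,\lambda_{k+1}-\mu_{k+1},\nu_2-\rho_2,\ldots,\lambda_n-\mu_n,\nu_{n-k+1}-\rho_{n-k+1},\ldots,\nu_n-\rho_n)$), such that for $1\le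 i<n$: (1) if rows $i$ and $i+1$ of $\lambda/\mu$ have $a_i$ columns in common, then $T$ has at least $a_i$ pairwise disjoint pairs consisting of one square with entry $W_{P_k,i}$ and one square with entry $W_{P_k,i+1}$, the former being Northeast of the latter; (2) if rows $i$ and $i+1$ of $\nu/\rho$ have $b_i$ columns in common, then $T$ has at least $b_i$ pairwise disjoint pairs consisting of one square with entry $N_{P_k,i}$ and one square with entry $N_{P_k,i+1}$, the former being Northeast of the latter. (Northeast is meant weakly: row index $\le$ and column index $\ge$, in English notation.) *)

theory Defs
  imports "HOL-Library.Multiset" "HOL-Library.FuncSet"
begin

text \<open>
  A partition is a weakly decreasing, finitely supported sequence, so that sequences differing only
  by trailing zeros are identified. Rows, columns and parts are counted from 0: the usual
  \<open>\<lambda>\<^sub>i\<close> is \<open>lam (i - 1)\<close>. Entries of tableaux, variables of symmetric functions and positions of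
  letters in words are counted from 1.
\<close>

definition is_partition :: "(nat \<Rightarrow> nat) \<Rightarrow> bool" where
  "is_partition p \<longleftrightarrow> antimono p \<and> finite {i. p i \<noteq> 0}"

definition partition_of_length :: "nat \<Rightarrow> (nat \<Rightarrow> nat) \<Rightarrow> bool" where
  "partition_of_length n p \<longleftrightarrow> antimono p \<and> (\<forall>i\<ge>n. p i = 0)"

definition skew_diagram :: "(nat \<Rightarrow> nat) \<Rightarrow> (nat \<Rightarrow> nat) \<Rightarrow> (nat \<times> nat) set" where
  "skew_diagram lam mu = {(i, j). mu i \<le> j \<and> j < lam i}"

definition diagram :: "(nat \<Rightarrow> nat) \<Rightarrow> (nat \<times> nat) set" where
  "diagram lam = skew_diagram lam (\<lambda>_. 0)"

definition ssyt :: "nat set \<Rightarrow> (nat \<times> nat) set \<Rightarrow> (nat \<times> nat \<Rightarrow> nat) set" where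
  "ssyt A D = {T \<in> D \<rightarrow>\<^sub>E A.
     (\<forall>i j j'. (i, j) \<in> D \<longrightarrow> (i, j') \<in> D \<longrightarrow> j < j' \<longrightarrow> T (i, j) \<le> T (i, j')) \<and>
     (\<forall>i i' j. (i, j) \<in> D \<longrightarrow> (i', j) \<in> D \<longrightarrow> i < i' \<longrightarrow> T (i, j) < T (i', j))}"


text \<open>
  A formal power series over the integers in \<open>x\<^sub>1, x\<^sub>2, \<dots>\<close> is represented by its coefficient
  function, a monomial being the multiset of the indices of its variables.
\<close>

type_synonym power_series = "nat multiset \<Rightarrow> int"

definition series_mult :: "power_series \<Rightarrow> power_series \<Rightarrow> power_series" where
  "series_mult f g = (\<lambda>M. \<Sum>A | A \<subseteq># M. f A * g (M - A))"

definition skew_schur :: "(nat \<Rightarrow> nat) \<Rightarrow> (nat \<Rightarrow> nat) \<Rightarrow> power_series" where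
  "skew_schur lam mu = (\<lambda>M.
     if mu \<le> lam
     then int (card {T \<in> ssyt {1..} (skew_diagram lam mu).
                      image_mset T (mset_set (skew_diagram lam mu)) = M})
     else 0)"

definition schur :: "(nat \<Rightarrow> nat) \<Rightarrow> power_series" where
  "schur kap = skew_schur kap (\<lambda>_. 0)"

definition schur_expansion :: "power_series \<Rightarrow> ((nat \<Rightarrow> nat) \<Rightarrow> int) \<Rightarrow> bool" where
  "schur_expansion f c \<longleftrightarrow>
     finite {kap. c kap \<noteq> 0} \<and> (\<forall>kap. c kap \<noteq> 0 \<longrightarrow> is_partition kap) \<and>
     f = (\<lambda>M. \<Sum>kap | c kap \<noteq> 0. c kap * schur kap M)"

text \<open>
  Schur functions form a basis of the ring of symmetric functions, so a symmetric function has
  exactly one expansion; this includes all products of skew Schur functions.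
\<close>

definition schur_coeff :: "power_series \<Rightarrow> (nat \<Rightarrow> nat) \<Rightarrow> int" where
  "schur_coeff f kap = (THE c. schur_expansion f c) kap"

definition lr_coeff ::
  "(nat \<Rightarrow> nat) \<Rightarrow> (nat \<Rightarrow> nat) \<Rightarrow> (nat \<Rightarrow> nat) \<Rightarrow> (nat \<Rightarrow> nat) \<Rightarrow> (nat \<Rightarrow> nat) \<Rightarrow> int" where
  "lr_coeff lam mu nu rho kap =
     schur_coeff (series_mult (skew_schur lam mu) (skew_schur nu rho)) kap"


datatype letter = N | W

text \<open>The word \<open>P\<^sub>k\<close>, intended for \<open>1 \<le> \<bar>k\<bar> \<le> n\<close>.\<close>

definition path_word :: "nat \<Rightarrow> int \<Rightarrow> letter list" where
  "path_word n k = (let m = nat \<bar>k\<bar> in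
     if k > 0
     then replicate m W @ concat (replicate (n - m) [N, W]) @ replicate m N
     else replicate m N @ concat (replicate (n - m) [W, N]) @ replicate m W)"

text \<open>
  \<open>letter_pos x w i\<close> is the position, counted from 1, of the occurrence number \<open>i\<close>, counted from 0,
  of the letter \<open>x\<close> in \<open>w\<close>.
\<close>

definition letter_pos :: "letter \<Rightarrow> letter list \<Rightarrow> nat \<Rightarrow> nat" where
  "letter_pos x w i = Suc (filter (\<lambda>p. w ! p = x) [0..<length w] ! i)"

definition common_columns :: "(nat \<Rightarrow> nat) \<Rightarrow> (nat \<Rightarrow> nat) \<Rightarrow> nat \<Rightarrow> nat" where
  "common_columns lam mu i =
     card {j. (i, j) \<in> skew_diagram lam mu \<and> (Suc i, j) \<in> skew_diagram lam mu}"

definition northeast :: "nat \<times> nat \<Rightarrow> nat \<times> nat \<Rightarrow> bool" where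
  "northeast s t \<longleftrightarrow> fst s \<le> fst t \<and> snd s \<ge> snd t"

definition has_disjoint_ne_pairs ::
  "(nat \<times> nat) set \<Rightarrow> (nat \<times> nat \<Rightarrow> nat) \<Rightarrow> nat \<Rightarrow> nat \<Rightarrow> nat \<Rightarrow> bool" where
  "has_disjoint_ne_pairs D T a x y \<longleftrightarrow>
     (\<exists>Q. finite Q \<and> a \<le> card Q \<and>
        (\<forall>(s, t) \<in> Q. s \<in> D \<and> t \<in> D \<and> T s = x \<and> T t = y \<and> northeast s t) \<and>
        pairwise (\<lambda>(s, t) (s', t'). {s, t} \<inter> {s', t'} = {}) Q)"

text \<open>
  The content is compared in the
  integers, so the set is empty when \<open>\<mu>\<close> is not contained in \<open>\<lambda>\<close> or \<open>\<rho>\<close> is not contained in \<open>\<nu>\<close>.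
\<close>

definition peelable_tableaux ::
  "nat \<Rightarrow> int \<Rightarrow> (nat \<Rightarrow> nat) \<Rightarrow> (nat \<Rightarrow> nat) \<Rightarrow> (nat \<Rightarrow> nat) \<Rightarrow> (nat \<Rightarrow> nat) \<Rightarrow> (nat \<Rightarrow> nat)
     \<Rightarrow> (nat \<times> nat \<Rightarrow> nat) set" where
  "peelable_tableaux n k lam mu nu rho kap =
     (let D = diagram kap; Wpos = letter_pos W (path_word n k); Npos = letter_pos N (path_word n k)
      in {T \<in> ssyt {1..2 * n} D.
           (\<forall>i<n. int (card {s \<in> D. T s = Wpos i}) = int (lam i) - int (mu i) \<and>
                  int (card {s \<in> D. T s = Npos i}) = int (nu i) - int (rho i)) \<and>
           (\<forall>i. Suc i < n \<longrightarrow>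
              has_disjoint_ne_pairs D T (common_columns lam mu i) (Wpos i) (Wpos (Suc i)) \<and>
              has_disjoint_ne_pairs D T (common_columns nu rho i) (Npos i) (Npos (Suc i)))})"

end

theory Submission
  imports Defs "HOL-Combinatorics.Permutations"
begin

text \<open>
  Both sides of the identity are signed counts that collapse under sign-reversing involutions; the
  Cauchy identity joins them.

  Let \<open>alternant n lam\<close> be the alternating function on vectors that is \<open>1\<close> at \<open>lam\<close> plus the staircase
  and \<open>0\<close> off the permutations of this vector, and let \<open>G c\<close> be the product of \<open>alternant n lam\<close> and
  \<open>alternant n nu\<close> at the shifted partitions \<open>mu\<close> and \<open>rho\<close>, increased by the entries of \<open>c\<close> at the positions of the letters \<open>W\<close> and \<open>N\<close>. By the
  Jacobi--Trudi identity (\<open>skew_kostka\<close>), the coefficient of a monomial in the product of the two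
  skew Schur functions is the sum of \<open>G (row sums)\<close> over all matrices of natural numbers with \<open>2 n\<close>
  rows and with the exponents of the monomial as column sums. By the Cauchy identity (\<open>cauchy\<close>, proved
  through the local rule of the Robinson--Schensted--Knuth correspondence), this is the sum over all
  \<open>kap\<close> of the coefficient of the monomial in the Schur function of \<open>kap\<close> times the sum of \<open>G (content T)\<close>
  over all tableaux \<open>T\<close> of shape \<open>kap\<close> with entries at most \<open>2 n\<close>. By the
  linear independence of Schur functions (\<open>schur_expansion_unique\<close>), the last sum is the
  Littlewood--Richardson coefficient.

  It remains to see that this sum counts peelable tableaux (\<open>tabsum_peelable\<close>). Being Northeast is
  a condition on columns only, so for the required content the pairing conditions say that \<open>mu\<close> plus the numbers of \<open>W\<close> entries
  in the columns from \<open>j\<close> on is a partition for every \<open>j\<close>, and likewise for \<open>rho\<close> and \<open>N\<close>. A tableau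
  that violates this, at a column \<open>j\<close> as far right as possible and for consecutive letters \<open>x\<close> and \<open>y\<close> of
  one kind, is cancelled by the tableau in which the numbers of \<open>x\<close> and \<open>y\<close> to the left of \<open>j\<close> are
  exchanged (\<open>cancel_violations\<close>). In the words \<open>P\<^sub>k\<close> at most one letter stands between \<open>x\<close> and
  \<open>y\<close>, and then the exchange, by one or three Bender--Knuth involutions, never conflicts with
  the entries in column \<open>j\<close> (\<open>swap_letters\<close>). For the remaining tableaux the vectors are strictly
  decreasing, and \<open>G\<close> is \<open>1\<close> or \<open>0\<close> according to whether the content is the required one.
\<close>

section \<open>Partitions and horizontal strips\<close>

definition psize :: "(nat \<Rightarrow> nat) \<Rightarrow> nat" where
  "psize p = (\<Sum>i | p i \<noteq> 0. p i)"

definition hstrip :: "(nat \<Rightarrow> nat) \<Rightarrow> (nat \<Rightarrow> nat) \<Rightarrow> bool" where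
  "hstrip p q \<longleftrightarrow> (\<forall>i. p i \<le> q i \<and> q (Suc i) \<le> p i)"

lemma psize_eq_sum:
  assumes "\<And>i. i \<ge> L \<Longrightarrow> p i = 0"
  shows "psize p = sum p {..<L}"
proof -
  have "{i. p i \<noteq> 0} \<subseteq> {..<L}" by (rule subsetI, rule ccontr) (use assms in auto)
  thus ?thesis unfolding psize_def by (intro sum.mono_neutral_left) auto
qed

lemma partition_bound:
  assumes "is_partition p" obtains L where "\<And>i. i \<ge> L \<Longrightarrow> p i = 0"
proof -
  have "finite {i. p i \<noteq> 0}" using assms by (simp add: is_partition_def)
  then obtain L where "\<forall>i\<in>{i. p i \<noteq> 0}. i < L" using finite_nat_set_iff_bounded by blast
  thus ?thesis using that[of L] by (metis (mono_tags, lifting) mem_Collect_eq not_le)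
qed

lemma is_partitionI:
  assumes "\<And>i. p (Suc i) \<le> p i" and "\<And>i. i \<ge> L \<Longrightarrow> p i = 0"
  shows "is_partition p"
proof -
  have "{i. p i \<noteq> 0} \<subseteq> {..<L}" by (rule subsetI, rule ccontr) (use assms(2) in auto)
  thus ?thesis unfolding is_partition_def
    using assms(1) by (auto simp: antimono_iff_le_Suc intro: finite_subset)
qed

lemma is_partition_antimono: "is_partition p \<Longrightarrow> i \<le> j \<Longrightarrow> p j \<le> p i"
  by (simp add: is_partition_def antimono_def)

lemma is_partition_zero [simp]: "is_partition (\<lambda>_. 0)"
  by (rule is_partitionI) auto

lemma hstrip_le: "hstrip p q \<Longrightarrow> p \<le> q"
  by (simp add: hstrip_def le_fun_def)

lemma hstrip_partition_lower:
  assumes "hstrip p q" "is_partition q" shows "is_partition p"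
proof -
  obtain L where "\<And>i. i \<ge> L \<Longrightarrow> q i = 0" using partition_bound assms(2) by metis
  thus ?thesis using assms(1) unfolding hstrip_def
    by (intro is_partitionI[of _ L]) (use le_trans in \<open>blast, metis le_zero_eq\<close>)
qed

lemma hstrip_partition_upper:
  assumes "hstrip p q" "is_partition p" shows "is_partition q"
proof -
  obtain L where "\<And>i. i \<ge> L \<Longrightarrow> p i = 0" using partition_bound assms(2) by metis
  hence "\<And>i. i \<ge> Suc L \<Longrightarrow> q i = 0" using assms(1) unfolding hstrip_def
    by (metis Suc_le_D Suc_le_mono le_zero_eq)
  thus ?thesis using assms(1) unfolding hstrip_def
    by (intro is_partitionI[of _ "Suc L"]) (use le_trans in \<open>blast, blast\<close>)
qed

lemma psize_mono:
  assumes "p \<le> q" "is_partition q" shows "psize p \<le> psize q"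
proof -
  obtain L where L: "\<And>i. i \<ge> L \<Longrightarrow> q i = 0" using partition_bound assms(2) by metis
  moreover have "\<And>i. i \<ge> L \<Longrightarrow> p i = 0" using L assms(1) by (metis le_fun_def le_zero_eq)
  ultimately show ?thesis using assms(1) psize_eq_sum[of L] by (simp add: le_fun_def sum_mono)
qed

lemma psize_zero [simp]: "psize (\<lambda>_. 0) = 0"
  by (simp add: psize_def)

text \<open>A part is at most the size, and so is the number of nonzero parts.\<close>

lemma finite_partitions_of_size: "finite {p. is_partition p \<and> psize p \<le> S}"
proof (rule finite_subset)
  show "finite {p :: nat \<Rightarrow> nat. \<forall>i. (i \<in> {..<S} \<longrightarrow> p i \<in> {..S}) \<and> (i \<notin> {..<S} \<longrightarrow> p i = 0)}"
    by (rule finite_set_of_finite_funs) auto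
next
  show "{p. is_partition p \<and> psize p \<le> S} \<subseteq>
     {p. \<forall>i. (i \<in> {..<S} \<longrightarrow> p i \<in> {..S}) \<and> (i \<notin> {..<S} \<longrightarrow> p i = 0)}"
  proof clarify
    fix p i assume p: "is_partition p" "psize p \<le> S"
    have fin: "finite {i. p i \<noteq> 0}" using p by (simp add: is_partition_def)
    have le: "p i \<le> psize p"
    proof (cases "p i = 0")
      case False
      thus ?thesis unfolding psize_def using member_le_sum[of i "{i. p i \<noteq> 0}" p] fin by auto
    qed simp
    have "p i = 0" if "i \<ge> S"
    proof (rule ccontr)
      assume nz: "p i \<noteq> 0"
      have sub: "{..i} \<subseteq> {i. p i \<noteq> 0}" using nz is_partition_antimono[OF p(1)]
        by (metis (mono_tags, lifting) atMost_iff le_zero_eq mem_Collect_eq subsetI)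
      have "card {..i} \<le> sum p {..i}"
        using sum_mono[of "{..i}" "\<lambda>_. 1" p] sub by (force simp: Suc_le_eq)
      also have "\<dots> \<le> psize p" unfolding psize_def using sub fin by (intro sum_mono2) auto
      finally show False using that p(2) by simp
    qed
    thus "(i \<in> {..<S} \<longrightarrow> p i \<in> {..S}) \<and> (i \<notin> {..<S} \<longrightarrow> p i = 0)"
      using le p(2) by auto
  qed
qed

lemma finite_below_partition: "is_partition q \<Longrightarrow> finite {p. is_partition p \<and> p \<le> q}"
  by (rule finite_subset[OF _ finite_partitions_of_size[of "psize q"]]) (auto simp: psize_mono)

lemma finite_skew_diagram: assumes "is_partition q" shows "finite (skew_diagram q p)"
proof -
  obtain L where L: "\<And>i. i \<ge> L \<Longrightarrow> q i = 0" using partition_bound assms by metis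
  have "skew_diagram q p \<subseteq> {..<L} \<times> {..<q 0}"
  proof (clarsimp simp: skew_diagram_def)
    fix i j assume "j < q i"
    moreover have "q i \<le> q 0" using assms is_partition_antimono by blast
    ultimately show "i < L \<and> j < q 0" using L[of i] by (metis less_le_trans not_le not_less_zero)
  qed
  thus ?thesis by (meson finite_SigmaI finite_lessThan finite_subset)
qed

lemma skew_diagram_same [simp]: "skew_diagram p p = {}"
  by (auto simp: skew_diagram_def)

lemma card_skew_diagram_psize:
  assumes "p \<le> q" "is_partition q"
  shows "card (skew_diagram q p) = psize q - psize p"
proof -
  obtain L where L: "\<And>i. i \<ge> L \<Longrightarrow> q i = 0" using partition_bound assms(2) by metis
  have Lp: "\<And>i. i \<ge> L \<Longrightarrow> p i = 0" using L assms(1) by (metis le_fun_def le_zero_eq)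
  have "skew_diagram q p = Sigma {..<L} (\<lambda>i. {p i..<q i})"
    using L by (force simp: skew_diagram_def not_le[symmetric])
  hence "card (skew_diagram q p) = (\<Sum>i<L. q i - p i)" by simp
  also have "\<dots> = sum q {..<L} - sum p {..<L}"
    using assms(1) by (intro sum_subtractf_nat) (simp add: le_fun_def)
  finally show ?thesis using psize_eq_sum[of L, OF L] psize_eq_sum[of L, OF Lp] by simp
qed

section \<open>Tableaux as chains of partitions\<close>

text \<open>
  The entries at most \<open>x\<close> of a tableau of shape \<open>kap/mu\<close> fill a diagram \<open>P x / mu\<close>, and column
  strictness says exactly that consecutive \<open>P x\<close> differ by horizontal strips. Chains make both
  removing the largest letter and changing the cells of a single letter one-line operations.
  They are constant from \<open>m\<close> on, so that the tableau determines the chain.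
\<close>

definition strip_chains :: "nat \<Rightarrow> (nat \<Rightarrow> nat) \<Rightarrow> (nat \<Rightarrow> nat) \<Rightarrow> (nat \<Rightarrow> nat \<Rightarrow> nat) set" where
  "strip_chains m mu kap =
     {P. P 0 = mu \<and> (\<forall>x\<ge>m. P x = kap) \<and> (\<forall>x<m. hstrip (P x) (P (Suc x)))}"

text \<open>
  The cells of the letter \<open>x\<close>. As \<open>0 - 1 = 0\<close>, the letter \<open>0\<close> has none.
\<close>

definition strip :: "(nat \<Rightarrow> nat \<Rightarrow> nat) \<Rightarrow> nat \<Rightarrow> (nat \<times> nat) set" where
  "strip P x = skew_diagram (P x) (P (x - 1))"

definition weight :: "(nat \<Rightarrow> nat \<Rightarrow> nat) \<Rightarrow> nat \<Rightarrow> nat" where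
  "weight P x = card (strip P x)"

definition tableau_of :: "(nat \<times> nat) set \<Rightarrow> (nat \<Rightarrow> nat \<Rightarrow> nat) \<Rightarrow> nat \<times> nat \<Rightarrow> nat" where
  "tableau_of D P = restrict (\<lambda>(i, j). LEAST x. j < P x i) D"

lemma strip_chains_step:
  assumes "P \<in> strip_chains m mu kap" shows "P x i \<le> P (Suc x) i"
  using assms by (cases "x < m") (auto simp: strip_chains_def hstrip_def)

lemma strip_chains_mono:
  assumes "P \<in> strip_chains m mu kap" "x \<le> y" shows "P x i \<le> P y i"
  using assms(2) strip_chains_step[OF assms(1)] by (induction rule: dec_induct) (auto intro: le_trans)

lemma strip_chains_le: "P \<in> strip_chains m mu kap \<Longrightarrow> P x i \<le> kap i"
  using strip_chains_mono[of P m mu kap x "max x m" i] by (simp add: strip_chains_def)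

lemma strip_chains_ge: "P \<in> strip_chains m mu kap \<Longrightarrow> mu i \<le> P x i"
  using strip_chains_mono[of P m mu kap 0 x i] by (simp add: strip_chains_def)

lemma strip_chains_partition:
  assumes P: "P \<in> strip_chains m mu kap" and kap: "is_partition kap"
  shows "is_partition (P x)"
proof (cases "x \<le> m")
  case True
  thus ?thesis
  proof (induction rule: inc_induct)
    case base
    then show ?case using P kap by (simp add: strip_chains_def)
  next
    case (step y)
    hence "hstrip (P y) (P (Suc y))" using P by (simp add: strip_chains_def)
    thus ?case using step.IH hstrip_partition_lower by blast
  qed
next
  case False
  thus ?thesis using P kap by (simp add: strip_chains_def)
qed

lemma strip_chains_interlace:
  assumes P: "P \<in> strip_chains m mu kap" and kap: "is_partition kap"
  shows "P (Suc x) (Suc i) \<le> P x i"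
proof (cases "x < m")
  case True
  thus ?thesis using P by (auto simp: strip_chains_def hstrip_def)
next
  case False
  thus ?thesis using P is_partition_antimono[OF kap, of i "Suc i"] by (simp add: strip_chains_def)
qed

lemma strip_chains_hstrip:
  assumes P: "P \<in> strip_chains m mu kap" and kap: "is_partition kap"
  shows "hstrip (P (x - 1)) (P x)"
  using strip_chains_interlace[OF P kap, of "x - 1"] strip_chains_step[OF P, of "x - 1"]
    is_partition_antimono[OF strip_chains_partition[OF P kap], of _ "Suc _" 0]
  by (cases x) (auto simp: hstrip_def)

lemma finite_strip: "P \<in> strip_chains m mu kap \<Longrightarrow> is_partition kap \<Longrightarrow> finite (strip P x)"
  unfolding strip_def by (intro finite_skew_diagram strip_chains_partition)

lemma tableau_of_le_iff:
  assumes P: "P \<in> strip_chains m mu kap" and s: "(i, j) \<in> skew_diagram kap mu"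
  shows "tableau_of (skew_diagram kap mu) P (i, j) \<le> x \<longleftrightarrow> j < P x i"
proof -
  have j: "j < P m i" using P s by (simp add: strip_chains_def skew_diagram_def)
  have "(LEAST y. j < P y i) \<le> x \<longleftrightarrow> j < P x i"
  proof
    assume "(LEAST y. j < P y i) \<le> x"
    moreover have "j < P (LEAST y. j < P y i) i" using j by (rule LeastI)
    ultimately show "j < P x i" using strip_chains_mono[OF P] less_le_trans by blast
  qed (rule Least_le)
  thus ?thesis using s by (simp add: tableau_of_def)
qed

text \<open>
  For surjectivity, row \<open>i\<close> of \<open>P x\<close> ends at the first column whose entry exceeds \<open>x\<close>.
\<close>

lemma bij_betw_tableau_of:
  assumes kap: "is_partition kap" and mu: "is_partition mu" and le: "mu \<le> kap"
  shows "bij_betw (tableau_of (skew_diagram kap mu)) (strip_chains m mu kap)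
           (ssyt {1..m} (skew_diagram kap mu))"
  unfolding bij_betw_def
proof (intro conjI equalityI subsetI)
  let ?D = "skew_diagram kap mu"
  show "inj_on (tableau_of ?D) (strip_chains m mu kap)"
  proof (rule inj_onI, intro ext)
    fix P Q x i assume P: "P \<in> strip_chains m mu kap" and Q: "Q \<in> strip_chains m mu kap"
      and eq: "tableau_of ?D P = tableau_of ?D Q"
    have *: "P' x i \<le> Q' x i" if "P' \<in> strip_chains m mu kap" "Q' \<in> strip_chains m mu kap"
      "tableau_of ?D P' = tableau_of ?D Q'" for P' Q'
    proof (rule ccontr)
      assume "\<not> P' x i \<le> Q' x i"
      hence lt: "Q' x i < P' x i" by simp
      hence "(i, Q' x i) \<in> ?D" using strip_chains_le[OF that(1), of x i] strip_chains_ge[OF that(2), of i x]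
        by (simp add: skew_diagram_def)
      from tableau_of_le_iff[OF that(1) this, of x] tableau_of_le_iff[OF that(2) this, of x] that(3) lt
      show False by simp
    qed
    show "P x i = Q x i" using *[OF P Q eq] *[OF Q P eq[symmetric]] by simp
  qed
  {
    fix T assume "T \<in> tableau_of ?D ` strip_chains m mu kap"
    then obtain P where P: "P \<in> strip_chains m mu kap" and T: "T = tableau_of ?D P" by blast
    note iff = tableau_of_le_iff[OF P, folded T]
    have pos: "T (i, j) \<ge> 1" if "(i, j) \<in> ?D" for i j
    proof -
      have "\<not> T (i, j) \<le> 0" unfolding iff[OF that] using P that
        by (simp add: strip_chains_def skew_diagram_def)
      thus ?thesis by simp
    qed
    have up: "T (i, j) \<le> m" if "(i, j) \<in> ?D" for i j
      unfolding iff[OF that] using P that by (simp add: strip_chains_def skew_diagram_def)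
    show "T \<in> ssyt {1..m} ?D"
      unfolding ssyt_def
    proof (intro CollectI conjI allI impI)
      show "T \<in> ?D \<rightarrow>\<^sub>E {1..m}" using pos up unfolding T
        by (auto simp: PiE_def extensional_def tableau_of_def)
    next
      fix i j j' assume a: "(i, j) \<in> ?D" "(i, j') \<in> ?D" "j < j'"
      have "j' < P (T (i, j')) i" using iff[OF a(2)] by blast
      thus "T (i, j) \<le> T (i, j')" unfolding iff[OF a(1)] using a(3) by simp
    next
      fix i i' j assume a: "(i, j) \<in> ?D" "(i', j) \<in> ?D" "i < i'"
      obtain x where x: "T (i', j) = Suc x" using pos[OF a(2)] by (metis Suc_le_D One_nat_def)
      have "j < P (Suc x) i'" using iff[OF a(2), of "Suc x"] x by simp
      also have "\<dots> \<le> P (Suc x) (Suc i)"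
        using is_partition_antimono[OF strip_chains_partition[OF P kap]] a(3) by simp
      also have "\<dots> \<le> P x i" by (rule strip_chains_interlace[OF P kap])
      finally show "T (i, j) < T (i', j)" using iff[OF a(1), of x] x by simp
    qed
  }
  {
    fix T assume T: "T \<in> ssyt {1..m} ?D"
    have row: "T (i, j) \<le> T (i, j')" if "(i, j) \<in> ?D" "(i, j') \<in> ?D" "j \<le> j'" for i j j'
      using T that by (cases "j = j'") (auto simp: ssyt_def)
    have col: "T (i, j) < T (i', j)" if "(i, j) \<in> ?D" "(i', j) \<in> ?D" "i < i'" for i i' j
      using T that by (auto simp: ssyt_def)
    have rng: "T s \<in> {1..m}" if "s \<in> ?D" for s using T that by (auto simp: ssyt_def)
    define P where "P = (\<lambda>x i. LEAST j. mu i \<le> j \<and> (kap i \<le> j \<or> x < T (i, j)))"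
    have PI: "mu i \<le> P x i \<and> (kap i \<le> P x i \<or> x < T (i, P x i))" for x i
      unfolding P_def
      by (rule LeastI[where P = "\<lambda>j. mu i \<le> j \<and> (kap i \<le> j \<or> x < T (i, j))" and k = "kap i"])
         (use le in \<open>auto simp: le_fun_def\<close>)
    have Pk: "P x i \<le> kap i" for x i unfolding P_def
      by (rule Least_le) (use le in \<open>auto simp: le_fun_def\<close>)
    have iff: "j < P x i \<longleftrightarrow> T (i, j) \<le> x" if D: "(i, j) \<in> ?D" for i j x
    proof
      assume "j < P x i"
      thus "T (i, j) \<le> x" unfolding P_def using D by (auto dest!: not_less_Least simp: skew_diagram_def)
    next
      assume Tx: "T (i, j) \<le> x"
      show "j < P x i"
      proof (rule ccontr)
        assume "\<not> j < P x i"
        hence lej: "P x i \<le> j" by simp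
        hence mem: "(i, P x i) \<in> ?D" using PI[of i x] D by (auto simp: skew_diagram_def)
        hence "x < T (i, P x i)" using PI[of i x] by (auto simp: skew_diagram_def)
        also have "\<dots> \<le> T (i, j)" using row[OF mem D lej] .
        finally show False using Tx by simp
      qed
    qed
    have P: "P \<in> strip_chains m mu kap"
      unfolding strip_chains_def hstrip_def
    proof (intro CollectI conjI allI impI)
      show "P 0 = mu"
      proof (rule ext, rule ccontr)
        fix i assume "P 0 i \<noteq> mu i"
        hence "mu i < P 0 i" using PI[of i 0] by simp
        moreover from this have "(i, mu i) \<in> ?D" using Pk[of 0 i] by (simp add: skew_diagram_def)
        ultimately show False using iff[of i "mu i" 0] rng[of "(i, mu i)"] by simp
      qed
    next
      fix x assume x: "m \<le> x"
      show "P x = kap"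
      proof (rule ext, rule ccontr)
        fix i assume "P x i \<noteq> kap i"
        hence lt: "P x i < kap i" using Pk[of x i] by simp
        hence "(i, P x i) \<in> ?D" using PI[of i x] by (simp add: skew_diagram_def)
        thus False using rng[of "(i, P x i)"] PI[of i x] lt x by auto
      qed
    next
      fix x i
      show "P x i \<le> P (Suc x) i"
      proof (rule ccontr)
        assume "\<not> P x i \<le> P (Suc x) i"
        hence lt: "P (Suc x) i < P x i" by simp
        hence "(i, P (Suc x) i) \<in> ?D" using PI[of i "Suc x"] Pk[of x i] by (simp add: skew_diagram_def)
        thus False using iff[of i "P (Suc x) i" x] iff[of i "P (Suc x) i" "Suc x"] lt by simp
      qed
      show "P (Suc x) (Suc i) \<le> P x i"
      proof (rule ccontr)
        assume "\<not> P (Suc x) (Suc i) \<le> P x i"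
        hence lt: "P x i < P (Suc x) (Suc i)" by simp
        have k: "kap (Suc i) \<le> kap i" "mu (Suc i) \<le> mu i"
          using is_partition_antimono[OF kap] is_partition_antimono[OF mu] by auto
        have D1: "(i, P x i) \<in> ?D" "(Suc i, P x i) \<in> ?D"
          using PI[of i x] Pk[of "Suc x" "Suc i"] lt k by (auto simp: skew_diagram_def)
        have "T (Suc i, P x i) \<le> Suc x" using iff[OF D1(2)] lt by simp
        hence "T (i, P x i) \<le> x" using col[OF D1] by simp
        thus False using iff[OF D1(1), of x] by simp
      qed
    qed
    have "T s = tableau_of ?D P s" for s
    proof (cases "s \<in> ?D")
      case True
      obtain i j where s: "s = (i, j)" by force
      have "tableau_of ?D P s \<le> x \<longleftrightarrow> T s \<le> x" for x
        using tableau_of_le_iff[OF P, of i j x] iff[of i j x] True s by simp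
      thus ?thesis by (meson order_antisym order_refl)
    next
      case False
      have "T \<in> ?D \<rightarrow>\<^sub>E {1..m}" using T by (simp add: ssyt_def)
      hence "T s = undefined" using False by (rule PiE_arb)
      thus ?thesis using False by (simp add: tableau_of_def)
    qed
    hence "T = tableau_of ?D P" by (rule ext)
    thus "T \<in> tableau_of ?D ` strip_chains m mu kap" using P by blast
  }
qed

lemma tableau_of_letter:
  assumes P: "P \<in> strip_chains m mu kap" and x: "x \<ge> 1"
  shows "{s \<in> skew_diagram kap mu. tableau_of (skew_diagram kap mu) P s = x} = strip P x"
proof (intro equalityI subsetI)
  fix s assume s: "s \<in> {s \<in> skew_diagram kap mu. tableau_of (skew_diagram kap mu) P s = x}"
  obtain i j where ij: "s = (i, j)" by force
  have D: "(i, j) \<in> skew_diagram kap mu" and T: "tableau_of (skew_diagram kap mu) P (i, j) = x"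
    using s ij by auto
  show "s \<in> strip P x"
    using tableau_of_le_iff[OF P D, of x] tableau_of_le_iff[OF P D, of "x - 1"] T x ij
    by (auto simp: strip_def skew_diagram_def)
next
  fix s assume s: "s \<in> strip P x"
  obtain i j where ij: "s = (i, j)" by force
  have j: "P (x - 1) i \<le> j" "j < P x i" using s ij by (auto simp: strip_def skew_diagram_def)
  have D: "(i, j) \<in> skew_diagram kap mu"
    using j strip_chains_le[OF P, of x i] strip_chains_ge[OF P, of i "x - 1"] by (simp add: skew_diagram_def)
  show "s \<in> {s \<in> skew_diagram kap mu. tableau_of (skew_diagram kap mu) P s = x}"
    using tableau_of_le_iff[OF P D, of x] tableau_of_le_iff[OF P D, of "x - 1"] j D x ij by auto
qed

lemma weight_outside:
  assumes "P \<in> strip_chains m mu kap" "x \<notin> {1..m}"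
  shows "weight P x = 0"
proof -
  have "P x = P (x - 1)" using assms by (cases "x = 0") (auto simp: strip_chains_def)
  thus ?thesis by (simp add: weight_def strip_def)
qed

lemma finite_strip_chains:
  assumes kap: "is_partition kap" shows "finite (strip_chains m mu kap)"
proof (cases "is_partition mu \<and> mu \<le> kap")
  case True
  have "finite (ssyt {1..m} (skew_diagram kap mu))"
    by (rule finite_subset[of _ "skew_diagram kap mu \<rightarrow>\<^sub>E {1..m}"])
       (auto simp: ssyt_def intro!: finite_PiE finite_skew_diagram kap)
  thus ?thesis using bij_betw_finite[OF bij_betw_tableau_of[OF kap]] True by blast
next
  case False
  have "strip_chains m mu kap = {}"
  proof (rule ccontr)
    assume "strip_chains m mu kap \<noteq> {}"
    then obtain P where P: "P \<in> strip_chains m mu kap" by blast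
    have "P 0 = mu" using P by (simp add: strip_chains_def)
    thus False using strip_chains_partition[OF P kap, of 0] strip_chains_le[OF P, of 0] False
      by (auto simp: le_fun_def)
  qed
  thus ?thesis by simp
qed

lemma finite_hstrip_below: "is_partition kap \<Longrightarrow> finite {gam. hstrip gam kap}"
  by (rule finite_subset[OF _ finite_below_partition[of kap]])
     (auto simp: hstrip_le hstrip_partition_lower[of _ kap])

text \<open>Dropping the last step of a chain removes the largest letter of a tableau.\<close>

lemma sum_strip_chains_Suc:
  fixes f :: "(nat \<Rightarrow> nat) \<Rightarrow> int"
  assumes kap: "is_partition kap"
  shows "(\<Sum>P\<in>strip_chains (Suc m) mu kap. f (weight P)) =
     (\<Sum>gam | hstrip gam kap. \<Sum>P\<in>strip_chains m mu gam.
        f ((weight P)(Suc m := psize kap - psize gam)))"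
proof -
  have "(\<Sum>gam | hstrip gam kap. \<Sum>P\<in>strip_chains m mu gam.
          f ((weight P)(Suc m := psize kap - psize gam))) =
     (\<Sum>(gam, P)\<in>Sigma {gam. hstrip gam kap} (strip_chains m mu).
          f ((weight P)(Suc m := psize kap - psize gam)))"
    by (subst sum.Sigma)
       (auto intro!: finite_hstrip_below finite_strip_chains hstrip_partition_lower[OF _ kap] kap)
  also have "\<dots> = (\<Sum>P\<in>strip_chains (Suc m) mu kap. f (weight P))"
  proof (rule sum.reindex_bij_witness
      [where i = "\<lambda>P. (P m, \<lambda>x. P (min x m))" and j = "\<lambda>(gam, P). \<lambda>x. if x \<le> m then P x else kap"],
      goal_cases)
    case (1 a)
    then obtain gam P where a: "a = (gam, P)" and P: "P \<in> strip_chains m mu gam" by auto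
    show ?case using P unfolding a by (auto simp: strip_chains_def min_def)
  next
    case (2 a)
    then obtain gam P where a: "a = (gam, P)" and P: "P \<in> strip_chains m mu gam" and h: "hstrip gam kap"
      by auto
    have [simp]: "P 0 = mu" "P m = gam" using P by (auto simp: strip_chains_def)
    show ?case using P h unfolding a by (auto simp: strip_chains_def less_Suc_eq_le Suc_le_eq)
  next
    case (3 P)
    show ?case using 3 by (auto simp: strip_chains_def min_def not_le)
  next
    case (4 P)
    thus ?case by (auto simp: strip_chains_def min_def)
  next
    case (5 a)
    then obtain gam P where a: "a = (gam, P)" and P: "P \<in> strip_chains m mu gam" and h: "hstrip gam kap"
      by auto
    have [simp]: "P 0 = mu" "P m = gam" using P by (auto simp: strip_chains_def)
    have "card (skew_diagram kap gam) = psize kap - psize gam"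
      by (rule card_skew_diagram_psize[OF hstrip_le[OF h] kap])
    moreover have "weight P x = 0" if "x > m" for x by (rule weight_outside[OF P]) (use that in auto)
    ultimately have "weight (\<lambda>x. if x \<le> m then P x else kap) =
        (weight P)(Suc m := psize kap - psize gam)"
      by (auto simp: weight_def strip_def fun_eq_iff)
    thus ?case by (simp add: a)
  qed
  finally show ?thesis by simp
qed

section \<open>The Pieri rule and the Cauchy identity\<close>

definition ups :: "(nat \<Rightarrow> nat) \<Rightarrow> nat \<Rightarrow> (nat \<Rightarrow> nat) set" where
  "ups p s = {q. hstrip p q \<and> psize q = psize p + s}"

lemma ups_partition: "is_partition p \<Longrightarrow> q \<in> ups p s \<Longrightarrow> is_partition q"
  unfolding ups_def using hstrip_partition_upper by blast

lemma finite_ups: "is_partition p \<Longrightarrow> finite (ups p s)"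
  by (rule finite_subset[OF _ finite_partitions_of_size[of "psize p + s"]])
     (auto simp: ups_def hstrip_partition_upper)

lemma psize_hstrip: "hstrip p q \<Longrightarrow> is_partition q \<Longrightarrow> psize p \<le> psize q"
  using psize_mono hstrip_le by blast

text \<open>
  The local rule behind the Robinson--Schensted--Knuth correspondence. Below and above
  a pair \<open>bet, gam\<close>, the parts \<open>eps i\<close> and \<open>del (Suc i)\<close> range over the same interval, from
  \<open>max (bet (Suc i)) (gam (Suc i))\<close> to \<open>min (bet i) (gam i)\<close>; reflecting this interval exchanges
  them. The first part \<open>del 0\<close> has no counterpart below; its excess is the number \<open>m\<close>.
\<close>

definition reflect :: "(nat \<Rightarrow> nat) \<Rightarrow> (nat \<Rightarrow> nat) \<Rightarrow> nat \<Rightarrow> nat \<Rightarrow> nat" where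
  "reflect bet gam i v = max (bet (Suc i)) (gam (Suc i)) + min (bet i) (gam i) - v"

lemma reflect:
  assumes "max (bet (Suc i)) (gam (Suc i)) \<le> v" and "v \<le> min (bet i) (gam i)"
  shows "max (bet (Suc i)) (gam (Suc i)) \<le> reflect bet gam i v"
    and "reflect bet gam i v \<le> min (bet i) (gam i)"
    and "reflect bet gam i v + v = max (bet (Suc i)) (gam (Suc i)) + min (bet i) (gam i)"
    and "reflect bet gam i (reflect bet gam i v) = v"
  unfolding reflect_def using assms by linarith+

lemma psize_local_rule:
  assumes bet: "is_partition bet" and gam: "is_partition gam"
    and h: "hstrip eps bet" "hstrip eps gam" "hstrip bet del" "hstrip gam del"
    and m: "del 0 = max (bet 0) (gam 0) + m"
    and r: "\<And>i. eps i + del (Suc i) = max (bet (Suc i)) (gam (Suc i)) + min (bet i) (gam i)"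
  shows "psize del + psize eps = psize bet + psize gam + m"
proof -
  obtain L1 where L1: "\<And>i. i \<ge> L1 \<Longrightarrow> bet i = 0" using partition_bound bet by metis
  obtain L2 where L2: "\<And>i. i \<ge> L2 \<Longrightarrow> gam i = 0" using partition_bound gam by metis
  define L where "L = max L1 L2"
  have zb: "bet i = 0" "gam i = 0" if "i \<ge> L" for i using that L1 L2 by (auto simp: L_def)
  have ze: "eps i = 0" if "i \<ge> L" for i
    using zb[OF that] h(1) by (metis hstrip_def le_zero_eq)
  have zd: "del i = 0" if "i \<ge> Suc L" for i
    using zb h(3) that by (metis Suc_le_D Suc_le_mono hstrip_def le_zero_eq)
  let ?M = "\<lambda>i. max (bet i) (gam i)" and ?m = "\<lambda>i. min (bet i) (gam i)"
  have "psize del + psize eps = del 0 + (\<Sum>i<L. del (Suc i)) + (\<Sum>i<L. eps i)"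
    using psize_eq_sum[of "Suc L" del] psize_eq_sum[of L eps] zd ze
    by (simp add: sum.lessThan_Suc_shift del: sum.lessThan_Suc)
  also have "\<dots> = m + (?M 0 + (\<Sum>i<L. ?M (Suc i))) + (\<Sum>i<L. ?m i)"
    using m r by (simp add: sum.distrib[symmetric] add_ac)
  also have "?M 0 + (\<Sum>i<L. ?M (Suc i)) = (\<Sum>i<Suc L. ?M i)"
    by (simp only: sum.lessThan_Suc_shift)
  also have "\<dots> = (\<Sum>i<L. ?M i)" using zb by simp
  also have "m + (\<Sum>i<L. ?M i) + (\<Sum>i<L. ?m i) = m + (\<Sum>i<L. bet i + gam i)"
    by (simp add: sum.distrib[symmetric] max_def min_def if_distrib cong: if_cong)
       (rule sum.cong, auto)
  also have "\<dots> = psize bet + psize gam + m"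
    using psize_eq_sum[of L bet] psize_eq_sum[of L gam] zb by (simp add: sum.distrib)
  finally show ?thesis .
qed

lemma local_rule_down:
  assumes bet: "is_partition bet" and gam: "is_partition gam"
    and d: "hstrip bet del" "hstrip gam del"
    and eps: "eps = (\<lambda>i. reflect bet gam i (del (Suc i)))"
    and m: "m = del 0 - max (bet 0) (gam 0)"
  shows "hstrip eps bet" "hstrip eps gam" "psize del + psize eps = psize bet + psize gam + m"
proof -
  have dd: "max (bet (Suc i)) (gam (Suc i)) \<le> del (Suc i)" "del (Suc i) \<le> min (bet i) (gam i)" for i
    using d by (auto simp: hstrip_def)
  have S: "eps i = reflect bet gam i (del (Suc i))" for i by (simp add: eps)
  note r = reflect[of bet i gam "del (Suc i)" for i, OF dd, folded S]
  show e: "hstrip eps bet" "hstrip eps gam" using r(1,2) by (auto simp: hstrip_def)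
  show "psize del + psize eps = psize bet + psize gam + m"
    by (rule psize_local_rule[OF bet gam e d _ r(3)]) (use d in \<open>auto simp: m hstrip_def\<close>)
qed

lemma local_rule_up:
  assumes bet: "is_partition bet" and gam: "is_partition gam"
    and e: "hstrip eps bet" "hstrip eps gam"
    and del: "del = (\<lambda>i. case i of 0 \<Rightarrow> max (bet 0) (gam 0) + m | Suc i \<Rightarrow> reflect bet gam i (eps i))"
  shows "hstrip bet del" "hstrip gam del" "psize del + psize eps = psize bet + psize gam + m"
proof -
  have ee: "max (bet (Suc i)) (gam (Suc i)) \<le> eps i" "eps i \<le> min (bet i) (gam i)" for i
    using e by (auto simp: hstrip_def)
  have S: "del (Suc i) = reflect bet gam i (eps i)" and 0: "del 0 = max (bet 0) (gam 0) + m" for i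
    by (simp_all add: del)
  note r = reflect[of bet i gam "eps i" for i, OF ee, folded S]
  have "bet i \<le> del i \<and> gam i \<le> del i" for i
    using 0 r(1) by (cases i) auto
  thus d: "hstrip bet del" "hstrip gam del" using r(2) by (auto simp: hstrip_def)
  show "psize del + psize eps = psize bet + psize gam + m"
    by (rule psize_local_rule[OF bet gam e d 0]) (use r(3) in \<open>simp add: add.commute\<close>)
qed

lemma local_rule:
  fixes F :: "(nat \<Rightarrow> nat) \<Rightarrow> nat \<Rightarrow> int"
  assumes bet: "is_partition bet"
  shows "(\<Sum>del\<in>ups bet s. \<Sum>gam | hstrip gam del. F gam (psize del - psize gam)) =
    (\<Sum>eps | hstrip eps bet. \<Sum>m\<le>s. \<Sum>gam\<in>ups eps (s - m). F gam (psize bet - psize eps + m))"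
    (is "?L = ?R")
proof -
  let ?A = "Sigma (ups bet s) (\<lambda>del. {gam. hstrip gam del})"
  let ?B = "Sigma {eps. hstrip eps bet} (\<lambda>eps. Sigma {..s} (\<lambda>m. ups eps (s - m)))"
  have "?L = (\<Sum>(del, gam)\<in>?A. F gam (psize del - psize gam))"
    by (subst sum.Sigma) (auto intro!: finite_ups bet finite_hstrip_below ups_partition[OF bet])
  also have "\<dots> = (\<Sum>(eps, m, gam)\<in>?B. F gam (psize bet - psize eps + m))"
  proof (rule sum.reindex_bij_witness[where
      j = "\<lambda>(del, gam). (\<lambda>i. reflect bet gam i (del (Suc i)), del 0 - max (bet 0) (gam 0), gam)" and
      i = "\<lambda>(eps, m, gam). (\<lambda>i. case i of 0 \<Rightarrow> max (bet 0) (gam 0) + m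
                               | Suc i \<Rightarrow> reflect bet gam i (eps i), gam)"], goal_cases)
    case (1 a)
    then obtain del gam where a: "a = (del, gam)" and d: "hstrip bet del" "hstrip gam del"
      by (auto simp: ups_def)
    have "reflect bet gam i (reflect bet gam i (del (Suc i))) = del (Suc i)" for i
      using d by (intro reflect(4)) (auto simp: hstrip_def)
    thus ?case unfolding a using d by (auto simp: hstrip_def fun_eq_iff split: nat.split)
  next
    case (2 a)
    then obtain del gam where a: "a = (del, gam)" and d: "hstrip bet del" "hstrip gam del"
      and s: "psize del = psize bet + s" by (auto simp: ups_def)
    have gam: "is_partition gam"
      using d hstrip_partition_lower hstrip_partition_upper bet by blast
    note e = local_rule_down[OF bet gam d refl refl]
    show ?case using e s psize_hstrip[OF e(2) gam] by (auto simp: a ups_def)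
  next
    case (3 b)
    then obtain eps m gam where b: "b = (eps, m, gam)" and e: "hstrip eps bet" "hstrip eps gam"
      by (auto simp: ups_def)
    have "reflect bet gam i (reflect bet gam i (eps i)) = eps i" for i
      using e by (intro reflect(4)) (auto simp: hstrip_def)
    thus ?case unfolding b by (auto simp: fun_eq_iff)
  next
    case (4 b)
    then obtain eps m gam where b: "b = (eps, m, gam)" and e: "hstrip eps bet" "hstrip eps gam"
      and m: "m \<le> s" and s: "psize gam = psize eps + (s - m)"
      by (auto simp: ups_def)
    have gam: "is_partition gam"
      using e hstrip_partition_lower hstrip_partition_upper bet by blast
    show ?case using local_rule_up[OF bet gam e refl, of m] s m by (auto simp: b ups_def)
  next
    case (5 a)
    then obtain del gam where a: "a = (del, gam)" and d: "hstrip bet del" "hstrip gam del"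
      and s: "psize del = psize bet + s" by (auto simp: ups_def)
    have gam: "is_partition gam" and del: "is_partition del"
      using d hstrip_partition_lower hstrip_partition_upper bet by blast+
    note e = local_rule_down[OF bet gam d refl refl]
    have "psize bet - psize (\<lambda>i. reflect bet gam i (del (Suc i))) + (del 0 - max (bet 0) (gam 0)) =
        psize del - psize gam"
      using e(3) psize_hstrip[OF e(1) bet] psize_hstrip[OF d(2) del] by linarith
    thus ?case by (simp add: a)
  qed
  also have "\<dots> = ?R"
  proof -
    have part: "is_partition eps" if "hstrip eps bet" for eps
      using hstrip_partition_lower[OF that bet] .
    have "?R = (\<Sum>eps | hstrip eps bet. \<Sum>(m, gam)\<in>Sigma {..s} (\<lambda>m. ups eps (s - m)).
                  F gam (psize bet - psize eps + m))"
      by (intro sum.cong refl sum.Sigma) (auto intro: finite_ups part)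
    also have "\<dots> = (\<Sum>(eps, m, gam)\<in>?B. F gam (psize bet - psize eps + m))"
      by (subst sum.Sigma) (auto intro!: finite_hstrip_below bet finite_SigmaI finite_ups part)
    finally show ?thesis by simp
  qed
  finally show ?thesis .
qed

definition compositions :: "nat set \<Rightarrow> nat \<Rightarrow> (nat \<Rightarrow> nat) set" where
  "compositions I s = {a. (\<forall>i. i \<notin> I \<longrightarrow> a i = 0) \<and> sum a I = s}"

text \<open>
  \<open>hop I s\<close> is dual to multiplication by the complete homogeneous symmetric polynomial of degree
  \<open>s\<close> in variables indexed by \<open>I\<close>: a function \<open>g\<close> of exponent vectors stands for the linear
  functional that sends the monomial with exponents \<open>w\<close> to \<open>g w\<close>.
\<close>

definition hop :: "nat set \<Rightarrow> nat \<Rightarrow> ((nat \<Rightarrow> nat) \<Rightarrow> int) \<Rightarrow> (nat \<Rightarrow> nat) \<Rightarrow> int" where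
  "hop I s g w = (\<Sum>a\<in>compositions I s. g (\<lambda>i. w i + a i))"

primrec hopseq :: "nat set \<Rightarrow> (nat \<Rightarrow> nat) \<Rightarrow> nat \<Rightarrow> ((nat \<Rightarrow> nat) \<Rightarrow> int) \<Rightarrow> (nat \<Rightarrow> nat) \<Rightarrow> int" where
  "hopseq I c 0 g = g"
| "hopseq I c (Suc m) g = hopseq I c m (hop I (c (Suc m)) g)"

text \<open>The value of this functional on the Schur polynomial of \<open>kap\<close> in \<open>r\<close> variables.\<close>

definition tabsum :: "nat \<Rightarrow> ((nat \<Rightarrow> nat) \<Rightarrow> int) \<Rightarrow> (nat \<Rightarrow> nat) \<Rightarrow> int" where
  "tabsum r g kap = (\<Sum>P\<in>strip_chains r (\<lambda>_. 0) kap. g (weight P))"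

lemma finite_compositions: assumes "finite I" shows "finite (compositions I s)"
proof (rule finite_subset)
  show "finite {a :: nat \<Rightarrow> nat. \<forall>i. (i \<in> I \<longrightarrow> a i \<in> {..s}) \<and> (i \<notin> I \<longrightarrow> a i = 0)}"
    using assms by (rule finite_set_of_finite_funs) auto
  show "compositions I s \<subseteq> {a. \<forall>i. (i \<in> I \<longrightarrow> a i \<in> {..s}) \<and> (i \<notin> I \<longrightarrow> a i = 0)}"
    using assms member_le_sum[of _ I] by (auto simp: compositions_def)
qed

lemma hop_insert:
  assumes I: "finite I" and x: "x \<notin> I"
  shows "hop (insert x I) s g (w(x := t)) = (\<Sum>m\<le>s. hop I (s - m) (\<lambda>c. g (c(x := t + m))) w)"
proof -
  have "(\<Sum>m\<le>s. hop I (s - m) (\<lambda>c. g (c(x := t + m))) w) =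
     (\<Sum>(m, a)\<in>Sigma {..s} (\<lambda>m. compositions I (s - m)). g ((\<lambda>i. w i + a i)(x := t + m)))"
    unfolding hop_def by (subst sum.Sigma) (auto simp: finite_compositions I)
  also have "\<dots> = hop (insert x I) s g (w(x := t))"
    unfolding hop_def
  proof (rule sum.reindex_bij_witness[where i = "\<lambda>a. (a x, a(x := 0))" and j = "\<lambda>(m, a). a(x := m)"],
      goal_cases)
    case (1 b)
    thus ?case using x by (auto simp: compositions_def fun_eq_iff)
  next
    case (2 b)
    then obtain m a where b: "b = (m, a)" "m \<le> s" "a \<in> compositions I (s - m)" by auto
    have "sum (a(x := m)) I = sum a I" using x by (intro sum.cong) auto
    thus ?case using b I x by (auto simp: compositions_def)
  next
    case (3 a)
    show ?case by simp
  next
    case (4 a)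
    have "sum (a(x := 0)) I = sum a I" using x by (intro sum.cong) auto
    thus ?case using 4 I x by (auto simp: compositions_def)
  next
    case (5 b)
    then obtain m a where b: "b = (m, a)" by auto
    have "(\<lambda>i. (w(x := t)) i + (a(x := m)) i) = (\<lambda>i. w i + a i)(x := t + m)" by auto
    thus ?case by (simp add: b)
  qed
  finally show ?thesis by simp
qed

lemma tabsum_0:
  "tabsum 0 g kap = (if kap = (\<lambda>_. 0) then g (\<lambda>_. 0) else 0)"
proof (cases "kap = (\<lambda>_. 0)")
  case True
  have "strip_chains 0 (\<lambda>_. 0) (\<lambda>_. 0) = {\<lambda>_ _. 0}" by (auto simp: strip_chains_def)
  moreover have "weight (\<lambda>_ _. 0) = (\<lambda>_. 0)" by (simp add: weight_def strip_def fun_eq_iff)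
  ultimately show ?thesis using True by (simp add: tabsum_def)
next
  case False
  hence "strip_chains 0 (\<lambda>_. 0) kap = {}" by (auto simp: strip_chains_def)
  thus ?thesis using False by (simp add: tabsum_def)
qed

lemma tabsum_Suc:
  "is_partition kap \<Longrightarrow> tabsum (Suc r) g kap =
     (\<Sum>gam | hstrip gam kap. tabsum r (\<lambda>w. g (w(Suc r := psize kap - psize gam))) gam)"
  unfolding tabsum_def by (rule sum_strip_chains_Suc)

text \<open>
  Multiplying a Schur polynomial by a complete homogeneous one adds horizontal strips: by induction
  on the number of variables, where the local rule moves the added strip past that of the last letter.
\<close>

lemma pieri:
  assumes "is_partition bet"
  shows "(\<Sum>del\<in>ups bet s. tabsum r g del) = tabsum r (hop {1..r} s g) bet"
  using assms
proof (induction r arbitrary: g s bet)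
  case 0
  have fin: "finite (ups bet s)" using 0 finite_ups by blast
  have iff: "(\<lambda>_. 0) \<in> ups bet s \<longleftrightarrow> bet = (\<lambda>_. 0) \<and> s = 0"
    by (auto simp: ups_def hstrip_def fun_eq_iff psize_def)
  have h: "hop {1..0} s g (\<lambda>_. 0) = (if s = 0 then g (\<lambda>_. 0) else 0)"
  proof -
    have "compositions {1..0} s = (if s = 0 then {\<lambda>_. 0} else {})" by (auto simp: compositions_def)
    thus ?thesis by (simp add: hop_def)
  qed
  have "(\<Sum>del\<in>ups bet s. tabsum 0 g del) = (if (\<lambda>_. 0) \<in> ups bet s then g (\<lambda>_. 0) else 0)"
    unfolding tabsum_0 using fin by (subst sum.delta) auto
  thus ?case unfolding iff tabsum_0 h by simp
next
  case (Suc r)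
  note bet = Suc.prems
  let ?g = "\<lambda>t w. g (w(Suc r := t))"
  have "(\<Sum>del\<in>ups bet s. tabsum (Suc r) g del) =
     (\<Sum>del\<in>ups bet s. \<Sum>gam | hstrip gam del. tabsum r (?g (psize del - psize gam)) gam)"
    by (intro sum.cong refl tabsum_Suc ups_partition[OF bet])
  also have "\<dots> = (\<Sum>eps | hstrip eps bet. \<Sum>m\<le>s. \<Sum>gam\<in>ups eps (s - m).
                    tabsum r (?g (psize bet - psize eps + m)) gam)"
    by (rule local_rule[OF bet])
  also have "\<dots> = (\<Sum>eps | hstrip eps bet. \<Sum>m\<le>s.
                    tabsum r (hop {1..r} (s - m) (?g (psize bet - psize eps + m))) eps)"
    by (intro sum.cong refl Suc.IH) (auto intro: hstrip_partition_lower[OF _ bet])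
  also have "\<dots> = (\<Sum>eps | hstrip eps bet.
                    tabsum r (\<lambda>w. hop {1..Suc r} s g (w(Suc r := psize bet - psize eps))) eps)"
  proof (intro sum.cong refl)
    fix eps
    have "{1..Suc r} = insert (Suc r) {1..r}" by auto
    hence "hop {1..Suc r} s g (w(Suc r := t)) = (\<Sum>m\<le>s. hop {1..r} (s - m) (?g (t + m)) w)" for w t
      using hop_insert[of "{1..r}" "Suc r"] by simp
    thus "(\<Sum>m\<le>s. tabsum r (hop {1..r} (s - m) (?g (psize bet - psize eps + m))) eps) =
       tabsum r (\<lambda>w. hop {1..Suc r} s g (w(Suc r := psize bet - psize eps))) eps"
      unfolding tabsum_def by (simp only: sum.swap[of _ _ "{..s}"])
  qed
  also have "\<dots> = tabsum (Suc r) (hop {1..Suc r} s g) bet" by (rule tabsum_Suc[OF bet, symmetric])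
  finally show ?case .
qed

text \<open>
  Adding the strips of the letters \<open>1, \<dots>, m\<close> to a shape; like \<open>hopseq\<close>, \<open>upseq\<close> applies the
  operator for the last letter first, because it acts on functions of the resulting shape.
\<close>

definition up :: "nat \<Rightarrow> ((nat \<Rightarrow> nat) \<Rightarrow> int) \<Rightarrow> (nat \<Rightarrow> nat) \<Rightarrow> int" where
  "up s G p = (\<Sum>q\<in>ups p s. G q)"

primrec upseq :: "(nat \<Rightarrow> nat) \<Rightarrow> nat \<Rightarrow> ((nat \<Rightarrow> nat) \<Rightarrow> int) \<Rightarrow> (nat \<Rightarrow> nat) \<Rightarrow> int" where
  "upseq c 0 G = G"
| "upseq c (Suc m) G = upseq c m (up (c (Suc m)) G)"

definition kostka :: "nat \<Rightarrow> (nat \<Rightarrow> nat) \<Rightarrow> (nat \<Rightarrow> nat) \<Rightarrow> (nat \<Rightarrow> nat) \<Rightarrow> nat" where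
  "kostka m kap mu c = card {P \<in> strip_chains m mu kap. \<forall>x\<in>{1..m}. weight P x = c x}"

lemma kostka_0: "kostka 0 kap mu c = (if kap = mu then 1 else 0)"
proof (cases "kap = mu")
  case True
  have "{P \<in> strip_chains 0 mu mu. \<forall>x\<in>{1..0}. weight P x = c x} = {\<lambda>_. mu}" by (auto simp: strip_chains_def)
  thus ?thesis using True by (simp add: kostka_def)
next
  case False
  hence "strip_chains 0 mu kap = {}" by (auto simp: strip_chains_def)
  thus ?thesis using False by (simp add: kostka_def)
qed

lemma kostka_sum:
  assumes "is_partition kap"
  shows "int (kostka m kap mu c) =
     (\<Sum>P\<in>strip_chains m mu kap. if \<forall>x\<in>{1..m}. weight P x = c x then 1 else 0)"
  unfolding kostka_def using finite_strip_chains[OF assms, of m mu]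
  by (simp add: sum.If_cases Int_def)

lemma kostka_Suc:
  assumes kap: "is_partition kap"
  shows "int (kostka (Suc m) kap mu c) =
     (\<Sum>gam | hstrip gam kap \<and> psize kap = psize gam + c (Suc m). int (kostka m gam mu c))"
proof -
  have iff: "(\<forall>x\<in>{1..Suc m}. (w(Suc m := t)) x = c x) \<longleftrightarrow> t = c (Suc m) \<and> (\<forall>x\<in>{1..m}. w x = c x)"
    for w :: "nat \<Rightarrow> nat" and t
    by (auto simp: le_Suc_eq)
  have "int (kostka (Suc m) kap mu c) =
     (\<Sum>gam | hstrip gam kap. \<Sum>P\<in>strip_chains m mu gam.
        if \<forall>x\<in>{1..Suc m}. ((weight P)(Suc m := psize kap - psize gam)) x = c x then 1 else 0)"
    unfolding kostka_sum[OF kap]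
    by (rule sum_strip_chains_Suc[OF kap, where f = "\<lambda>w. if \<forall>x\<in>{1..Suc m}. w x = c x then 1 else 0"])
  also have "\<dots> = (\<Sum>gam | hstrip gam kap.
       if psize kap = psize gam + c (Suc m) then int (kostka m gam mu c) else 0)"
  proof (intro sum.cong refl)
    fix gam assume "gam \<in> {gam. hstrip gam kap}"
    hence h: "hstrip gam kap" by simp
    have gam: "is_partition gam" using hstrip_partition_lower[OF h kap] .
    have "psize kap - psize gam = c (Suc m) \<longleftrightarrow> psize kap = psize gam + c (Suc m)"
      using psize_hstrip[OF h kap] by auto
    thus "(\<Sum>P\<in>strip_chains m mu gam.
        if \<forall>x\<in>{1..Suc m}. ((weight P)(Suc m := psize kap - psize gam)) x = c x then 1 else 0) =
       (if psize kap = psize gam + c (Suc m) then int (kostka m gam mu c) else 0)"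
      unfolding iff kostka_sum[OF gam] by simp
  qed
  also have "\<dots> = (\<Sum>gam | hstrip gam kap \<and> psize kap = psize gam + c (Suc m). int (kostka m gam mu c))"
    using finite_hstrip_below[OF kap] by (simp add: sum.If_cases Int_def)
  finally show ?thesis .
qed

lemma finite_partitions_exact: "finite {p. is_partition p \<and> psize p = S}"
  by (rule finite_subset[OF _ finite_partitions_of_size[of S]]) auto

lemma upseq_kostka:
  assumes mu: "is_partition mu"
  shows "upseq c m G mu =
     (\<Sum>kap | is_partition kap \<and> psize kap = psize mu + sum c {1..m}. int (kostka m kap mu c) * G kap)"
proof (induction m arbitrary: G)
  case 0
  have "(\<Sum>kap | is_partition kap \<and> psize kap = psize mu. int (kostka 0 kap mu c) * G kap) =
        (\<Sum>kap | is_partition kap \<and> psize kap = psize mu. if kap = mu then G kap else 0)"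
    by (intro sum.cong) (auto simp: kostka_0)
  also have "\<dots> = G mu" using mu by (subst sum.delta[OF finite_partitions_exact]) auto
  finally show ?case by simp
next
  case (Suc m)
  let ?S = "\<lambda>m. {kap. is_partition kap \<and> psize kap = psize mu + sum c {1..m}}"
  have fin: "finite (?S m)" for m by (rule finite_partitions_exact)
  have "upseq c (Suc m) G mu = (\<Sum>gam\<in>?S m. int (kostka m gam mu c) * up (c (Suc m)) G gam)"
    using Suc.IH by simp
  also have "\<dots> = (\<Sum>gam\<in>?S m. \<Sum>kap\<in>ups gam (c (Suc m)). int (kostka m gam mu c) * G kap)"
    by (simp add: up_def sum_distrib_left)
  also have "\<dots> = (\<Sum>(gam, kap)\<in>Sigma (?S m) (\<lambda>gam. ups gam (c (Suc m))). int (kostka m gam mu c) * G kap)"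
    by (subst sum.Sigma) (use fin in \<open>auto intro: finite_ups\<close>)
  also have "\<dots> = (\<Sum>(kap, gam)\<in>Sigma (?S (Suc m))
       (\<lambda>kap. {gam. hstrip gam kap \<and> psize kap = psize gam + c (Suc m)}). int (kostka m gam mu c) * G kap)"
    by (rule sum.reindex_bij_witness[where i = prod.swap and j = prod.swap])
       (auto simp: ups_def hstrip_partition_upper hstrip_partition_lower)
  also have "\<dots> = (\<Sum>kap\<in>?S (Suc m). \<Sum>gam | hstrip gam kap \<and> psize kap = psize gam + c (Suc m).
                      int (kostka m gam mu c) * G kap)"
    by (subst sum.Sigma) (use fin[of "Suc m"] in \<open>auto intro: finite_subset[OF _ finite_hstrip_below]\<close>)
  also have "\<dots> = (\<Sum>kap\<in>?S (Suc m). int (kostka (Suc m) kap mu c) * G kap)"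
    by (intro sum.cong refl) (simp add: kostka_Suc sum_distrib_right)
  finally show ?case .
qed

lemma upseq_cong:
  assumes "is_partition mu" and "\<And>kap. is_partition kap \<Longrightarrow> G kap = G' kap"
  shows "upseq c m G mu = upseq c m G' mu"
  unfolding upseq_kostka[OF assms(1)] using assms(2) by (intro sum.cong) auto

text \<open>
  The Cauchy identity, as the expansion of a product of complete homogeneous polynomials into
  Schur polynomials: the factors are absorbed one after the other by the Pieri rule, until only the
  empty shape is left.
\<close>

lemma cauchy:
  "(\<Sum>kap | is_partition kap \<and> psize kap = sum c {1..m}. int (kostka m kap (\<lambda>_. 0) c) * tabsum r g kap) =
     hopseq {1..r} c m g (\<lambda>_. 0)"
proof -
  have up: "up s (tabsum r g) bet = tabsum r (hop {1..r} s g) bet" if "is_partition bet" for s g bet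
    unfolding up_def by (rule pieri[OF that])
  have "upseq c m (tabsum r g) bet = tabsum r (hopseq {1..r} c m g) bet" if "is_partition bet" for bet
  proof (induction m arbitrary: g)
    case (Suc m)
    show ?case using Suc.IH upseq_cong[OF that up] by simp
  qed simp
  hence "upseq c m (tabsum r g) (\<lambda>_. 0) = tabsum r (hopseq {1..r} c m g) (\<lambda>_. 0)" by simp
  also have "\<dots> = hopseq {1..r} c m g (\<lambda>_. 0)"
  proof -
    have "strip_chains r (\<lambda>_. 0) (\<lambda>_. 0) = {\<lambda>_ _. 0}"
    proof (intro equalityI subsetI)
      fix P assume P: "P \<in> strip_chains r (\<lambda>_. 0) (\<lambda>_. 0)"
      show "P \<in> {\<lambda>_ _. 0}" using strip_chains_le[OF P] by (auto simp: fun_eq_iff)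
    qed (auto simp: strip_chains_def hstrip_def)
    moreover have "weight (\<lambda>_ _. 0) = (\<lambda>_. 0)" by (simp add: weight_def strip_def fun_eq_iff)
    ultimately show ?thesis by (simp add: tabsum_def)
  qed
  finally show ?thesis using upseq_kostka[of "\<lambda>_. 0" c m "tabsum r g"] by simp
qed

section \<open>Skew Kostka numbers by straightening\<close>

lemma sum_involution_cancel:
  fixes f :: "'a \<Rightarrow> int"
  assumes "\<And>x. x \<in> A \<Longrightarrow> phi x \<in> A" and "\<And>x. x \<in> A \<Longrightarrow> phi (phi x) = x"
    and "\<And>x. x \<in> A \<Longrightarrow> f (phi x) = - f x"
  shows "sum f A = 0"
proof -
  have "sum f A = (\<Sum>x\<in>A. - f x)"
    by (rule sum.reindex_bij_witness[where i = phi and j = phi]) (use assms in auto)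
  thus ?thesis by (simp add: sum_negf)
qed

definition alternating :: "nat \<Rightarrow> ((nat \<Rightarrow> nat) \<Rightarrow> int) \<Rightarrow> bool" where
  "alternating n g \<longleftrightarrow> (\<forall>w i. Suc i < n \<longrightarrow> g (w \<circ> transpose i (Suc i)) = - g w)"

text \<open>Adding the staircase turns weakly decreasing sequences into strictly decreasing ones.\<close>

definition shifted :: "nat \<Rightarrow> (nat \<Rightarrow> nat) \<Rightarrow> nat \<Rightarrow> nat" where
  "shifted n p = (\<lambda>i. if i < n then p i + (n - i) else 0)"

lemma transpose_permutes: "Suc i < n \<Longrightarrow> transpose i (Suc i) permutes {..<n}"
  by (rule permutes_swap_id) auto

lemma compositions_permute:
  assumes p: "p permutes I" and a: "a \<in> compositions I s"
  shows "a \<circ> p \<in> compositions I s"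
  using a sum.permute[OF p, of a] permutes_in_image[OF p] by (auto simp: compositions_def)

lemma alternating_hop:
  assumes g: "alternating n g" shows "alternating n (hop {..<n} s g)"
  unfolding alternating_def
proof (intro allI impI)
  fix w :: "nat \<Rightarrow> nat" and i assume i: "Suc i < n"
  let ?t = "transpose i (Suc i)"
  note t = transpose_permutes[OF i]
  have "hop {..<n} s g (w \<circ> ?t) = (\<Sum>a\<in>compositions {..<n} s. - g (\<lambda>j. w j + a j))"
    unfolding hop_def
  proof (rule sum.reindex_bij_witness[where i = "\<lambda>a. a \<circ> ?t" and j = "\<lambda>a. a \<circ> ?t"])
    fix a
    have "(\<lambda>j. (w \<circ> ?t) j + a j) = (\<lambda>j. w j + (a \<circ> ?t) j) \<circ> ?t" by (auto simp: fun_eq_iff)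
    thus "- g (\<lambda>j. w j + (a \<circ> ?t) j) = g (\<lambda>j. (w \<circ> ?t) j + a j)"
      using g i by (simp add: alternating_def)
  qed (auto simp: compositions_permute[OF t] comp_assoc)
  thus "hop {..<n} s g (w \<circ> ?t) = - hop {..<n} s g w" by (simp add: sum_negf hop_def)
qed

text \<open>
  The steps \<open>a\<close> that do not lead from \<open>p\<close> to a horizontal strip cancel: if \<open>v\<close> is the shifted \<open>p\<close>
  and \<open>v i \<le> v (Suc i) + a (Suc i)\<close>, then the end point with coordinates \<open>i\<close> and \<open>Suc i\<close> swapped is
  again above \<open>v\<close>. With the largest such \<open>i\<close> the swap is an involution, because the inequalities at
  larger indices do not see these coordinates.
\<close>

lemma straighten_strips:
  assumes g: "alternating n g" and p: "is_partition p" and pn: "p n = 0"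
  shows "(\<Sum>q | q \<in> ups p s \<and> q n = 0. g (shifted n q)) = hop {..<n} s g (shifted n p)"
proof -
  define v where "v = shifted n p"
  define bad where "bad = (\<lambda>w :: nat \<Rightarrow> nat. {i. Suc i < n \<and> v i \<le> w (Suc i)})"
  define add where "add = (\<lambda>a i. v i + (a i :: nat))"
  let ?C = "compositions {..<n} s"
  define swap where "swap = (\<lambda>a j. (add a \<circ> transpose (Max (bad (add a))) (Suc (Max (bad (add a))))) j - v j)"
  have fin: "finite ?C" by (rule finite_compositions) simp
  have finb: "finite (bad w)" for w by (rule finite_subset[of _ "{..<n}"]) (auto simp: bad_def)
  have vdec: "v (Suc i) \<le> v i" if "Suc i < n" for i
    using that is_partition_antimono[OF p, of i "Suc i"] by (simp add: v_def shifted_def)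
  have p0: "p i = 0" if "i \<ge> n" for i using is_partition_antimono[OF p that] pn by simp
  have "(\<Sum>a | a \<in> ?C \<and> bad (add a) \<noteq> {}. g (add a)) = 0"
  proof (rule sum_involution_cancel[where phi = swap])
    fix a assume a: "a \<in> {a \<in> ?C. bad (add a) \<noteq> {}}"
    define i where "i = Max (bad (add a))"
    define t where "t = transpose i (Suc i)"
    define a' where "a' = (\<lambda>j. (add a \<circ> t) j - v j)"
    have ib: "i \<in> bad (add a)" using a finb Max_in unfolding i_def by blast
    hence i: "Suc i < n" "v i \<le> add a (Suc i)" by (auto simp: bad_def)
    have t: "t permutes {..<n}" unfolding t_def by (rule transpose_permutes[OF i(1)])
    have tt: "t \<circ> t = id" by (simp add: t_def)
    have le: "v j \<le> add a (t j)" for j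
      using i vdec[OF i(1)] by (auto simp: t_def transpose_def add_def)
    have "add a' j = v j + a' j" for j by (simp add: add_def)
    hence add': "add a' = add a \<circ> t" using le by (simp add: fun_eq_iff a'_def)
    have C': "a' \<in> ?C"
    proof -
      have "a' j = 0" if "j \<ge> n" for j
        using that i a by (auto simp: a'_def t_def transpose_def add_def compositions_def)
      moreover have "sum v {..<n} + sum a' {..<n} = sum v {..<n} + sum a {..<n}"
      proof -
        have "sum v {..<n} + sum a' {..<n} = sum (add a') {..<n}" by (simp add: add_def sum.distrib)
        also have "\<dots> = sum (add a) {..<n}" unfolding add' by (rule sum.permute[OF t, symmetric])
        finally show ?thesis by (simp add: add_def sum.distrib)
      qed
      ultimately show ?thesis using a by (simp add: compositions_def)
    qed
    have max': "Max (bad (add a')) = i"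
    proof (rule Max_eqI[OF finb])
      show ib': "i \<in> bad (add a')"
        unfolding add' using i by (simp add: bad_def t_def add_def)
      fix j assume j: "j \<in> bad (add a')"
      show "j \<le> i"
      proof (rule ccontr)
        assume "\<not> j \<le> i"
        hence "j \<in> bad (add a)" using j by (simp add: bad_def add' t_def transpose_def)
        hence "j \<le> i" unfolding i_def by (rule Max_ge[OF finb])
        thus False using \<open>\<not> j \<le> i\<close> by simp
      qed
    qed
    have ne': "bad (add a') \<noteq> {}" unfolding add' using i by (auto simp: bad_def t_def add_def)
    have sw: "swap a = a'" by (simp add: swap_def a'_def t_def i_def)
    show "swap a \<in> {a \<in> ?C. bad (add a) \<noteq> {}}" using C' ne' sw by simp
    have "swap a' = (\<lambda>j. (add a' \<circ> t) j - v j)" unfolding swap_def max' t_def ..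
    thus "swap (swap a) = a" unfolding sw add' comp_assoc tt by (simp add: add_def)
    show "g (add (swap a)) = - g (add a)"
      unfolding sw add' using g i(1) by (simp add: alternating_def t_def)
  qed
  moreover have "hop {..<n} s g v = (\<Sum>a | a \<in> ?C \<and> bad (add a) \<noteq> {}. g (add a)) +
      (\<Sum>a | a \<in> ?C \<and> bad (add a) = {}. g (add a))"
  proof -
    have "hop {..<n} s g v = (\<Sum>a\<in>?C. g (add a))" by (simp add: hop_def add_def)
    also have "\<dots> = (\<Sum>a\<in>{a \<in> ?C. bad (add a) \<noteq> {}} \<union> {a \<in> ?C. bad (add a) = {}}. g (add a))"
      by (intro sum.cong refl) auto
    also have "\<dots> = (\<Sum>a | a \<in> ?C \<and> bad (add a) \<noteq> {}. g (add a)) +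
        (\<Sum>a | a \<in> ?C \<and> bad (add a) = {}. g (add a))"
      by (rule sum.union_disjoint) (auto simp: fin)
    finally show ?thesis .
  qed
  moreover have "(\<Sum>a | a \<in> ?C \<and> bad (add a) = {}. g (add a)) =
      (\<Sum>q | q \<in> ups p s \<and> q n = 0. g (shifted n q))"
  proof (rule sum.reindex_bij_witness[where i = "\<lambda>q i. q i - p i" and j = "\<lambda>a i. p i + a i"], goal_cases)
    case (1 a)
    show ?case by simp
  next
    case (2 a)
    have az: "a i = 0" if "i \<ge> n" for i using 2 that by (simp add: compositions_def)
    have "p (Suc i) + a (Suc i) \<le> p i" for i
    proof (cases "Suc i < n")
      case True
      hence "add a (Suc i) < v i" using 2 by (auto simp: bad_def not_le)
      thus ?thesis using True by (simp add: add_def v_def shifted_def)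
    qed (use az p0 in simp)
    moreover have "psize (\<lambda>i. p i + a i) = psize p + s"
      using psize_eq_sum[of n p] psize_eq_sum[of n "\<lambda>i. p i + a i"] p0 az 2
      by (simp add: compositions_def sum.distrib)
    ultimately show ?case using az pn by (simp add: ups_def hstrip_def)
  next
    case (3 q)
    thus ?case by (auto simp: ups_def hstrip_def)
  next
    case (4 q)
    have q: "is_partition q" using 4 ups_partition[OF p] by blast
    have q0: "q i = 0" if "i \<ge> n" for i using is_partition_antimono[OF q that] 4 by simp
    have h: "p i \<le> q i" "q (Suc i) \<le> p i" for i using 4 by (auto simp: ups_def hstrip_def)
    have "(\<Sum>i<n. q i - p i) = s"
      using sum_subtractf_nat[where f = q and g = p and A = "{..<n}"] h psize_eq_sum[of n p] psize_eq_sum[of n q] p0 q0 4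
      by (simp add: ups_def)
    moreover have "bad (add (\<lambda>i. q i - p i)) = {}"
    proof -
      have "\<not> v i \<le> add (\<lambda>i. q i - p i) (Suc i)" if "Suc i < n" for i
        using that h(1)[of "Suc i"] h(2)[of i] by (simp add: add_def v_def shifted_def)
      thus ?thesis by (auto simp: bad_def)
    qed
    ultimately show ?case using q0 by (simp add: compositions_def)
  next
    case (5 a)
    have "add a = shifted n (\<lambda>i. p i + a i)"
      using 5 by (auto simp: add_def v_def shifted_def fun_eq_iff compositions_def)
    thus ?case by simp
  qed
  ultimately show ?thesis unfolding v_def by simp
qed

lemma upseq_alternating:
  assumes mu: "is_partition mu" "mu n = 0" and g: "alternating n g"
  shows "upseq c m (\<lambda>q. if q n = 0 then g (shifted n q) else 0) mu = hopseq {..<n} c m g (shifted n mu)"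
  using g
proof (induction m arbitrary: g)
  case (Suc m)
  have "up s (\<lambda>q. if q n = 0 then g (shifted n q) else 0) p =
      (if p n = 0 then hop {..<n} s g (shifted n p) else 0)" if p: "is_partition p" for p s
  proof (cases "p n = 0")
    case True
    have "up s (\<lambda>q. if q n = 0 then g (shifted n q) else 0) p =
       (\<Sum>q | q \<in> ups p s \<and> q n = 0. g (shifted n q))"
      unfolding up_def using finite_ups[OF p] by (simp add: sum.If_cases Int_def)
    thus ?thesis using straighten_strips[OF Suc.prems p True] True by simp
  next
    case False
    hence "q n \<noteq> 0" if "q \<in> ups p s" for q using that unfolding ups_def hstrip_def by (metis (mono_tags, lifting) le_zero_eq mem_Collect_eq)
    hence "(\<Sum>q\<in>ups p s. if q n = 0 then g (shifted n q) else 0) = 0" by (intro sum.neutral) fastforce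
    thus ?thesis using False by (simp add: up_def)
  qed
  from upseq_cong[OF mu(1) this] show ?case
    using Suc.IH[OF alternating_hop[OF Suc.prems]] by simp
qed (use mu in simp)

text \<open>
  The coefficients of the alternating polynomial whose leading exponent vector is \<open>shifted n lam\<close>.
\<close>

definition alternant :: "nat \<Rightarrow> (nat \<Rightarrow> nat) \<Rightarrow> (nat \<Rightarrow> nat) \<Rightarrow> int" where
  "alternant n lam w =
     (\<Sum>p | p permutes {..<n}. if \<forall>i<n. w (p i) = lam i + (n - i) then sign p else 0)"

lemma alternating_alternant: "alternating n (alternant n lam)"
  unfolding alternating_def
proof (intro allI impI)
  fix w :: "nat \<Rightarrow> nat" and i assume i: "Suc i < n"
  let ?t = "transpose i (Suc i)"
  note t = transpose_permutes[OF i]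
  have "alternant n lam w =
     (\<Sum>p | p permutes {..<n}. if \<forall>j<n. w ((?t \<circ> p) j) = lam j + (n - j) then sign (?t \<circ> p) else 0)"
    unfolding alternant_def by (rule setum_permutations_compose_left[OF t])
  also have "\<dots> = - alternant n lam (w \<circ> ?t)"
    unfolding alternant_def sum_negf[symmetric]
  proof (intro sum.cong refl)
    fix p assume "p \<in> {p. p permutes {..<n}}"
    hence "permutation p" by (auto intro: permutation_permutes[THEN iffD2])
    hence "sign (?t \<circ> p) = - sign p"
      by (subst sign_compose) (auto simp: sign_swap_id permutation_swap_id)
    thus "(if \<forall>j<n. w ((?t \<circ> p) j) = lam j + (n - j) then sign (?t \<circ> p) else 0) =
       - (if \<forall>j<n. (w \<circ> ?t) (p j) = lam j + (n - j) then sign p else 0)" by simp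
  qed
  finally show "alternant n lam (w \<circ> ?t) = - alternant n lam w" by simp
qed

lemma alternant_decreasing:
  assumes lam: "antimono lam" and w: "\<And>i. Suc i < n \<Longrightarrow> w (Suc i) < w i"
  shows "alternant n lam w = (if \<forall>i<n. w i = lam i + (n - i) then 1 else 0)"
proof -
  have wdec: "w j < w i" if "i < j" "j < n" for i j
    using that
  proof (induction rule: strict_inc_induct)
    case (base k)
    then show ?case using w[of k] by simp
  next
    case (step k)
    then show ?case using w[of k] by simp
  qed
  have id: "p = id" if p: "p permutes {..<n}" and eq: "\<forall>i<n. w (p i) = lam i + (n - i)" for p
  proof (rule permutes_natset_ge[OF p], rule ballI)
    have pn: "p i < n" if "i < n" for i using permutes_in_image[OF p] that by auto
    have pS: "p i < p (Suc i)" if "Suc i < n" for i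
    proof (rule ccontr)
      assume "\<not> p i < p (Suc i)"
      hence "w (p i) \<le> w (p (Suc i))" using wdec[of "p (Suc i)" "p i"] pn[of i] that
        by (cases "p (Suc i) = p i") auto
      moreover have "lam (Suc i) \<le> lam i" using lam by (simp add: antimono_iff_le_Suc)
      ultimately show False using eq that by auto
    qed
    fix i assume "i \<in> {..<n}"
    hence "i < n" by simp
    thus "i \<le> p i"
    proof (induction i)
      case (Suc i)
      thus ?case using pS[of i] by simp
    qed simp
  qed
  have "alternant n lam w = (\<Sum>p | p permutes {..<n}.
      if p = id then (if \<forall>i<n. w i = lam i + (n - i) then 1 else 0) else 0)"
    unfolding alternant_def
  proof (intro sum.cong refl)
    fix p assume "p \<in> {p. p permutes {..<n}}"
    thus "(if \<forall>i<n. w (p i) = lam i + (n - i) then sign p else 0) =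
        (if p = id then (if \<forall>i<n. w i = lam i + (n - i) then 1 else 0) else 0)"
      using id[of p] by (cases "p = id") auto
  qed
  also have "\<dots> = (if \<forall>i<n. w i = lam i + (n - i) then 1 else 0)"
    by (subst sum.delta) (auto simp: finite_permutations permutes_id)
  finally show ?thesis .
qed

lemma partition_of_length_is_partition: "partition_of_length n p \<Longrightarrow> is_partition p"
  unfolding partition_of_length_def
  by (rule is_partitionI[of p n]) (auto simp: antimono_iff_le_Suc)

lemma kostka_size:
  assumes "is_partition kap" "kostka m kap mu c \<noteq> 0"
  shows "psize kap = psize mu + sum c {1..m}"
  using assms
proof (induction m arbitrary: kap)
  case 0
  thus ?case by (simp add: kostka_0 split: if_splits)
next
  case (Suc m)
  have "(\<Sum>gam | hstrip gam kap \<and> psize kap = psize gam + c (Suc m). int (kostka m gam mu c)) \<noteq> 0"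
    using Suc.prems kostka_Suc[OF Suc.prems(1), of m mu c] by linarith
  then obtain gam where "hstrip gam kap" "psize kap = psize gam + c (Suc m)" "kostka m gam mu c \<noteq> 0"
    by (auto elim!: sum.not_neutral_contains_not_neutral)
  thus ?case using Suc.IH[of gam] hstrip_partition_lower[of gam kap] Suc.prems(1) by simp
qed

text \<open>
  The Jacobi--Trudi identity. Its determinant is implicit: the right-hand side adds up, with the
  signs in \<open>alternant\<close>, the ways of getting from \<open>shifted n mu\<close> to a permutation of \<open>shifted n lam\<close> by
  arbitrary steps, and straightening leaves those in which each step is a horizontal strip.
\<close>

lemma skew_kostka:
  assumes lam: "partition_of_length n lam" and mu: "partition_of_length n mu"
  shows "int (kostka m lam mu c) = hopseq {..<n} c m (alternant n lam) (shifted n mu)"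
proof -
  let ?S = "{kap. is_partition kap \<and> psize kap = psize mu + sum c {1..m}}"
  note lp = partition_of_length_is_partition[OF lam] and mp = partition_of_length_is_partition[OF mu]
  have "hopseq {..<n} c m (alternant n lam) (shifted n mu) =
      (\<Sum>kap\<in>?S. int (kostka m kap mu c) * (if kap n = 0 then alternant n lam (shifted n kap) else 0))"
    using upseq_alternating[OF mp _ alternating_alternant] mu upseq_kostka[OF mp]
    by (simp add: partition_of_length_def)
  also have "\<dots> = (\<Sum>kap\<in>?S. if kap = lam then int (kostka m kap mu c) else 0)"
  proof (intro sum.cong refl)
    fix kap assume "kap \<in> ?S"
    hence kp: "is_partition kap" by simp
    have "alternant n lam (shifted n kap) = (if \<forall>i<n. shifted n kap i = lam i + (n - i) then 1 else 0)"
    proof (rule alternant_decreasing)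
      fix i assume "Suc i < n"
      thus "shifted n kap (Suc i) < shifted n kap i"
        using is_partition_antimono[OF kp, of i "Suc i"] by (simp add: shifted_def)
    qed (use lam in \<open>simp add: partition_of_length_def\<close>)
    moreover have "kap = lam \<longleftrightarrow> kap n = 0 \<and> (\<forall>i<n. shifted n kap i = lam i + (n - i))"
    proof
      assume R: "kap n = 0 \<and> (\<forall>i<n. shifted n kap i = lam i + (n - i))"
      show "kap = lam"
      proof
        fix i show "kap i = lam i"
        proof (cases "i < n")
          case False
          hence "kap i = 0" using is_partition_antimono[OF kp, of n i] R by simp
          thus ?thesis using lam False by (simp add: partition_of_length_def)
        qed (use R in \<open>auto simp: shifted_def\<close>)
      qed
    qed (use lam in \<open>auto simp: shifted_def partition_of_length_def\<close>)
    ultimately show "int (kostka m kap mu c) * (if kap n = 0 then alternant n lam (shifted n kap) else 0) =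
        (if kap = lam then int (kostka m kap mu c) else 0)" by auto
  qed
  also have "\<dots> = (if lam \<in> ?S then int (kostka m lam mu c) else 0)"
    by (subst sum.delta[OF finite_partitions_exact]) simp
  also have "\<dots> = int (kostka m lam mu c)" using kostka_size[OF lp, of m mu c] lp by auto
  finally show ?thesis by simp
qed

section \<open>Products in interleaved variables\<close>

definition coords :: "nat \<Rightarrow> (nat \<Rightarrow> nat) \<Rightarrow> (nat \<Rightarrow> nat) \<Rightarrow> nat \<Rightarrow> nat" where
  "coords n pos w = (\<lambda>i. if i < n then w (pos i) else 0)"

text \<open>
  A complete homogeneous polynomial in two disjoint sets of variables is the sum, over the ways to
  split the degree, of the products of those in the two sets.
\<close>

lemma hop_product:
  assumes inj: "inj_on pos1 {..<n}" "inj_on pos2 {..<n}"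
    and disj: "pos1 ` {..<n} \<inter> pos2 ` {..<n} = {}" and I: "I = pos1 ` {..<n} \<union> pos2 ` {..<n}"
  shows "hop I s (\<lambda>w. g1 (coords n pos1 w) * g2 (coords n pos2 w)) w =
    (\<Sum>t\<le>s. hop {..<n} t g1 (coords n pos1 w) * hop {..<n} (s - t) g2 (coords n pos2 w))"
proof -
  let ?c1 = "coords n pos1" and ?c2 = "coords n pos2"
  let ?C = "compositions {..<n}"
  let ?S = "Sigma {..s} (\<lambda>t. ?C t \<times> ?C (s - t))"
  define join where "join = (\<lambda>(a :: nat \<Rightarrow> nat) (b :: nat \<Rightarrow> nat) x.
     if x \<in> pos1 ` {..<n} then a (the_inv_into {..<n} pos1 x)
     else if x \<in> pos2 ` {..<n} then b (the_inv_into {..<n} pos2 x) else 0)"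
  have cadd: "coords n pos (\<lambda>i. w i + a i) = (\<lambda>i. coords n pos w i + coords n pos a i)" for pos a
    by (auto simp: coords_def)
  have j1: "join a b (pos1 i) = a i" if "i < n" for a b i
    using that inj(1) by (auto simp: join_def the_inv_into_f_f)
  have j2: "join a b (pos2 i) = b i" if "i < n" for a b i
    using that inj(2) disj by (auto simp: join_def the_inv_into_f_f)
  have jc: "?c1 (join a b) = a" "?c2 (join a b) = b" if "a \<in> ?C t" "b \<in> ?C u" for a b t u
    using that j1 j2 by (auto simp: coords_def compositions_def fun_eq_iff)
  have sumI: "sum a I = sum (?c1 a) {..<n} + sum (?c2 a) {..<n}" for a :: "nat \<Rightarrow> nat"
    unfolding I using disj inj by (simp add: sum.union_disjoint sum.reindex coords_def)
  have fin: "finite (?C t)" for t by (rule finite_compositions) simp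
  have "(\<Sum>t\<le>s. hop {..<n} t g1 (?c1 w) * hop {..<n} (s - t) g2 (?c2 w)) =
     (\<Sum>t\<le>s. \<Sum>(a, b)\<in>?C t \<times> ?C (s - t). g1 (\<lambda>i. ?c1 w i + a i) * g2 (\<lambda>i. ?c2 w i + b i))"
    by (simp add: hop_def sum_product sum.cartesian_product)
  also have "\<dots> = (\<Sum>(t, a, b)\<in>?S. g1 (\<lambda>i. ?c1 w i + a i) * g2 (\<lambda>i. ?c2 w i + b i))"
    by (subst sum.Sigma) (auto simp: fin)
  also have "\<dots> = hop I s (\<lambda>w. g1 (?c1 w) * g2 (?c2 w)) w"
    unfolding hop_def
  proof (rule sum.reindex_bij_witness[where
      i = "\<lambda>a. (sum (?c1 a) {..<n}, ?c1 a, ?c2 a)" and j = "\<lambda>(t, a, b). join a b"], goal_cases)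
    case (1 z)
    then obtain t a b where z: "z = (t, a, b)" and ab: "a \<in> ?C t" "b \<in> ?C (s - t)" by auto
    have "sum a {..<n} = t" using ab by (simp add: compositions_def)
    thus ?case using jc[OF ab] by (simp add: z)
  next
    case (2 z)
    then obtain t a b where z: "z = (t, a, b)" and ab: "a \<in> ?C t" "b \<in> ?C (s - t)" and t: "t \<le> s" by auto
    have "sum (join a b) I = s" unfolding sumI jc[OF ab] using ab t by (simp add: compositions_def)
    moreover have "join a b x = 0" if "x \<notin> I" for x using that unfolding I join_def by simp
    ultimately show ?case by (simp add: z compositions_def)
  next
    case (3 a)
    have "join (?c1 a) (?c2 a) x = a x" for x
    proof (cases "x \<in> I")
      case True
      thus ?thesis unfolding I using j1 j2 by (auto simp: coords_def)
    next
      case False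
      thus ?thesis using 3 unfolding I by (auto simp: join_def compositions_def)
    qed
    thus ?case by auto
  next
    case (4 a)
    hence "sum (?c1 a) {..<n} + sum (?c2 a) {..<n} = s" unfolding sumI[symmetric] by (simp add: compositions_def)
    thus ?case by (auto simp: compositions_def) (auto simp: coords_def)
  next
    case (5 z)
    then obtain t a b where z: "z = (t, a, b)" and ab: "a \<in> ?C t" "b \<in> ?C (s - t)" by auto
    show ?case by (simp add: z cadd jc[OF ab])
  qed
  finally show ?thesis by simp
qed

lemma hopseq_cong:
  assumes "\<And>x. x \<in> {1..m} \<Longrightarrow> c x = c' x"
  shows "hopseq I c m g = hopseq I c' m g"
  using assms by (induction m arbitrary: g) auto

lemma hopseq_sum:
  "hopseq I c m (\<lambda>w. \<Sum>k\<in>K. f k w) w = (\<Sum>k\<in>K. hopseq I c m (f k) w)"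
proof (induction m arbitrary: f)
  case (Suc m)
  have "hop I s (\<lambda>w. \<Sum>k\<in>K. f k w) = (\<lambda>w. \<Sum>k\<in>K. hop I s (f k) w)" for s
    unfolding hop_def by (rule ext) (rule sum.swap)
  thus ?case using Suc.IH by simp
qed simp

lemma hopseq_translate:
  "hopseq I c m (\<lambda>w. g (\<lambda>i. off i + w i)) w = hopseq I c m g (\<lambda>i. off i + w i)"
proof (induction m arbitrary: g)
  case (Suc m)
  have "hop I s (\<lambda>w. g (\<lambda>i. off i + w i)) = (\<lambda>w. hop I s g (\<lambda>i. off i + w i))" for s
    by (simp add: hop_def add.assoc fun_eq_iff)
  thus ?case using Suc.IH by simp
qed simp

definition subcontents :: "(nat \<Rightarrow> nat) \<Rightarrow> nat \<Rightarrow> (nat \<Rightarrow> nat) set" where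
  "subcontents c m = {c'. \<forall>x. c' x \<le> (if x \<in> {1..m} then c x else 0)}"

lemma subcontents_0: "subcontents c 0 = {\<lambda>_. 0}"
  by (auto simp: subcontents_def)

lemma hopseq_product:
  assumes inj: "inj_on pos1 {..<n}" "inj_on pos2 {..<n}"
    and disj: "pos1 ` {..<n} \<inter> pos2 ` {..<n} = {}" and I: "I = pos1 ` {..<n} \<union> pos2 ` {..<n}"
  shows "hopseq I c m (\<lambda>w. g1 (coords n pos1 w) * g2 (coords n pos2 w)) w =
    (\<Sum>c'\<in>subcontents c m. hopseq {..<n} c' m g1 (coords n pos1 w) *
        hopseq {..<n} (\<lambda>x. c x - c' x) m g2 (coords n pos2 w))"
proof (induction m arbitrary: g1 g2)
  case 0
  show ?case by (simp add: subcontents_0)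
next
  case (Suc m)
  let ?c1 = "coords n pos1" and ?c2 = "coords n pos2" and ?x = "Suc m"
  have "hopseq I c (Suc m) (\<lambda>w. g1 (?c1 w) * g2 (?c2 w)) w =
    (\<Sum>t\<le>c ?x. hopseq I c m (\<lambda>w. hop {..<n} t g1 (?c1 w) * hop {..<n} (c ?x - t) g2 (?c2 w)) w)"
    by (simp add: hop_product[OF assms, abs_def] hopseq_sum)
  also have "\<dots> = (\<Sum>t\<le>c ?x. \<Sum>c'\<in>subcontents c m. hopseq {..<n} c' m (hop {..<n} t g1) (?c1 w) *
        hopseq {..<n} (\<lambda>x. c x - c' x) m (hop {..<n} (c ?x - t) g2) (?c2 w))"
    by (simp only: Suc.IH)
  also have "\<dots> = (\<Sum>(t, c')\<in>{..c ?x} \<times> subcontents c m.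
       hopseq {..<n} c' m (hop {..<n} t g1) (?c1 w) *
        hopseq {..<n} (\<lambda>x. c x - c' x) m (hop {..<n} (c ?x - t) g2) (?c2 w))"
    by (rule sum.cartesian_product)
  also have "\<dots> = (\<Sum>c'\<in>subcontents c (Suc m). hopseq {..<n} c' (Suc m) g1 (?c1 w) *
        hopseq {..<n} (\<lambda>x. c x - c' x) (Suc m) g2 (?c2 w))"
  proof (rule sum.reindex_bij_witness[where
      i = "\<lambda>c'. (c' ?x, c'(?x := 0))" and j = "\<lambda>(t, c'). c'(?x := t)"], goal_cases)
    case (1 z)
    then obtain t c' where z: "z = (t, c')" and c': "c' \<in> subcontents c m" by auto
    have "c' ?x = 0" using c' by (auto simp: subcontents_def dest: spec[of _ ?x])
    thus ?case by (auto simp: z)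
  next
    case (2 z)
    thus ?case by (auto simp: subcontents_def split: if_splits) (meson Suc_leD le_SucI le_trans not_le)+
  next
    case (3 c')
    show ?case by simp
  next
    case (4 c')
    hence *: "c' x \<le> (if x \<in> {1..Suc m} then c x else 0)" for x by (simp add: subcontents_def)
    have "(c'(?x := 0)) x \<le> (if x \<in> {1..m} then c x else 0)" for x
      using *[of x] by (auto simp: le_Suc_eq split: if_splits)
    thus ?case using *[of ?x] by (simp add: subcontents_def)
  next
    case (5 z)
    then obtain t c' where z: "z = (t, c')" by auto
    have "hopseq {..<n} (c'(?x := t)) m g = hopseq {..<n} c' m g"
      "hopseq {..<n} (\<lambda>x. c x - (c'(?x := t)) x) m g = hopseq {..<n} (\<lambda>x. c x - c' x) m g" for g
      by (intro hopseq_cong; simp)+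
    thus ?case by (simp add: z)
  qed
  finally show ?case .
qed

section \<open>Toggles in the columns left of a given one\<close>

text \<open>
  When a tableau is read column by column from the right, these are the letters read once column \<open>j\<close>
  is done.
\<close>

definition tail :: "(nat \<Rightarrow> nat \<Rightarrow> nat) \<Rightarrow> nat \<Rightarrow> nat \<Rightarrow> nat" where
  "tail P j x = card {(i, c) \<in> strip P x. j \<le> c}"

lemma tail_0: "tail P 0 x = weight P x"
  by (simp add: tail_def weight_def)

lemma tail_beyond:
  assumes P: "P \<in> strip_chains r mu kap" and kap: "is_partition kap" and j: "kap 0 \<le> j"
  shows "tail P j x = 0"
proof -
  have "c < j" if "(i, c) \<in> strip P x" for i c
  proof -
    have "c < P x i" using that by (simp add: strip_def skew_diagram_def)
    also have "\<dots> \<le> kap 0" using strip_chains_le[OF P, of x i] is_partition_antimono[OF kap, of 0 i] by simp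
    finally show ?thesis using j by simp
  qed
  hence "{(i, c) \<in> strip P x. j \<le> c} = {}" by fastforce
  thus ?thesis unfolding tail_def by (simp only: card.empty)
qed

lemma strip_column_unique:
  assumes P: "P \<in> strip_chains r mu kap" and kap: "is_partition kap"
    and "(i1, j) \<in> strip P x" "(i2, j) \<in> strip P x"
  shows "i1 = i2"
proof -
  have lt: "\<not> i1 < i2" if "(i1, j) \<in> strip P x" "(i2, j) \<in> strip P x" for i1 i2
  proof
    assume "i1 < i2"
    have "P x i2 \<le> P x (Suc i1)"
      using is_partition_antimono[OF strip_chains_partition[OF P kap]] \<open>i1 < i2\<close> by simp
    also have "\<dots> \<le> P (x - 1) i1" using strip_chains_hstrip[OF P kap, of x] by (simp add: hstrip_def)
    finally show False using that by (simp add: strip_def skew_diagram_def)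
  qed
  show ?thesis using lt[OF assms(3,4)] lt[OF assms(4,3)] by simp
qed

lemma tail_step:
  assumes P: "P \<in> strip_chains r mu kap" and kap: "is_partition kap"
  shows "tail P j x = tail P (Suc j) x + (if \<exists>i. (i, j) \<in> strip P x then 1 else 0)"
proof -
  let ?C = "{(i, c) \<in> strip P x. c = j}"
  have fin: "finite (strip P x)" by (rule finite_strip[OF P kap])
  have "{(i, c) \<in> strip P x. j \<le> c} = {(i, c) \<in> strip P x. Suc j \<le> c} \<union> ?C"
    by (auto simp: Suc_le_eq)
  hence "tail P j x = tail P (Suc j) x + card ?C" unfolding tail_def
    by (subst card_Un_disjoint[symmetric]) (auto intro: finite_subset[OF _ fin])
  moreover have "card ?C = (if \<exists>i. (i, j) \<in> strip P x then 1 else 0)"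
  proof (cases "\<exists>i. (i, j) \<in> strip P x")
    case True
    then obtain i where i: "(i, j) \<in> strip P x" by blast
    have "?C = {(i, j)}" using i strip_column_unique[OF P kap] by auto
    thus ?thesis using True by simp
  next
    case False
    hence "?C = {}" by auto
    hence "card ?C = 0" by (simp only: card.empty)
    thus ?thesis using False by simp
  qed
  ultimately show ?thesis by simp
qed

text \<open>
  The size of \<open>P z\<close> left of column \<open>j\<close>; the number of entries \<open>x\<close> there is the increase of \<open>head\<close> from
  \<open>x - 1\<close> to \<open>x\<close>. Shapes here have at most \<open>L\<close> rows.
\<close>

definition head :: "nat \<Rightarrow> (nat \<Rightarrow> nat \<Rightarrow> nat) \<Rightarrow> nat \<Rightarrow> nat \<Rightarrow> nat" where
  "head L P j z = (\<Sum>i<L. min (P z i) j)"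

lemma weight_tail_head:
  assumes P: "P \<in> strip_chains r mu kap" and kap: "is_partition kap" and L: "\<And>i. i \<ge> L \<Longrightarrow> kap i = 0"
  shows "weight P x + head L P j (x - 1) = tail P j x + head L P j x"
proof -
  have fin: "finite (strip P x)" by (rule finite_strip[OF P kap])
  have "strip P x = {(i, c) \<in> strip P x. j \<le> c} \<union> {(i, c) \<in> strip P x. c < j}" by auto
  hence "weight P x = tail P j x + card {(i, c) \<in> strip P x. c < j}" unfolding tail_def weight_def
    by (subst card_Un_disjoint[symmetric]) (auto intro: finite_subset[OF _ fin])
  moreover have "card {(i, c) \<in> strip P x. c < j} = (\<Sum>i<L. min (P x i) j - min (P (x - 1) i) j)"
  proof -
    have z: "P x i = 0" if "i \<ge> L" for i using strip_chains_le[OF P, of x i] L[OF that] by simp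
    have "{(i, c) \<in> strip P x. c < j} = Sigma {..<L} (\<lambda>i. {P (x - 1) i..<min (P x i) j})"
      using z by (force simp: strip_def skew_diagram_def not_le[symmetric])
    hence "card {(i, c) \<in> strip P x. c < j} = (\<Sum>i<L. min (P x i) j - P (x - 1) i)" by simp
    also have "\<dots> = (\<Sum>i<L. min (P x i) j - min (P (x - 1) i) j)"
      by (intro sum.cong refl) linarith
    finally show ?thesis .
  qed
  moreover have "(\<Sum>i<L. min (P x i) j - min (P (x - 1) i) j) + head L P j (x - 1) = head L P j x"
  proof -
    have "P (x - 1) i \<le> P x i" for i by (rule strip_chains_mono[OF P]) simp
    hence "min (P (x - 1) i) j \<le> min (P x i) j" for i by (meson min.mono order_refl)
    thus ?thesis unfolding head_def sum.distrib[symmetric] by (intro sum.cong refl) simp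
  qed
  ultimately show ?thesis by simp
qed

text \<open>
  The Bender--Knuth involution exchanging the letters \<open>z\<close> and \<open>Suc z\<close>, restricted to the columns
  left of column \<open>j\<close>: there, row \<open>i\<close> of \<open>P z\<close> may end anywhere between the two bounds, and the
  toggle reflects this interval. In row \<open>0\<close> the upper bound from the row above is void, and \<open>j\<close>
  stands for it. Rows that reach into column \<open>j\<close> stay.
\<close>

definition toggle_lo :: "nat \<Rightarrow> nat \<Rightarrow> (nat \<Rightarrow> nat \<Rightarrow> nat) \<Rightarrow> nat \<Rightarrow> nat" where
  "toggle_lo j z P i = min j (max (P (Suc z) (Suc i)) (P (z - 1) i))"

definition toggle_hi :: "nat \<Rightarrow> nat \<Rightarrow> (nat \<Rightarrow> nat \<Rightarrow> nat) \<Rightarrow> nat \<Rightarrow> nat" where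
  "toggle_hi j z P i = min j (min (P (Suc z) i) (case i of 0 \<Rightarrow> j | Suc i' \<Rightarrow> P (z - 1) i'))"

definition toggle :: "nat \<Rightarrow> nat \<Rightarrow> (nat \<Rightarrow> nat \<Rightarrow> nat) \<Rightarrow> nat \<Rightarrow> nat \<Rightarrow> nat" where
  "toggle j z P = P(z := (\<lambda>i. if j < P z i then P z i else toggle_lo j z P i + toggle_hi j z P i - P z i))"

lemma toggle_bounds:
  assumes P: "P \<in> strip_chains r mu kap" and kap: "is_partition kap" and z: "1 \<le> z" and i: "P z i \<le> j"
  shows "toggle_lo j z P i \<le> P z i" and "P z i \<le> toggle_hi j z P i"
proof -
  have "P (Suc z) (Suc i) \<le> P z i" by (rule strip_chains_interlace[OF P kap])
  moreover have "P (z - 1) i \<le> P z i" by (rule strip_chains_mono[OF P]) simp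
  ultimately show "toggle_lo j z P i \<le> P z i" unfolding toggle_lo_def by simp
  have "P z (Suc i') \<le> P (z - 1) i'" for i' using strip_chains_interlace[OF P kap, of "z - 1" i'] z by simp
  thus "P z i \<le> toggle_hi j z P i"
    using strip_chains_step[OF P, of z i] i unfolding toggle_hi_def by (cases i) auto
qed

lemma toggle_other: "y \<noteq> z \<Longrightarrow> toggle j z P y = P y"
  by (simp add: toggle_def)

lemma toggle_large: "j < P z i \<Longrightarrow> toggle j z P z i = P z i"
  by (simp add: toggle_def)

lemma toggle_small:
  assumes "P \<in> strip_chains r mu kap" "is_partition kap" "1 \<le> z" "P z i \<le> j"
  shows "toggle j z P z i + P z i = toggle_lo j z P i + toggle_hi j z P i"
    and "toggle_lo j z P i \<le> toggle j z P z i" and "toggle j z P z i \<le> toggle_hi j z P i"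
    and "toggle j z P z i \<le> j"
  using toggle_bounds[OF assms] assms(4) unfolding toggle_def by (auto simp: toggle_hi_def)

lemma toggle_strip_chains:
  assumes P: "P \<in> strip_chains r mu kap" and kap: "is_partition kap" and z: "1 \<le> z" "z < r"
  shows "toggle j z P \<in> strip_chains r mu kap"
proof -
  have 1: "hstrip (P (z - 1)) (toggle j z P z)"
    unfolding hstrip_def
  proof (intro allI conjI)
    fix i
    have le: "P (z - 1) i \<le> P z i" by (rule strip_chains_mono[OF P]) simp
    show "P (z - 1) i \<le> toggle j z P z i"
    proof (cases "j < P z i")
      case False
      hence "P (z - 1) i \<le> toggle_lo j z P i" using le by (simp add: toggle_lo_def)
      thus ?thesis using toggle_small(2)[OF P kap z(1), of i j] False by simp
    qed (use le in \<open>simp add: toggle_large\<close>)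
    have le': "P z (Suc i) \<le> P (z - 1) i" using strip_chains_interlace[OF P kap, of "z - 1" i] z by simp
    show "toggle j z P z (Suc i) \<le> P (z - 1) i"
    proof (cases "j < P z (Suc i)")
      case False
      have "toggle_hi j z P (Suc i) \<le> P (z - 1) i" by (simp add: toggle_hi_def)
      thus ?thesis using toggle_small(3)[OF P kap z(1), of "Suc i" j] False by simp
    qed (use le' in \<open>simp add: toggle_large\<close>)
  qed
  have 2: "hstrip (toggle j z P z) (P (Suc z))"
    unfolding hstrip_def
  proof (intro allI conjI)
    fix i
    have le: "P z i \<le> P (Suc z) i" by (rule strip_chains_step[OF P])
    show "toggle j z P z i \<le> P (Suc z) i"
    proof (cases "j < P z i")
      case False
      have "toggle_hi j z P i \<le> P (Suc z) i" by (simp add: toggle_hi_def)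
      thus ?thesis using toggle_small(3)[OF P kap z(1), of i j] False by simp
    qed (use le in \<open>simp add: toggle_large\<close>)
    have le': "P (Suc z) (Suc i) \<le> P z i" by (rule strip_chains_interlace[OF P kap])
    show "P (Suc z) (Suc i) \<le> toggle j z P z i"
    proof (cases "j < P z i")
      case False
      hence "P (Suc z) (Suc i) \<le> toggle_lo j z P i" using le' by (simp add: toggle_lo_def)
      thus ?thesis using toggle_small(2)[OF P kap z(1), of i j] False by simp
    qed (use le' in \<open>simp add: toggle_large\<close>)
  qed
  have "hstrip (toggle j z P x) (toggle j z P (Suc x))" if "x < r" for x
  proof -
    consider "x = z" | "Suc x = z" | "x \<noteq> z" "Suc x \<noteq> z" by blast
    thus ?thesis
    proof cases
      case 1
      thus ?thesis using 2 by (simp add: toggle_other)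
    next
      case 2
      thus ?thesis using 1 by (auto simp: toggle_other)
    next
      case 3
      thus ?thesis using P that by (simp add: toggle_other strip_chains_def)
    qed
  qed
  thus ?thesis using P z unfolding strip_chains_def by (auto simp: toggle_other)
qed

lemma toggle_toggle:
  assumes P: "P \<in> strip_chains r mu kap" and kap: "is_partition kap" and z: "1 \<le> z" "z < r"
  shows "toggle j z (toggle j z P) = P"
proof (intro ext)
  fix y i
  let ?Q = "toggle j z P"
  have Q: "?Q \<in> strip_chains r mu kap" by (rule toggle_strip_chains[OF assms])
  show "toggle j z ?Q y i = P y i"
  proof (cases "y = z")
    case True
    show ?thesis
    proof (cases "j < P z i")
      case False
      hence P': "P z i \<le> j" by simp
      have Q': "?Q z i \<le> j" using toggle_small(4)[OF P kap z(1) P'] .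
      have "toggle_lo j z ?Q i = toggle_lo j z P i" "toggle_hi j z ?Q i = toggle_hi j z P i"
        using z by (auto simp: toggle_lo_def toggle_hi_def toggle_other split: nat.split)
      thus ?thesis
        using toggle_small(1)[OF P kap z(1) P'] toggle_small(1)[OF Q kap z(1) Q'] True by simp
    qed (use True in \<open>simp add: toggle_large\<close>)
  qed (simp add: toggle_other)
qed

definition same_tails :: "nat \<Rightarrow> (nat \<Rightarrow> nat \<Rightarrow> nat) \<Rightarrow> (nat \<Rightarrow> nat \<Rightarrow> nat) \<Rightarrow> bool" where
  "same_tails j P Q \<longleftrightarrow> (\<forall>z i. P z i - j = Q z i - j)"

lemma same_tails_trans: "same_tails j P Q \<Longrightarrow> same_tails j Q R \<Longrightarrow> same_tails j P R"
  by (simp add: same_tails_def)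

lemma same_tails_less: "same_tails j P Q \<Longrightarrow> j < P z i \<longleftrightarrow> j < Q z i"
  unfolding same_tails_def by (metis zero_less_diff)

lemma same_tails_toggle:
  assumes "P \<in> strip_chains r mu kap" "is_partition kap" "1 \<le> z"
  shows "same_tails j P (toggle j z P)"
  unfolding same_tails_def
proof (intro allI)
  fix y i
  show "P y i - j = toggle j z P y i - j"
  proof (cases "y = z \<and> P z i \<le> j")
    case True
    thus ?thesis using toggle_small(4)[OF assms, of i j] by simp
  next
    case False
    thus ?thesis by (cases "y = z") (auto simp: toggle_other toggle_large)
  qed
qed

lemma same_tails_tail:
  assumes st: "same_tails j P Q" and j: "j \<le> j'" shows "tail P j' x = tail Q j' x"
proof -
  have eq: "P z i - j = Q z i - j" for z i using st by (simp add: same_tails_def)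
  have "c < P z i \<longleftrightarrow> c < Q z i" if "j' \<le> c" for c z i
    using eq[of z i] that j by linarith
  hence "{(i, c) \<in> strip P x. j' \<le> c} = {(i, c) \<in> strip Q x. j' \<le> c}"
    by (auto simp: strip_def skew_diagram_def not_less[symmetric])
  thus ?thesis by (simp add: tail_def)
qed

text \<open>
  Cut off at column \<open>j\<close>, a row of \<open>P z\<close> that reaches into it ends at \<open>j\<close>, which is the upper bound.
  The condition makes \<open>j\<close> the lower bound too, so that leaving such a row alone agrees with the
  reflection, and the toggle exchanges the numbers of \<open>z\<close> and \<open>Suc z\<close> left of column \<open>j\<close>.
\<close>

definition toggle_ok :: "nat \<Rightarrow> nat \<Rightarrow> (nat \<Rightarrow> nat \<Rightarrow> nat) \<Rightarrow> bool" where
  "toggle_ok j z P \<longleftrightarrow> (\<forall>i. j < P z i \<longrightarrow> j < P (Suc z) (Suc i) \<or> j < P (z - 1) i)"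

lemma same_tails_toggle_ok: "same_tails j P Q \<Longrightarrow> toggle_ok j z P \<Longrightarrow> toggle_ok j z Q"
  unfolding toggle_ok_def by (simp add: same_tails_less)

lemma head_toggle:
  assumes P: "P \<in> strip_chains r mu kap" and kap: "is_partition kap" and L: "\<And>i. i \<ge> L \<Longrightarrow> kap i = 0"
    and z: "1 \<le> z" and ok: "toggle_ok j z P"
  shows "head L (toggle j z P) j z + head L P j z = head L P j (Suc z) + head L P j (z - 1)"
proof -
  let ?A = "\<lambda>i. min (P (Suc z) i) j" and ?B = "\<lambda>i. min (P (z - 1) i) j"
  let ?lo = "toggle_lo j z P" and ?hi = "toggle_hi j z P"
  have pt: "min (toggle j z P z i) j + min (P z i) j = ?lo i + ?hi i" for i
  proof (cases "j < P z i")
    case True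
    have "P z (Suc i') \<le> P (z - 1) i'" for i' using strip_chains_interlace[OF P kap, of "z - 1" i'] z by simp
    hence "j < P (z - 1) i'" if "i = Suc i'" for i' using True that less_le_trans by blast
    hence "?hi i = j" using True strip_chains_step[OF P, of z i] unfolding toggle_hi_def
      by (cases i) (auto simp: min_def)
    moreover have "?lo i = j" using ok True unfolding toggle_ok_def toggle_lo_def
      by (auto simp: min_def max_def)
    ultimately show ?thesis using True by (simp add: toggle_large min_def)
  next
    case False
    hence "P z i \<le> j" by simp
    from toggle_small(1,4)[OF P kap z this] this show ?thesis by (simp add: min_absorb1)
  qed
  \<comment> \<open>The upper bound in a row and the lower bound in the row above are the minimum and the maximum
     of the same two numbers; hence the shift by one.\<close>
  have "(\<Sum>i<Suc K. ?hi i) + (\<Sum>i<K. ?lo i) = (\<Sum>i<Suc K. ?A i) + (\<Sum>i<K. ?B i)" for K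
  proof (induction K)
    case 0
    show ?case by (simp add: toggle_hi_def min_def)
  next
    case (Suc K)
    have "?hi (Suc K) + ?lo K = ?A (Suc K) + ?B K"
      by (auto simp: toggle_hi_def toggle_lo_def min_def max_def)
    thus ?case using Suc.IH by simp
  qed
  from this[of L] have "(\<Sum>i<L. ?hi i) + (\<Sum>i<L. ?lo i) = (\<Sum>i<L. ?A i) + (\<Sum>i<L. ?B i)"
    using strip_chains_le[OF P, of "Suc z" L] L[of L] by (simp add: toggle_hi_def)
  moreover have "(\<Sum>i<L. min (toggle j z P z i) j) + (\<Sum>i<L. min (P z i) j) = (\<Sum>i<L. ?hi i) + (\<Sum>i<L. ?lo i)"
    unfolding sum.distrib[symmetric] using pt by (intro sum.cong refl) simp
  ultimately show ?thesis by (simp add: head_def)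
qed

lemma head_toggle_other: "y \<noteq> z \<Longrightarrow> head L (toggle j z P) j y = head L P j y"
  by (simp add: head_def toggle_other)

section \<open>Exchanging two letters at distance at most two\<close>

text \<open>
  Each toggle exchanges the numbers of two neighbouring letters, so three of them reverse the numbers
  of three neighbouring letters.
\<close>

definition swap_letters :: "nat \<Rightarrow> nat \<Rightarrow> nat \<Rightarrow> (nat \<Rightarrow> nat \<Rightarrow> nat) \<Rightarrow> nat \<Rightarrow> nat \<Rightarrow> nat" where
  "swap_letters j x y P =
     (if y = Suc x then toggle j x P else toggle j x (toggle j (Suc x) (toggle j x P)))"

text \<open>
  This is where the letters must be at most two apart. Without an \<open>x\<close> in column \<open>j\<close>, the toggle at
  \<open>x\<close> meets no obstacle there. An entry \<open>Suc x\<close> in column \<open>j\<close> could obstruct the toggle at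
  \<open>Suc x\<close>; but the entry \<open>Suc (Suc x)\<close> in the same column then lies directly below it, and so the row
  of \<open>Suc x\<close> cannot hold \<open>Suc (Suc x)\<close> further to the left.
\<close>

lemma swap_letters:
  assumes P: "P \<in> strip_chains r mu kap" and kap: "is_partition kap"
    and x: "1 \<le> x" and y: "y = Suc x \<or> y = Suc (Suc x)" "y \<le> r"
    and nox: "\<And>i. (i, j) \<notin> strip P x" and hasy: "(i0, j) \<in> strip P y"
  defines "Q \<equiv> swap_letters j x y P"
  shows "Q \<in> strip_chains r mu kap" and "same_tails j P Q" and "swap_letters j x y Q = P"
    and "weight Q x + tail P j y = weight P y + tail P j x"
    and "weight Q y + tail P j x = weight P x + tail P j y"
    and "z \<noteq> x \<Longrightarrow> z \<noteq> y \<Longrightarrow> weight Q z = weight P z"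
proof -
  obtain L where L: "\<And>i. i \<ge> L \<Longrightarrow> kap i = 0" using partition_bound kap by metis
  have ok: "toggle_ok j x P" using nox unfolding toggle_ok_def
    by (auto simp: strip_def skew_diagram_def not_le[symmetric])
  let ?P1 = "toggle j x P"
  have c1: "?P1 \<in> strip_chains r mu kap" and s1: "same_tails j P ?P1"
    and h1: "head L ?P1 j x + head L P j x = head L P j (Suc x) + head L P j (x - 1)"
    using toggle_strip_chains[OF P kap x] same_tails_toggle[OF P kap x] head_toggle[OF P kap L x ok] y by auto
  have Q: "Q \<in> strip_chains r mu kap \<and> same_tails j P Q \<and> swap_letters j x y Q = P \<and>
      head L Q j x + head L P j (y - 1) = head L P j y + head L P j (x - 1) \<and>
      head L Q j (y - 1) + head L P j x = head L P j y + head L P j (x - 1) \<and>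
      (\<forall>z. z < x \<or> y \<le> z \<longrightarrow> head L Q j z = head L P j z)"
    using y(1)
  proof
    assume "y = Suc x"
    thus ?thesis unfolding Q_def swap_letters_def
      using c1 s1 h1 toggle_toggle[OF P kap x] y(2) by (auto simp: head_toggle_other)
  next
    assume yy: "y = Suc (Suc x)"
    have x2: "1 \<le> Suc x" "Suc x < r" "x < r" using yy y by auto
    have "toggle_ok j (Suc x) P"
      unfolding toggle_ok_def
    proof (intro allI impI)
      fix i assume i: "j < P (Suc x) i"
      have i0: "P (Suc x) i0 \<le> j" "j < P (Suc (Suc x)) i0"
        using hasy yy by (auto simp: strip_def skew_diagram_def)
      have "i < i0"
      proof (rule ccontr)
        assume "\<not> i < i0"
        hence "P (Suc x) i \<le> P (Suc x) i0"
          by (intro is_partition_antimono[OF strip_chains_partition[OF P kap]]) simp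
        thus False using i i0 by simp
      qed
      hence "P (Suc (Suc x)) i0 \<le> P (Suc (Suc x)) (Suc i)"
        by (intro is_partition_antimono[OF strip_chains_partition[OF P kap]]) simp
      thus "j < P (Suc (Suc x)) (Suc i) \<or> j < P (Suc x - 1) i" using i0 by simp
    qed
    hence ok2: "toggle_ok j (Suc x) ?P1" by (rule same_tails_toggle_ok[OF s1])
    let ?P2 = "toggle j (Suc x) ?P1"
    have c2: "?P2 \<in> strip_chains r mu kap" and s2: "same_tails j ?P1 ?P2"
      and h2: "head L ?P2 j (Suc x) + head L ?P1 j (Suc x) = head L ?P1 j (Suc (Suc x)) + head L ?P1 j x"
      using toggle_strip_chains[OF c1 kap x2(1,2)] same_tails_toggle[OF c1 kap x2(1)]
        head_toggle[OF c1 kap L x2(1) ok2] by auto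
    have ok3: "toggle_ok j x ?P2"
      using same_tails_toggle_ok[OF same_tails_trans[OF s1 s2] ok] .
    let ?P3 = "toggle j x ?P2"
    have c3: "?P3 \<in> strip_chains r mu kap" and s3: "same_tails j ?P2 ?P3"
      and h3: "head L ?P3 j x + head L ?P2 j x = head L ?P2 j (Suc x) + head L ?P2 j (x - 1)"
      using toggle_strip_chains[OF c2 kap x x2(3)] same_tails_toggle[OF c2 kap x]
        head_toggle[OF c2 kap L x ok3] by auto
    have Q3: "Q = ?P3" unfolding Q_def swap_letters_def using yy by simp
    have "swap_letters j x y Q = P"
      unfolding Q3 swap_letters_def using yy toggle_toggle[OF c2 kap x x2(3)]
        toggle_toggle[OF c1 kap x2(1,2)] toggle_toggle[OF P kap x x2(3)] by simp
    moreover have "same_tails j P Q" unfolding Q3 using s1 s2 s3 same_tails_trans by blast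
    moreover have "head L Q j z = head L P j z" if "z < x \<or> y \<le> z" for z
      unfolding Q3 using that yy by (auto simp: head_toggle_other)
    moreover have "head L Q j x + head L P j (y - 1) = head L P j y + head L P j (x - 1) \<and>
      head L Q j (y - 1) + head L P j x = head L P j y + head L P j (x - 1)"
      using h1 h2 h3 yy x unfolding Q3 by (simp add: head_toggle_other)
    ultimately show ?thesis using c3 unfolding Q3 by blast
  qed
  thus Qc: "Q \<in> strip_chains r mu kap" and st: "same_tails j P Q" and "swap_letters j x y Q = P" by auto
  have ta: "tail Q j u = tail P j u" for u using same_tails_tail[OF st, of j u] by simp
  have w: "weight Q u + head L Q j (u - 1) = tail P j u + head L Q j u"
    "weight P u + head L P j (u - 1) = tail P j u + head L P j u" for u
    using weight_tail_head[OF Qc kap, of L u j] weight_tail_head[OF P kap, of L u j] L ta by auto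
  have hx: "head L Q j (x - 1) = head L P j (x - 1)" and hy: "head L Q j y = head L P j y"
    using Q x by auto
  show "weight Q x + tail P j y = weight P y + tail P j x"
    using w(1)[of x] w(2)[of y] Q hx by linarith
  show "weight Q y + tail P j x = weight P x + tail P j y"
    using w(1)[of y] w(2)[of x] Q hy by linarith
  assume z: "z \<noteq> x" "z \<noteq> y"
  show "weight Q z = weight P z"
  proof (cases "z < x \<or> y < z")
    case True
    have "head L Q j z = head L P j z \<and> head L Q j (z - 1) = head L P j (z - 1)"
      using Q True by auto
    thus ?thesis using w[of z] by linarith
  next
    case False
    hence zz: "z = Suc x" "y = Suc (Suc x)" using z y by auto
    thus ?thesis using w[of z] Q by simp
  qed
qed

section \<open>Cancelling the tableaux that fail the pairing conditions\<close>

text \<open>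
  A triple \<open>(x, y, d)\<close> demands that, reading columns from right to left, the number of \<open>y\<close> never
  gets ahead of the number of \<open>x\<close> by \<open>d\<close> or more.
\<close>

definition violates :: "(nat \<times> nat \<times> nat) set \<Rightarrow> (nat \<Rightarrow> nat \<Rightarrow> nat) \<Rightarrow> nat \<Rightarrow> nat \<times> nat \<times> nat \<Rightarrow> bool" where
  "violates E P j e \<longleftrightarrow> e \<in> E \<and> (case e of (x, y, d) \<Rightarrow> d + tail P j x \<le> tail P j y)"

text \<open>
  The reflection principle. At the rightmost column \<open>j\<close> with a violation, column \<open>j\<close> holds a \<open>y\<close>
  and no \<open>x\<close>, and the excess is exactly \<open>d\<close>; exchanging the numbers of \<open>x\<close> and \<open>y\<close> to the left of
  \<open>j\<close> then reflects the whole content, and changes nothing from which \<open>j\<close> and the triple were found.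
\<close>

lemma cancel_violations:
  fixes g :: "(nat \<Rightarrow> nat) \<Rightarrow> int"
  assumes kap: "is_partition kap"
    and E: "\<And>x y d. (x, y, d) \<in> E \<Longrightarrow> 1 \<le> x \<and> (y = Suc x \<or> y = Suc (Suc x)) \<and> y \<le> r \<and> 0 < d"
    and g: "\<And>x y d w w'. (x, y, d) \<in> E \<Longrightarrow> d + w' x = w y \<Longrightarrow> w' y = d + w x \<Longrightarrow>
              (\<And>z. z \<noteq> x \<Longrightarrow> z \<noteq> y \<Longrightarrow> w' z = w z) \<Longrightarrow> g w' = - g w"
  shows "(\<Sum>P\<in>strip_chains r mu kap. g (weight P)) =
     (\<Sum>P | P \<in> strip_chains r mu kap \<and> (\<forall>j e. \<not> violates E P j e). g (weight P))"
proof -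
  define J where "J = (\<lambda>P. GREATEST j. \<exists>e. violates E P j e)"
  define phi where "phi = (\<lambda>P. case SOME e. violates E P (J P) e of (x, y, d) \<Rightarrow> swap_letters (J P) x y P)"
  let ?C = "strip_chains r mu kap"
  let ?bad = "{P \<in> ?C. \<exists>j e. violates E P j e}"
  have key: "phi P \<in> ?bad \<and> phi (phi P) = P \<and> g (weight (phi P)) = - g (weight P)" if "P \<in> ?bad" for P
  proof -
    have P: "P \<in> ?C" and ex: "\<exists>j e. violates E P j e" using that by auto
    have bnd: "j \<le> kap 0" if "\<exists>e. violates E P' j e" "P' \<in> ?C" for j P'
    proof (rule ccontr)
      assume "\<not> j \<le> kap 0"
      hence "tail P' j y = 0" for y using tail_beyond[OF that(2) kap] by simp
      thus False using that(1) E by (fastforce simp: violates_def)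
    qed
    define j where "j = J P"
    define e where "e = (SOME e. violates E P j e)"
    have "\<exists>e. violates E P j e"
      unfolding j_def J_def using ex bnd[OF _ P] by (rule GreatestI_ex_nat)
    hence ve: "violates E P j e" unfolding e_def by (rule someI_ex)
    obtain x y d where xyd: "e = (x, y, d)" by (cases e) auto
    have inE: "(x, y, d) \<in> E" and v: "d + tail P j x \<le> tail P j y"
      using ve by (auto simp: violates_def xyd)
    have nv: "\<not> violates E P j' e'" if "j < j'" for j' e'
    proof
      assume "violates E P j' e'"
      hence "j' \<le> j" unfolding j_def J_def using bnd[OF _ P] by (intro Greatest_le_nat) blast+
      thus False using that by simp
    qed
    have "tail P (Suc j) y < d + tail P (Suc j) x"
      using nv[of "Suc j" e] inE by (simp add: violates_def xyd)
    hence nox: "\<And>i. (i, j) \<notin> strip P x" and hasy: "\<exists>i. (i, j) \<in> strip P y"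
      and eq: "tail P j y = d + tail P j x"
      using v tail_step[OF P kap, of j x] tail_step[OF P kap, of j y] by (auto split: if_splits)
    obtain i0 where i0: "(i0, j) \<in> strip P y" using hasy by blast
    define Q where "Q = swap_letters j x y P"
    note sw = swap_letters[OF P kap conjunct1[OF E[OF inE]] _ _ nox i0, folded Q_def]
    have Q: "Q \<in> ?C" and st: "same_tails j P Q" and undo: "swap_letters j x y Q = P"
      and wx: "weight Q x + tail P j y = weight P y + tail P j x"
      and wy: "weight Q y + tail P j x = weight P x + tail P j y"
      and wz: "\<And>z. z \<noteq> x \<Longrightarrow> z \<noteq> y \<Longrightarrow> weight Q z = weight P z"
      using sw E[OF inE] by blast+
    have phi: "phi P = Q" by (simp add: phi_def Q_def j_def[symmetric] e_def[symmetric] xyd)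
    have veq: "violates E Q j' = violates E P j'" if "j \<le> j'" for j'
      by (rule ext) (simp add: violates_def same_tails_tail[OF st that])
    have JQ: "J Q = j" unfolding J_def
    proof (rule Greatest_equality)
      show "\<exists>e. violates E Q j e" using veq[OF order_refl] ve by metis
      fix j' assume "\<exists>e. violates E Q j' e"
      thus "j' \<le> j" using veq[of j'] nv[of j'] by (metis leI less_imp_le)
    qed
    have "phi Q = P" using undo veq[of j] by (simp add: phi_def JQ e_def[symmetric] xyd)
    moreover have "g (weight Q) = - g (weight P)"
      by (rule g[OF inE]) (use wx wy wz eq in auto)
    moreover have "Q \<in> ?bad" using Q veq[OF order_refl] ve by (metis (mono_tags, lifting) mem_Collect_eq)
    ultimately show ?thesis by (simp add: phi)
  qed
  have "(\<Sum>P\<in>?bad. g (weight P)) = 0"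
    by (rule sum_involution_cancel[where phi = phi]) (use key in blast)+
  moreover have "(\<Sum>P\<in>?C. g (weight P)) = (\<Sum>P\<in>?bad. g (weight P)) +
      (\<Sum>P | P \<in> ?C \<and> (\<forall>j e. \<not> violates E P j e). g (weight P))"
    by (subst sum.union_disjoint[symmetric]) (auto intro!: sum.cong finite_subset[OF _ finite_strip_chains[OF kap]])
  ultimately show ?thesis by simp
qed

section \<open>Disjoint Northeast pairs\<close>

text \<open>
  Hall's condition for matching the elements of \<open>Y\<close> with larger ones of \<open>X\<close>, leaving \<open>d\<close> unmatched:
  match the largest of \<open>Y\<close> with the largest of \<open>X\<close>, or drop it as long as some may be dropped.
\<close>

lemma matching_upwards:
  fixes X Y :: "nat set"
  assumes "finite X" "finite Y" "card Y = a + d"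
    and "\<And>j. card {y \<in> Y. j \<le> y} \<le> card {x \<in> X. j \<le> x} + d"
  shows "\<exists>f Y'. Y' \<subseteq> Y \<and> card Y' = a \<and> inj_on f Y' \<and> f ` Y' \<subseteq> X \<and> (\<forall>y\<in>Y'. y \<le> f y)"
  using assms
proof (induction "card Y" arbitrary: X Y a d)
  case 0
  thus ?case by (intro exI[of _ id] exI[of _ "{}"]) auto
next
  case (Suc n)
  note fin = Suc.prems(1,2)
  define y1 where "y1 = Max Y"
  have y1: "y1 \<in> Y" "\<And>y. y \<in> Y \<Longrightarrow> y \<le> y1"
    using fin Suc.hyps(2) unfolding y1_def by (auto intro: Max_in)
  define Z where "Z = Y - {y1}"
  have Z: "finite Z" "card Z = n" "Z \<subseteq> Y" using fin y1 Suc.hyps(2) by (auto simp: Z_def)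
  have cY: "card {y \<in> Y. j \<le> y} = Suc (card {y \<in> Z. j \<le> y})" if "j \<le> y1" for j
  proof -
    have "{y \<in> Y. j \<le> y} = insert y1 {y \<in> Z. j \<le> y}" using y1 that by (auto simp: Z_def)
    thus ?thesis using Z by (simp add: Z_def)
  qed
  have cZ: "card {y \<in> Z. j \<le> y} = 0" if "\<not> j \<le> y1" for j
  proof -
    have "{y \<in> Z. j \<le> y} = {}" using y1(2) that Z(3) by fastforce
    thus ?thesis by (simp only: card.empty)
  qed
  show ?case
  proof (cases d)
    case (Suc d')
    have "card {y \<in> Z. j \<le> y} \<le> card {x \<in> X. j \<le> x} + d'" for j
      using Suc.prems(4)[of j] cY[of j] cZ[of j] Suc by (cases "j \<le> y1") auto
    from Suc.hyps(1)[OF Z(2)[symmetric] fin(1) Z(1) _ this, of a] Suc.prems(3) Suc.hyps(2) Z Suc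
    show ?thesis by fastforce
  next
    case 0
    have "card {x \<in> X. y1 \<le> x} \<noteq> 0" using Suc.prems(4)[of y1] cY[of y1] 0 by simp
    then obtain x0 where "x0 \<in> X" "y1 \<le> x0" by (metis (mono_tags, lifting) Collect_empty_eq card.empty)
    define x1 where "x1 = Max X"
    have x1: "x1 \<in> X" "y1 \<le> x1"
      using fin(1) \<open>x0 \<in> X\<close> le_trans[OF \<open>y1 \<le> x0\<close> Max_ge[OF fin(1) \<open>x0 \<in> X\<close>]]
      unfolding x1_def by (blast intro: Max_in)+
    define X' where "X' = X - {x1}"
    have "card {y \<in> Z. j \<le> y} \<le> card {x \<in> X'. j \<le> x} + 0" for j
    proof (cases "j \<le> y1")
      case True
      have "{x \<in> X. j \<le> x} = insert x1 {x \<in> X'. j \<le> x}" using x1 True by (auto simp: X'_def)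
      hence "card {x \<in> X. j \<le> x} = Suc (card {x \<in> X'. j \<le> x})" using fin by (simp add: X'_def)
      thus ?thesis using Suc.prems(4)[of j] cY[OF True] 0 by simp
    qed (simp add: cZ)
    moreover have "finite X'" "card Z = n + 0" using fin Z by (auto simp: X'_def)
    ultimately obtain f Y' where f: "Y' \<subseteq> Z" "card Y' = n" "inj_on f Y'" "f ` Y' \<subseteq> X'" "\<forall>y\<in>Y'. y \<le> f y"
      using Suc.hyps(1)[OF Z(2)[symmetric] _ Z(1), of X' n 0] by blast
    have ny: "y1 \<notin> Y'" using f(1) by (auto simp: Z_def)
    have nx: "x1 \<notin> f ` Y'" using f(4) by (auto simp: X'_def)
    have eq: "(f(y1 := x1)) ` Y' = f ` Y'" using ny by (intro image_cong) auto
    have "inj_on (f(y1 := x1)) (insert y1 Y')"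
      using f(3) ny nx by (auto simp: inj_on_def)
    moreover have "card (insert y1 Y') = a"
      using ny f(1,2) Z finite_subset[OF f(1) Z(1)] Suc.prems(3) Suc.hyps(2) 0 by simp
    moreover have "insert y1 Y' \<subseteq> Y" "(f(y1 := x1)) ` insert y1 Y' \<subseteq> X"
      using f Z y1 x1 ny eq by (auto simp: X'_def)
    moreover have "\<forall>y\<in>insert y1 Y'. y \<le> (f(y1 := x1)) y" using f(5) x1 by auto
    ultimately show ?thesis by blast
  qed
qed

lemma strip_order:
  assumes P: "P \<in> strip_chains r mu kap" and kap: "is_partition kap" and xy: "x < y"
    and s: "(i, c) \<in> strip P x" and t: "(i', c') \<in> strip P y" and c: "c' \<le> c"
  shows "i < i'"
proof (rule ccontr)
  assume "\<not> i < i'"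
  have "c < P x i" using s by (simp add: strip_def skew_diagram_def)
  also have "\<dots> \<le> P x i'" using is_partition_antimono[OF strip_chains_partition[OF P kap]] \<open>\<not> i < i'\<close> by simp
  also have "\<dots> \<le> P (y - 1) i'" by (rule strip_chains_mono[OF P]) (use xy in simp)
  also have "\<dots> \<le> c'" using t by (simp add: strip_def skew_diagram_def)
  finally show False using c by simp
qed

text \<open>
  For \<open>x < y\<close>, an entry \<open>x\<close> is Northeast of an entry \<open>y\<close> as soon as its column is not to the left of
  that of \<open>y\<close>. So the pairs are a matching problem about columns only.
\<close>

lemma has_disjoint_ne_pairs_iff:
  assumes kap: "is_partition kap" and P: "P \<in> strip_chains r mu kap" and x: "1 \<le> x" and xy: "x < y"
  shows "has_disjoint_ne_pairs (skew_diagram kap mu) (tableau_of (skew_diagram kap mu) P) a x y \<longleftrightarrow>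
     (\<forall>j. tail P j y + a \<le> tail P j x + weight P y)"
proof -
  let ?D = "skew_diagram kap mu"
  let ?T = "tableau_of ?D P"
  have Tx: "s \<in> ?D \<and> ?T s = z \<longleftrightarrow> s \<in> strip P z" if "1 \<le> z" for s z
    using tableau_of_letter[OF P that] by blast
  have cells: "s \<in> ?D \<and> t \<in> ?D \<and> ?T s = x \<and> ?T t = y \<and> northeast s t \<longleftrightarrow>
      s \<in> strip P x \<and> t \<in> strip P y \<and> snd t \<le> snd s" for s t
    using Tx[of x s] Tx[of y t] x xy strip_order[OF P kap xy, of "fst s" "snd s" "fst t" "snd t"]
    by (auto simp: northeast_def)
  have fin: "finite (strip P z)" for z by (rule finite_strip[OF P kap])
  have disj: "strip P x \<inter> strip P y = {}"
    using strip_order[OF P kap xy] by (metis disjoint_iff_not_equal less_irrefl order_refl surj_pair)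
  have inj: "inj_on snd (strip P z)" for z
    using strip_column_unique[OF P kap] by (auto simp: inj_on_def)
  have tailX: "tail P j z = card {c \<in> snd ` strip P z. j \<le> c}" for j z
  proof -
    have "{c \<in> snd ` strip P z. j \<le> c} = snd ` {(i, c) \<in> strip P z. j \<le> c}" by force
    moreover have "inj_on snd {(i, c) \<in> strip P z. j \<le> c}" by (rule inj_on_subset[OF inj]) auto
    ultimately show ?thesis by (simp add: tail_def card_image)
  qed
  show ?thesis
  proof
    assume "has_disjoint_ne_pairs ?D ?T a x y"
    then obtain Q where Q: "finite Q" "a \<le> card Q"
      and "\<forall>(s, t)\<in>Q. s \<in> strip P x \<and> t \<in> strip P y \<and> snd t \<le> snd s"
      and pw: "pairwise (\<lambda>(s, t) (s', t'). {s, t} \<inter> {s', t'} = {}) Q"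
      unfolding has_disjoint_ne_pairs_def cells by blast
    hence cell: "\<And>s t. (s, t) \<in> Q \<Longrightarrow> s \<in> strip P x \<and> t \<in> strip P y \<and> snd t \<le> snd s" by blast
    have pw': "{s, t} \<inter> {s', t'} = {}" if "(s, t) \<in> Q" "(s', t') \<in> Q" "(s, t) \<noteq> (s', t')" for s t s' t'
      using pairwiseD[OF pw that] by simp
    have i1: "inj_on fst Q" and i2: "inj_on snd Q"
      using pw' unfolding inj_on_def by (metis Int_iff empty_iff insertI1 insertI2 prod.collapse)+
    show "\<forall>j. tail P j y + a \<le> tail P j x + weight P y"
    proof
      fix j
      let ?Q1 = "{q \<in> Q. j \<le> snd (snd q)}" and ?Q2 = "{q \<in> Q. snd (snd q) < j}"
      have "card ?Q1 \<le> tail P j x" unfolding tail_def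
        by (rule card_inj_on_le[of fst])
           (use cell in \<open>auto intro!: inj_on_subset[OF i1] finite_subset[OF _ fin[of x]] dest: le_trans\<close>, fastforce)
      moreover have "card ?Q2 \<le> card {(i, c) \<in> strip P y. c < j}"
        by (rule card_inj_on_le[of snd])
           (use cell in \<open>auto intro!: inj_on_subset[OF i2] finite_subset[OF _ fin[of y]]\<close>)
      moreover have "card Q = card ?Q1 + card ?Q2"
        by (subst card_Un_disjoint[symmetric]) (auto intro!: arg_cong[of _ _ card] simp: Q)
      moreover have "weight P y = tail P j y + card {(i, c) \<in> strip P y. c < j}"
        unfolding weight_def tail_def
        by (subst card_Un_disjoint[symmetric])
           (auto intro!: arg_cong[of _ _ card] intro: finite_subset[OF _ fin[of y]])
      ultimately show "tail P j y + a \<le> tail P j x + weight P y" using Q(2) by linarith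
    qed
  next
    assume A: "\<forall>j. tail P j y + a \<le> tail P j x + weight P y"
    let ?X = "snd ` strip P x" and ?Y = "snd ` strip P y"
    have cY: "card ?Y = weight P y" using inj by (simp add: weight_def card_image)
    have "a \<le> weight P y"
      using A[rule_format, of "kap 0"] tail_beyond[OF P kap, of "kap 0"] by simp
    then obtain d where d: "weight P y = a + d" using le_Suc_ex by blast
    have "\<exists>f Y'. Y' \<subseteq> ?Y \<and> card Y' = a \<and> inj_on f Y' \<and> f ` Y' \<subseteq> ?X \<and> (\<forall>c\<in>Y'. c \<le> f c)"
    proof (rule matching_upwards)
      show "card {c \<in> ?Y. j \<le> c} \<le> card {c \<in> ?X. j \<le> c} + d" for j
        using A[rule_format, of j] d unfolding tailX by simp
    qed (use fin cY d in auto)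
    then obtain f Y' where f: "Y' \<subseteq> ?Y" "card Y' = a" "inj_on f Y'" "f ` Y' \<subseteq> ?X" "\<forall>c\<in>Y'. c \<le> f c"
      by blast
    define cell where "cell = (\<lambda>z c. inv_into (strip P z) snd c)"
    have cell: "cell z c \<in> strip P z" "snd (cell z c) = c" if "c \<in> snd ` strip P z" for z c
      using inv_into_into[OF that] f_inv_into_f[OF that] by (auto simp: cell_def)
    define Q where "Q = (\<lambda>c. (cell x (f c), cell y c)) ` Y'"
    have Yc: "cell x (f c) \<in> strip P x" "snd (cell x (f c)) = f c" "cell y c \<in> strip P y" "snd (cell y c) = c"
      if "c \<in> Y'" for c
      using cell[of "f c" x] cell[of c y] subsetD[OF f(1) that] subsetD[OF f(4) imageI[OF that]] by blast+
    have finY: "finite Y'" using f(1) fin finite_subset by blast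
    have "inj_on (\<lambda>c. (cell x (f c), cell y c)) Y'"
      by (rule inj_on_inverseI[where g = "\<lambda>q. snd (snd q)"]) (simp add: Yc(4))
    hence "card Q = a" by (simp add: Q_def card_image f(2))
    moreover have "finite Q" using finY by (simp add: Q_def)
    moreover have "\<forall>(s, t)\<in>Q. s \<in> ?D \<and> t \<in> ?D \<and> ?T s = x \<and> ?T t = y \<and> northeast s t"
      unfolding cells using Yc f(5) by (auto simp: Q_def)
    moreover have "pairwise (\<lambda>(s, t) (s', t'). {s, t} \<inter> {s', t'} = {}) Q"
    proof -
      have "{cell x (f c), cell y c} \<inter> {cell x (f c'), cell y c'} = {}"
        if c: "c \<in> Y'" "c' \<in> Y'" "c \<noteq> c'" for c c'
      proof -
        have "f c \<noteq> f c'" using f(3) c by (auto simp: inj_on_def)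
        hence "cell x (f c) \<noteq> cell x (f c')" "cell y c \<noteq> cell y c'"
          using Yc c by metis+
        moreover have "cell x (f c) \<noteq> cell y c'" "cell y c \<noteq> cell x (f c')"
          using Yc(1,3) c disj by (metis disjoint_iff_not_equal)+
        ultimately show ?thesis by auto
      qed
      thus ?thesis unfolding Q_def pairwise_def by auto
    qed
    ultimately show "has_disjoint_ne_pairs ?D ?T a x y"
      unfolding has_disjoint_ne_pairs_def by (intro exI[of _ Q] conjI) (assumption | simp)+
  qed
qed

lemma common_columns_eq:
  assumes "antimono lam" "antimono mu"
  shows "common_columns lam mu i = lam (Suc i) - mu i"
proof -
  have "mu (Suc i) \<le> mu i" "lam (Suc i) \<le> lam i" using assms by (auto simp: antimono_iff_le_Suc)
  hence "{j. (i, j) \<in> skew_diagram lam mu \<and> (Suc i, j) \<in> skew_diagram lam mu} = {mu i..<lam (Suc i)}"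
    by (auto simp: skew_diagram_def)
  thus ?thesis by (simp add: common_columns_def)
qed

text \<open>
  Of the \<open>lam (Suc i) - mu (Suc i)\<close> entries \<open>y\<close>, at most \<open>mu i - mu (Suc i)\<close> may stay unpaired if the two
  rows overlap; if they do not, there are too few entries \<open>y\<close> for more than that.
\<close>

lemma ne_pairs_common_columns:
  assumes kap: "is_partition kap" and P: "P \<in> strip_chains r mu' kap" and x: "1 \<le> x" and xy: "x < y"
    and lam: "antimono lam" and mu: "antimono mu"
    and wy: "mu (Suc i) + weight P y = lam (Suc i)"
  shows "has_disjoint_ne_pairs (skew_diagram kap mu') (tableau_of (skew_diagram kap mu') P)
       (common_columns lam mu i) x y \<longleftrightarrow> (\<forall>j. tail P j y < Suc (mu i - mu (Suc i)) + tail P j x)"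
proof -
  have mi: "mu (Suc i) \<le> mu i" using mu by (simp add: antimono_iff_le_Suc)
  have tw: "tail P j y \<le> weight P y" for j unfolding tail_def weight_def
    by (rule card_mono[OF finite_strip[OF P kap]]) auto
  have "tail P j y + (lam (Suc i) - mu i) \<le> tail P j x + weight P y \<longleftrightarrow>
      tail P j y < Suc (mu i - mu (Suc i)) + tail P j x" for j
    using mi tw[of j] wy by linarith
  thus ?thesis unfolding has_disjoint_ne_pairs_iff[OF kap P x xy] common_columns_eq[OF lam mu] by simp
qed

section \<open>Letter positions in the words\<close>

definition poslist :: "'a \<Rightarrow> 'a list \<Rightarrow> nat list" where
  "poslist x w = filter (\<lambda>p. w ! p = x) [0..<length w]"

lemma poslist_append: "poslist x (u @ v) = poslist x u @ map (\<lambda>p. length u + p) (poslist x v)"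
proof -
  have "[0..<length (u @ v)] = [0..<length u] @ map (\<lambda>p. length u + p) [0..<length v]"
    using upt_add_eq_append[of 0 "length u" "length v"] map_add_upt[of "length u" "length v"]
    by (simp add: add.commute)
  moreover have "filter (\<lambda>p. (u @ v) ! p = x) [0..<length u] = filter (\<lambda>p. u ! p = x) [0..<length u]"
    by (rule filter_cong) (auto simp: nth_append)
  ultimately show ?thesis unfolding poslist_def by (simp add: filter_map comp_def)
qed

lemma poslist_replicate: "poslist x (replicate m y) = (if x = y then [0..<m] else [])"
  unfolding poslist_def by (auto simp: filter_id_conv filter_empty_conv)

lemma poslist_alternating:
  assumes "a \<noteq> b"
  shows "poslist a (concat (replicate m [a, b])) = map (\<lambda>i. 2 * i) [0..<m]"
    and "poslist b (concat (replicate m [a, b])) = map (\<lambda>i. Suc (2 * i)) [0..<m]"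
proof (induction m)
  case (Suc m)
  have two: "poslist a [a, b] = [0]" "poslist b [a, b] = [1]" using assms by (auto simp: poslist_def)
  have up: "[0..<Suc m] = 0 # map Suc [0..<m]" by (simp add: map_Suc_upt upt_conv_Cons)
  have step: "poslist c (concat (replicate (Suc m) [a, b])) =
      poslist c [a, b] @ map (\<lambda>p. 2 + p) (poslist c (concat (replicate m [a, b])))" for c
    using poslist_append[of c "[a, b]" "concat (replicate m [a, b])"] by simp
  {
    case 1
    show ?case unfolding step two Suc.IH up by simp
  next
    case 2
    show ?case unfolding step two Suc.IH up by simp
  }
qed (auto simp: poslist_def)

lemma letter_pos_word:
  fixes a b :: letter
  assumes ab: "a \<noteq> b" and m: "m \<le> n" and i: "i < n"
    and w: "w = replicate m a @ concat (replicate (n - m) [b, a]) @ replicate m b"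
  shows "letter_pos a w i = (if i < m then Suc i else 2 * i + 2 - m)"
    and "letter_pos b w i = (if i < n - m then Suc (m + 2 * i) else Suc (n + i))"
proof -
  have len: "length (concat (replicate (n - m) [b, a])) = 2 * (n - m)" by (simp add: length_concat sum_list_replicate)
  have "poslist a w = [0..<m] @ map (\<lambda>i. m + Suc (2 * i)) [0..<n - m]"
    unfolding w using ab by (simp add: poslist_append poslist_replicate poslist_alternating comp_def)
  thus "letter_pos a w i = (if i < m then Suc i else 2 * i + 2 - m)"
    unfolding letter_pos_def poslist_def[symmetric] using i m by (auto simp: nth_append)
  have "poslist b w = map (\<lambda>i. m + 2 * i) [0..<n - m] @ map (\<lambda>i. m + (2 * (n - m) + i)) [0..<m]"
    unfolding w using ab len by (simp add: poslist_append poslist_replicate poslist_alternating comp_def)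
  thus "letter_pos b w i = (if i < n - m then Suc (m + 2 * i) else Suc (n + i))"
    unfolding letter_pos_def poslist_def[symmetric] using i m by (auto simp: nth_append)
qed

text \<open>
  The properties of the word \<open>P\<^sub>k\<close> behind the theorem: its two kinds of letters fill the positions,
  and two consecutive letters of one kind have at most one letter between them.
\<close>

definition interleaving :: "nat \<Rightarrow> (nat \<Rightarrow> nat) \<Rightarrow> (nat \<Rightarrow> nat) \<Rightarrow> bool" where
  "interleaving n p q \<longleftrightarrow> inj_on p {..<n} \<and> inj_on q {..<n} \<and> p ` {..<n} \<inter> q ` {..<n} = {} \<and>
     p ` {..<n} \<union> q ` {..<n} = {1..2 * n} \<and>
     (\<forall>i. Suc i < n \<longrightarrow> (p (Suc i) = Suc (p i) \<or> p (Suc i) = Suc (Suc (p i))) \<and>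
                         (q (Suc i) = Suc (q i) \<or> q (Suc i) = Suc (Suc (q i))))"

lemma interleaving_sym: "interleaving n p q \<Longrightarrow> interleaving n q p"
  unfolding interleaving_def by (simp add: Int_commute Un_commute)

lemma interleaving_word:
  fixes a b :: letter
  assumes ab: "a \<noteq> b" and m: "m \<le> n"
    and w: "w = replicate m a @ concat (replicate (n - m) [b, a]) @ replicate m b"
  shows "interleaving n (letter_pos a w) (letter_pos b w)"
proof -
  note pos = letter_pos_word[OF ab m _ w]
  have inj: "inj_on (letter_pos a w) {..<n}" "inj_on (letter_pos b w) {..<n}"
    using m by (auto simp: inj_on_def pos split: if_splits)
  have disj: "letter_pos a w ` {..<n} \<inter> letter_pos b w ` {..<n} = {}"
  proof -
    have "letter_pos a w i \<noteq> letter_pos b w i'" if ii: "i < n" "i' < n" for i i'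
    proof (cases "i < m")
      case True
      thus ?thesis using pos(1)[OF ii(1)] pos(2)[OF ii(2)] m by (auto split: if_splits)
    next
      case False
      then obtain e where e: "i = m + e" using le_Suc_ex not_less by blast
      have "letter_pos a w i = m + 2 * e + 2" using pos(1)[OF ii(1)] e by simp
      thus ?thesis using pos(2)[OF ii(2)] ii e by (cases "i' < n - m") (simp_all, presburger)
    qed
    thus ?thesis by fastforce
  qed
  have sub: "letter_pos a w ` {..<n} \<union> letter_pos b w ` {..<n} \<subseteq> {1..2 * n}"
    using m by (auto simp: pos split: if_splits)
  have "card (letter_pos a w ` {..<n} \<union> letter_pos b w ` {..<n}) = 2 * n"
    using inj disj by (simp add: card_Un_disjoint card_image)
  hence "letter_pos a w ` {..<n} \<union> letter_pos b w ` {..<n} = {1..2 * n}"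
    using sub by (intro card_subset_eq) auto
  moreover have "letter_pos a w (Suc i) = Suc (letter_pos a w i) \<or> letter_pos a w (Suc i) = Suc (Suc (letter_pos a w i))"
    if "Suc i < n" for i
    using that m pos(1)[of i] pos(1)[of "Suc i"] by (auto split: if_splits)
  moreover have "letter_pos b w (Suc i) = Suc (letter_pos b w i) \<or> letter_pos b w (Suc i) = Suc (Suc (letter_pos b w i))"
    if "Suc i < n" for i
    using that m pos(2)[of i] pos(2)[of "Suc i"] by (auto split: if_splits)
  ultimately show ?thesis using inj disj unfolding interleaving_def by blast
qed

lemma interleaving_path_word:
  assumes "1 \<le> \<bar>k\<bar>" "\<bar>k\<bar> \<le> int n"
  shows "interleaving n (letter_pos W (path_word n k)) (letter_pos N (path_word n k))"
proof (cases "k > 0")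
  case True
  show ?thesis
    by (rule interleaving_word[of W N "nat \<bar>k\<bar>"]) (use assms True in \<open>auto simp: path_word_def Let_def\<close>)
next
  case False
  show ?thesis
    by (rule interleaving_sym, rule interleaving_word[of N W "nat \<bar>k\<bar>"])
       (use assms False in \<open>auto simp: path_word_def Let_def\<close>)
qed

section \<open>Linear independence of Schur functions\<close>

lemma count_image_mset_set:
  assumes "finite D" shows "count (image_mset T (mset_set D)) x = card {s \<in> D. T s = x}"
proof -
  have "count (image_mset T (mset_set D)) x = (\<Sum>s | s \<in> D \<and> x = T s. 1)"
    using assms by (simp add: count_image_mset')
  also have "{s \<in> D. x = T s} = {s \<in> D. T s = x}" by auto
  finally show ?thesis by simp
qed

lemma skew_schur_kostka:
  assumes lam: "is_partition lam" and mu: "is_partition mu" and M: "set_mset M \<subseteq> {1..m}"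
  shows "skew_schur lam mu M = int (kostka m lam mu (count M))"
proof (cases "mu \<le> lam")
  case True
  let ?D = "skew_diagram lam mu"
  let ?A = "{P \<in> strip_chains m mu lam. \<forall>x\<in>{1..m}. weight P x = count M x}"
  let ?B = "{T \<in> ssyt {1..} ?D. image_mset T (mset_set ?D) = M}"
  have fin: "finite ?D" by (rule finite_skew_diagram[OF lam])
  note bij = bij_betw_tableau_of[OF lam mu True, of m]
  have cont: "image_mset T (mset_set ?D) = M \<longleftrightarrow> (\<forall>x\<in>{1..m}. card {s \<in> ?D. T s = x} = count M x)"
    if T: "T \<in> ssyt {1..m} ?D" for T
  proof -
    have "card {s \<in> ?D. T s = x} = count M x" if "x \<notin> {1..m}" for x
    proof -
      have "{s \<in> ?D. T s = x} = {}" using T that by (auto simp: ssyt_def PiE_def Pi_def)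
      hence "card {s \<in> ?D. T s = x} = 0" by (simp only: card.empty)
      moreover have "x \<notin># M" using M that by blast
      ultimately show ?thesis by (simp add: not_in_iff)
    qed
    thus ?thesis unfolding multiset_eq_iff count_image_mset_set[OF fin] by blast
  qed
  have sub: "T \<in> ssyt {1..m} ?D \<longleftrightarrow> T \<in> ssyt {1..} ?D" if "image_mset T (mset_set ?D) = M" for T
  proof -
    have "T s \<in> {1..m}" if "s \<in> ?D" for s
    proof -
      have "T s \<in># image_mset T (mset_set ?D)" using that fin by simp
      thus ?thesis using M \<open>image_mset T (mset_set ?D) = M\<close> by blast
    qed
    thus ?thesis by (auto simp: ssyt_def PiE_def Pi_def)
  qed
  have "tableau_of ?D ` ?A = ?B"
  proof (intro equalityI subsetI)
    fix T assume "T \<in> tableau_of ?D ` ?A"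
    then obtain P where P: "P \<in> strip_chains m mu lam" "\<forall>x\<in>{1..m}. weight P x = count M x"
      and T: "T = tableau_of ?D P" by auto
    have Ts: "T \<in> ssyt {1..m} ?D" using bij P(1) T by (auto simp: bij_betw_def)
    have "card {s \<in> ?D. T s = x} = weight P x" if "1 \<le> x" for x
      unfolding T weight_def using tableau_of_letter[OF P(1) that] by simp
    hence "image_mset T (mset_set ?D) = M" unfolding cont[OF Ts] using P(2) by simp
    thus "T \<in> ?B" using Ts sub by blast
  next
    fix T assume "T \<in> ?B"
    hence Ts: "T \<in> ssyt {1..m} ?D" and c: "image_mset T (mset_set ?D) = M" using sub by auto
    obtain P where P: "P \<in> strip_chains m mu lam" and T: "T = tableau_of ?D P"
      using bij Ts by (auto simp: bij_betw_def)
    have "card {s \<in> ?D. T s = x} = weight P x" if "1 \<le> x" for x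
      unfolding T weight_def using tableau_of_letter[OF P that] by simp
    hence "\<forall>x\<in>{1..m}. weight P x = count M x" using c unfolding cont[OF Ts] by simp
    thus "T \<in> tableau_of ?D ` ?A" using P T by blast
  qed
  hence "bij_betw (tableau_of ?D) ?A ?B" by (intro bij_betw_subset[OF bij]) auto
  from bij_betw_same_card[OF this] show ?thesis using True by (simp add: skew_schur_def kostka_def)
next
  case False
  have "strip_chains m mu lam = {}"
  proof (rule ccontr)
    assume "strip_chains m mu lam \<noteq> {}"
    then obtain P where P: "P \<in> strip_chains m mu lam" by blast
    have "mu i \<le> lam i" for i
      using strip_chains_ge[OF P, of i 0] strip_chains_le[OF P, of 0 i] by (rule le_trans)
    thus False using False by (simp add: le_fun_def)
  qed
  thus ?thesis using False by (simp add: skew_schur_def kostka_def)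
qed

lemma skew_schur_no_0:
  assumes lam: "is_partition lam" and M: "0 \<in># M" shows "skew_schur lam mu M = 0"
proof -
  have fin: "finite (skew_diagram lam mu)" by (rule finite_skew_diagram[OF lam])
  have "image_mset T (mset_set (skew_diagram lam mu)) \<noteq> M" if "T \<in> ssyt {1..} (skew_diagram lam mu)" for T
  proof
    assume "image_mset T (mset_set (skew_diagram lam mu)) = M"
    hence "0 \<in># image_mset T (mset_set (skew_diagram lam mu))" using M by simp
    then obtain s where "s \<in> skew_diagram lam mu" "T s = 0" using fin by auto
    moreover from this have "T s \<in> {1..}" using that unfolding ssyt_def by blast
    ultimately show False by simp
  qed
  hence "{T \<in> ssyt {1..} (skew_diagram lam mu). image_mset T (mset_set (skew_diagram lam mu)) = M} = {}"
    by blast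
  hence "card {T \<in> ssyt {1..} (skew_diagram lam mu).
      image_mset T (mset_set (skew_diagram lam mu)) = M} = 0" by (simp only: card.empty)
  thus ?thesis by (simp add: skew_schur_def)
qed

text \<open>
  The entries of row \<open>i\<close> of a tableau are at least \<open>Suc i\<close>, so the sum of all entries is smallest,
  with value \<open>row_stat\<close>, when equality holds everywhere. This makes the Kostka matrix triangular
  with respect to \<open>row_stat\<close>.
\<close>

definition row_stat :: "(nat \<Rightarrow> nat) \<Rightarrow> nat" where
  "row_stat kap = (\<Sum>s\<in>diagram kap. Suc (fst s))"

definition row_content :: "(nat \<Rightarrow> nat) \<Rightarrow> nat multiset" where
  "row_content kap = image_mset (\<lambda>s. Suc (fst s)) (mset_set (diagram kap))"

lemma finite_diagram: "is_partition kap \<Longrightarrow> finite (diagram kap)"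
  unfolding diagram_def by (rule finite_skew_diagram)

lemma schur_card:
  "schur kap M = int (card {T \<in> ssyt {1..} (diagram kap). image_mset T (mset_set (diagram kap)) = M})"
  unfolding schur_def skew_schur_def diagram_def by (simp add: le_fun_def)

lemma schur_row_content_nonzero:
  assumes kap: "is_partition kap" shows "schur kap (row_content kap) \<noteq> 0"
proof -
  let ?D = "diagram kap" and ?M = "row_content kap"
  let ?S = "{T \<in> ssyt {1..} ?D. image_mset T (mset_set ?D) = ?M}"
  have fin: "finite ?D" by (rule finite_diagram[OF kap])
  have "?S \<subseteq> ?D \<rightarrow>\<^sub>E set_mset ?M"
  proof
    fix T assume T: "T \<in> ?S"
    hence c: "image_mset T (mset_set ?D) = ?M" by simp
    have "T s \<in># ?M" if "s \<in> ?D" for s unfolding c[symmetric] using that fin by simp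
    thus "T \<in> ?D \<rightarrow>\<^sub>E set_mset ?M" using T by (simp add: ssyt_def PiE_iff)
  qed
  hence finS: "finite ?S" by (rule finite_subset) (simp add: fin finite_PiE)
  have "restrict (\<lambda>s. Suc (fst s)) ?D \<in> ?S"
  proof -
    have "image_mset (restrict (\<lambda>s. Suc (fst s)) ?D) (mset_set ?D) = ?M"
      unfolding row_content_def by (rule image_mset_cong) (simp add: fin)
    thus ?thesis by (auto simp: ssyt_def)
  qed
  hence "card ?S \<noteq> 0" using finS by auto
  thus ?thesis by (simp add: schur_card)
qed

lemma ssyt_entry_ge_row:
  assumes kap: "is_partition kap" and T: "T \<in> ssyt {1..} (diagram kap)"
  shows "(i, j) \<in> diagram kap \<Longrightarrow> Suc i \<le> T (i, j)"
proof (induction i)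
  case 0
  thus ?case using T by (auto simp: ssyt_def PiE_def Pi_def)
next
  case (Suc i)
  have "(i, j) \<in> diagram kap"
    using Suc.prems is_partition_antimono[OF kap, of i "Suc i"] by (simp add: diagram_def skew_diagram_def)
  moreover from this have "T (i, j) < T (Suc i, j)" using T Suc.prems by (simp add: ssyt_def)
  ultimately show ?case using Suc.IH by simp
qed

lemma schur_row_content_triangular:
  assumes kap: "is_partition kap" and kap': "is_partition kap'"
    and nz: "schur kap (row_content kap') \<noteq> 0"
  shows "row_stat kap \<le> row_stat kap'" and "row_stat kap = row_stat kap' \<Longrightarrow> kap = kap'"
proof -
  let ?D = "diagram kap"
  have "{T \<in> ssyt {1..} ?D. image_mset T (mset_set ?D) = row_content kap'} \<noteq> {}"
    using nz unfolding schur_card by (metis card.empty of_nat_0)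
  then obtain T where T: "T \<in> ssyt {1..} ?D" and c: "image_mset T (mset_set ?D) = row_content kap'" by blast
  have eq: "(\<Sum>s\<in>?D. T s) = row_stat kap'"
    using c unfolding row_stat_def row_content_def sum_unfold_sum_mset by simp
  have ge: "Suc (fst s) \<le> T s" if "s \<in> ?D" for s
    using ssyt_entry_ge_row[OF kap T, of "fst s" "snd s"] that by simp
  show "row_stat kap \<le> row_stat kap'" unfolding eq[symmetric] unfolding row_stat_def by (rule sum_mono[OF ge])
  assume "row_stat kap = row_stat kap'"
  hence "Suc (fst s) = T s" if "s \<in> ?D" for s
    using sum_mono_inv[of "\<lambda>s. Suc (fst s)" ?D T s] ge that finite_diagram[OF kap]
    unfolding eq[symmetric] unfolding row_stat_def by simp
  hence "row_content kap = row_content kap'"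
    unfolding c[symmetric] unfolding row_content_def by (intro image_mset_cong) (simp add: finite_diagram[OF kap])
  moreover have "count (row_content k) (Suc i) = k i" if "is_partition k" for k i
  proof -
    have "{s \<in> diagram k. Suc (fst s) = Suc i} = {i} \<times> {..<k i}"
      by (auto simp: diagram_def skew_diagram_def)
    thus ?thesis unfolding row_content_def count_image_mset_set[OF finite_diagram[OF that]] by simp
  qed
  ultimately show "kap = kap'" using kap kap' by (metis ext)
qed

lemma schur_expansion_unique:
  assumes c: "schur_expansion f c" and c': "schur_expansion f c'"
  shows "c = c'"
proof (rule ccontr)
  assume ne: "c \<noteq> c'"
  define K where "K = {kap. c kap \<noteq> 0} \<union> {kap. c' kap \<noteq> 0}"
  have finK: "finite K" using c c' by (simp add: K_def schur_expansion_def)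
  have partK: "is_partition kap" if "kap \<in> K" for kap
    using c c' that by (auto simp: K_def schur_expansion_def)
  have sumK: "f M = (\<Sum>kap\<in>K. e kap * schur kap M)" if "schur_expansion f e" "{kap. e kap \<noteq> 0} \<subseteq> K" for e M
  proof -
    have "f M = (\<Sum>kap | e kap \<noteq> 0. e kap * schur kap M)"
      using that(1) unfolding schur_expansion_def by metis
    also have "\<dots> = (\<Sum>kap\<in>K. e kap * schur kap M)"
      by (rule sum.mono_neutral_left[OF finK that(2)]) auto
    finally show ?thesis .
  qed
  have zero: "(\<Sum>kap\<in>K. (c kap - c' kap) * schur kap M) = 0" for M
    using sumK[OF c, of M] sumK[OF c', of M] by (simp add: K_def left_diff_distrib sum_subtractf)
  define D where "D = {kap \<in> K. c kap \<noteq> c' kap}"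
  obtain kap where "c kap \<noteq> c' kap" using ne by auto
  hence "kap \<in> D" by (cases "c kap = 0") (auto simp: D_def K_def)
  then obtain kap0 where k0: "kap0 \<in> D" and min: "\<And>kap. kap \<in> D \<Longrightarrow> row_stat kap0 \<le> row_stat kap"
    using ex_has_least_nat[of "\<lambda>k. k \<in> D" _ row_stat] by blast
  have p0: "is_partition kap0" using k0 partK by (simp add: D_def)
  let ?M = "row_content kap0"
  have "(c kap - c' kap) * schur kap ?M = (if kap = kap0 then (c kap - c' kap) * schur kap ?M else 0)"
    if "kap \<in> K" for kap
  proof (cases "kap = kap0 \<or> kap \<notin> D \<or> schur kap ?M = 0")
    case True
    thus ?thesis using that by (auto simp: D_def)
  next
    case False
    thus ?thesis using schur_row_content_triangular[OF partK[OF that] p0] min[of kap] by force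
  qed
  hence "(\<Sum>kap\<in>K. (c kap - c' kap) * schur kap ?M) =
      (\<Sum>kap\<in>K. if kap = kap0 then (c kap - c' kap) * schur kap ?M else 0)"
    by (intro sum.cong refl)
  also have "\<dots> = (c kap0 - c' kap0) * schur kap0 ?M"
    using k0 finK by (subst sum.delta) (auto simp: D_def)
  finally show False using zero[of ?M] k0 schur_row_content_nonzero[OF p0] by (simp add: D_def)
qed

lemma schur_coeff_eq: "schur_expansion f c \<Longrightarrow> schur_coeff f kap = c kap"
  unfolding schur_coeff_def by (metis schur_expansion_unique the_equality)

section \<open>Peelable tableaux and the product expansion\<close>

lemma coords_swap:
  assumes inj: "inj_on p {..<n}" and i: "Suc i < n"
    and w: "w' (p i) = w (p (Suc i))" "w' (p (Suc i)) = w (p i)"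
    and o: "\<And>z. z \<noteq> p i \<Longrightarrow> z \<noteq> p (Suc i) \<Longrightarrow> w' z = w z"
  shows "coords n p w' = coords n p w \<circ> transpose i (Suc i)"
proof
  fix j
  consider "j = i" | "j = Suc i" | "j \<noteq> i" "j \<noteq> Suc i" by blast
  thus "coords n p w' j = (coords n p w \<circ> transpose i (Suc i)) j"
  proof cases
    case 3
    moreover have "p j \<noteq> p i \<and> p j \<noteq> p (Suc i)" if "j < n"
      using inj_onD[OF inj, of j i] inj_onD[OF inj, of j "Suc i"] 3 that i by auto
    ultimately show ?thesis using o[of "p j"] by (simp add: coords_def transpose_def)
  qed (use i w in \<open>simp_all add: coords_def\<close>)
qed

text \<open>
  The vector with coordinates \<open>mu i + (n - i)\<close> plus the number of \<open>p i\<close> in the columns from \<open>j\<close> on is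
  strictly decreasing for all \<open>j\<close> iff these triples are not violated.
\<close>

definition demands :: "nat \<Rightarrow> (nat \<Rightarrow> nat) \<Rightarrow> (nat \<Rightarrow> nat) \<Rightarrow> (nat \<times> nat \<times> nat) set" where
  "demands n p mu = {(p i, p (Suc i), Suc (mu i - mu (Suc i))) | i. Suc i < n}"

text \<open>
  The number \<open>d\<close> is the difference of two neighbouring coordinates of the shifted \<open>mu\<close>, so exchanging
  contents up to \<open>d\<close> is a transposition of the shifted vector.
\<close>

lemma alternant_coords_swap:
  assumes inj: "inj_on p {..<n}" and mu: "antimono mu" and off: "coords n p off = shifted n mu"
    and e: "(x, y, d) \<in> demands n p mu" and w: "d + w' x = w y" "w' y = d + w x"
    and o: "\<And>z. z \<noteq> x \<Longrightarrow> z \<noteq> y \<Longrightarrow> w' z = w z"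
  shows "alternant n lam (coords n p (\<lambda>z. off z + w' z)) = - alternant n lam (coords n p (\<lambda>z. off z + w z))"
proof -
  obtain i where i: "Suc i < n" and xyd: "x = p i" "y = p (Suc i)" "d = Suc (mu i - mu (Suc i))"
    using e by (auto simp: demands_def)
  have "mu (Suc i) \<le> mu i" using mu by (simp add: antimono_iff_le_Suc)
  moreover have "off (p i) = mu i + (n - i)" "off (p (Suc i)) = mu (Suc i) + (n - Suc i)"
    using fun_cong[OF off, of i] fun_cong[OF off, of "Suc i"] i by (auto simp: coords_def shifted_def)
  ultimately have off': "off x = off y + d" using i xyd by simp
  have "coords n p (\<lambda>z. off z + w' z) = coords n p (\<lambda>z. off z + w z) \<circ> transpose i (Suc i)"
    by (rule coords_swap[OF inj i]) (use off' w o xyd in auto)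
  thus ?thesis using alternating_alternant i by (simp add: alternating_def)
qed

lemma coords_unchanged:
  assumes disj: "p ` {..<n} \<inter> q ` {..<n} = {}" and e: "(x, y, d) \<in> demands n p mu"
    and o: "\<And>z. z \<noteq> x \<Longrightarrow> z \<noteq> y \<Longrightarrow> w' z = w z"
  shows "coords n q (\<lambda>z. off z + w' z) = coords n q (\<lambda>z. off z + w z)"
proof
  fix j
  have "q j \<noteq> x \<and> q j \<noteq> y" if "j < n"
    using e disj that by (auto simp: demands_def) (metis Suc_lessD disjoint_iff imageI lessThan_iff)+
  thus "coords n q (\<lambda>z. off z + w' z) j = coords n q (\<lambda>z. off z + w z) j"
    using o[of "q j"] by (simp add: coords_def)
qed

lemma alternant_no_violation:
  assumes lam: "antimono lam" and mu: "antimono mu" and off: "coords n p off = shifted n mu"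
    and nv: "\<And>e. \<not> violates (demands n p mu) P 0 e"
  shows "alternant n lam (coords n p (\<lambda>z. off z + weight P z)) =
     (if \<forall>i<n. mu i + weight P (p i) = lam i then 1 else 0)"
proof -
  have offi: "off (p i) = mu i + (n - i)" if "i < n" for i
    using fun_cong[OF off, of i] that by (simp add: coords_def shifted_def)
  have "alternant n lam (coords n p (\<lambda>z. off z + weight P z)) =
    (if \<forall>i<n. coords n p (\<lambda>z. off z + weight P z) i = lam i + (n - i) then 1 else 0)"
  proof (rule alternant_decreasing[OF lam])
    fix i assume i: "Suc i < n"
    have "\<not> violates (demands n p mu) P 0 (p i, p (Suc i), Suc (mu i - mu (Suc i)))" by (rule nv)
    hence "weight P (p (Suc i)) < Suc (mu i - mu (Suc i)) + weight P (p i)"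
      using i by (auto simp: violates_def demands_def tail_0)
    moreover have "mu (Suc i) \<le> mu i" using mu by (simp add: antimono_iff_le_Suc)
    ultimately show "coords n p (\<lambda>z. off z + weight P z) (Suc i) < coords n p (\<lambda>z. off z + weight P z) i"
      using i offi[of i] offi[of "Suc i"] by (simp add: coords_def)
  qed
  moreover have "(\<forall>i<n. coords n p (\<lambda>z. off z + weight P z) i = lam i + (n - i)) \<longleftrightarrow>
      (\<forall>i<n. mu i + weight P (p i) = lam i)"
    using offi by (auto simp: coords_def)
  ultimately show ?thesis by simp
qed

lemma demands_iff_ne_pairs:
  assumes kap: "is_partition kap" and P: "P \<in> strip_chains r mu' kap"
    and p: "\<And>i. i < n \<Longrightarrow> 1 \<le> p i" "\<And>i. Suc i < n \<Longrightarrow> p i < p (Suc i)"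
    and lam: "antimono lam" and mu: "antimono mu"
    and w: "\<forall>i<n. mu i + weight P (p i) = lam i"
  shows "(\<forall>j e. \<not> violates (demands n p mu) P j e) \<longleftrightarrow>
     (\<forall>i. Suc i < n \<longrightarrow> has_disjoint_ne_pairs (skew_diagram kap mu') (tableau_of (skew_diagram kap mu') P)
        (common_columns lam mu i) (p i) (p (Suc i)))"
proof -
  have "has_disjoint_ne_pairs (skew_diagram kap mu') (tableau_of (skew_diagram kap mu') P)
        (common_columns lam mu i) (p i) (p (Suc i)) \<longleftrightarrow>
      (\<forall>j. tail P j (p (Suc i)) < Suc (mu i - mu (Suc i)) + tail P j (p i))" if "Suc i < n" for i
    using ne_pairs_common_columns[OF kap P p(1) p(2) lam mu, of i i] that w by simp
  moreover have "(\<forall>j e. \<not> violates (demands n p mu) P j e) \<longleftrightarrow>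
      (\<forall>i. Suc i < n \<longrightarrow> (\<forall>j. tail P j (p (Suc i)) < Suc (mu i - mu (Suc i)) + tail P j (p i)))"
  proof (intro iffI allI impI)
    fix i j assume nv: "\<forall>j e. \<not> violates (demands n p mu) P j e" and i: "Suc i < n"
    have "\<not> violates (demands n p mu) P j (p i, p (Suc i), Suc (mu i - mu (Suc i)))" using nv by blast
    thus "tail P j (p (Suc i)) < Suc (mu i - mu (Suc i)) + tail P j (p i)"
      using i by (auto simp: violates_def demands_def)
  next
    fix j e
    assume lt: "\<forall>i. Suc i < n \<longrightarrow> (\<forall>j. tail P j (p (Suc i)) < Suc (mu i - mu (Suc i)) + tail P j (p i))"
    show "\<not> violates (demands n p mu) P j e"
    proof
      assume "violates (demands n p mu) P j e"
      then obtain i where i: "Suc i < n"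
        and v: "Suc (mu i - mu (Suc i)) + tail P j (p i) \<le> tail P j (p (Suc i))"
        by (auto simp: violates_def demands_def)
      show False using lt[rule_format, OF i, of j] v by simp
    qed
  qed
  ultimately show ?thesis by blast
qed

lemma interleaving_inc: "interleaving n p q \<Longrightarrow> Suc i < n \<Longrightarrow> p i < p (Suc i) \<and> q i < q (Suc i)"
  by (fastforce simp: interleaving_def)

lemma interleaving_range:
  assumes "interleaving n p q" "i < n" shows "p i \<in> {1..2 * n}" "q i \<in> {1..2 * n}"
  using assms unfolding interleaving_def by blast+

text \<open>
  After the cancellation the arguments of both alternants are strictly decreasing, so their product
  only tests the content.
\<close>

lemma tabsum_peelable:
  assumes il: "interleaving n p q" and kap: "is_partition kap"
    and anti: "antimono lam" "antimono mu" "antimono nu" "antimono rho"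
    and off: "coords n p off = shifted n mu" "coords n q off = shifted n rho"
  shows "tabsum (2 * n) (\<lambda>w. alternant n lam (coords n p (\<lambda>z. off z + w z)) *
                             alternant n nu (coords n q (\<lambda>z. off z + w z))) kap =
    int (card {T \<in> ssyt {1..2 * n} (diagram kap).
       (\<forall>i<n. int (card {s \<in> diagram kap. T s = p i}) = int (lam i) - int (mu i) \<and>
              int (card {s \<in> diagram kap. T s = q i}) = int (nu i) - int (rho i)) \<and>
       (\<forall>i. Suc i < n \<longrightarrow>
          has_disjoint_ne_pairs (diagram kap) T (common_columns lam mu i) (p i) (p (Suc i)) \<and>
          has_disjoint_ne_pairs (diagram kap) T (common_columns nu rho i) (q i) (q (Suc i)))})"
    (is "tabsum _ ?G kap = int (card ?R)")
proof -
  let ?C = "strip_chains (2 * n) (\<lambda>_. 0) kap"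
  let ?E = "demands n p mu \<union> demands n q rho"
  let ?w = "\<lambda>P. (\<forall>i<n. mu i + weight P (p i) = lam i) \<and> (\<forall>i<n. rho i + weight P (q i) = nu i)"
  let ?ok = "\<lambda>P. \<forall>j e. \<not> violates ?E P j e"
  have inj: "inj_on p {..<n}" "inj_on q {..<n}" and disj: "p ` {..<n} \<inter> q ` {..<n} = {}"
    "q ` {..<n} \<inter> p ` {..<n} = {}"
    using il by (auto simp: interleaving_def)
  have ok_iff: "?ok P \<longleftrightarrow> (\<forall>j e. \<not> violates (demands n p mu) P j e) \<and>
      (\<forall>j e. \<not> violates (demands n q rho) P j e)" for P
    by (auto simp: violates_def)
  have "tabsum (2 * n) ?G kap = (\<Sum>P | P \<in> ?C \<and> ?ok P. ?G (weight P))"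
    unfolding tabsum_def
  proof (rule cancel_violations[OF kap])
    fix x y d assume "(x, y, d) \<in> ?E"
    thus "1 \<le> x \<and> (y = Suc x \<or> y = Suc (Suc x)) \<and> y \<le> 2 * n \<and> 0 < d"
      using il interleaving_range[OF il] unfolding demands_def interleaving_def by fastforce
  next
    fix x y d and w w' :: "nat \<Rightarrow> nat"
    assume e: "(x, y, d) \<in> ?E" and w: "d + w' x = w y" "w' y = d + w x"
      and o: "\<And>z. z \<noteq> x \<Longrightarrow> z \<noteq> y \<Longrightarrow> w' z = w z"
    show "?G w' = - ?G w"
    proof (cases "(x, y, d) \<in> demands n p mu")
      case True
      have "alternant n lam (coords n p (\<lambda>z. off z + w' z)) =
          - alternant n lam (coords n p (\<lambda>z. off z + w z))"
        by (rule alternant_coords_swap[OF inj(1) anti(2) off(1) True w o])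
      moreover have "coords n q (\<lambda>z. off z + w' z) = coords n q (\<lambda>z. off z + w z)"
        by (rule coords_unchanged[OF disj(1) True o])
      ultimately show ?thesis by simp
    next
      case False
      hence F: "(x, y, d) \<in> demands n q rho" using e by simp
      have "alternant n nu (coords n q (\<lambda>z. off z + w' z)) =
          - alternant n nu (coords n q (\<lambda>z. off z + w z))"
        by (rule alternant_coords_swap[OF inj(2) anti(4) off(2) F w o])
      moreover have "coords n p (\<lambda>z. off z + w' z) = coords n p (\<lambda>z. off z + w z)"
        by (rule coords_unchanged[OF disj(2) F o])
      ultimately show ?thesis by simp
    qed
  qed
  also have "\<dots> = (\<Sum>P | P \<in> ?C \<and> ?ok P. if ?w P then 1 else 0)"
  proof (intro sum.cong refl)
    fix P assume "P \<in> {P \<in> ?C. ?ok P}"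
    hence "?ok P" by simp
    hence "alternant n lam (coords n p (\<lambda>z. off z + weight P z)) =
        (if \<forall>i<n. mu i + weight P (p i) = lam i then 1 else 0)"
      and "alternant n nu (coords n q (\<lambda>z. off z + weight P z)) =
        (if \<forall>i<n. rho i + weight P (q i) = nu i then 1 else 0)"
      unfolding ok_iff using alternant_no_violation[OF anti(1,2) off(1)]
        alternant_no_violation[OF anti(3,4) off(2)] by blast+
    thus "?G (weight P) = (if ?w P then 1 else 0)" by (simp only: if_distrib mult_1 mult_zero_left) simp
  qed
  also have "\<dots> = int (card {P \<in> ?C. ?ok P \<and> ?w P})"
    using finite_strip_chains[OF kap, of "2 * n" "\<lambda>_. 0"]
    by (simp add: sum.If_cases Int_def conj_assoc)
  also have "card {P \<in> ?C. ?ok P \<and> ?w P} = card ?R"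
  proof -
    let ?t = "tableau_of (diagram kap)"
    have bij: "bij_betw ?t ?C (ssyt {1..2 * n} (diagram kap))"
      unfolding diagram_def by (rule bij_betw_tableau_of[OF kap]) (auto simp: le_fun_def)
    have iff: "?ok P \<and> ?w P \<longleftrightarrow> ?t P \<in> ?R" if P: "P \<in> ?C" for P
    proof -
      have wt: "card {s \<in> diagram kap. ?t P s = x} = weight P x" if "1 \<le> x" for x
        unfolding diagram_def tableau_of_letter[OF P that] weight_def ..
      have p1: "1 \<le> p i" "1 \<le> q i" if "i < n" for i using interleaving_range[OF il that] by auto
      have "?w P \<longleftrightarrow> (\<forall>i<n. int (card {s \<in> diagram kap. ?t P s = p i}) = int (lam i) - int (mu i) \<and>
              int (card {s \<in> diagram kap. ?t P s = q i}) = int (nu i) - int (rho i))"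
        using wt[OF p1(1)] wt[OF p1(2)] by (auto simp: algebra_simps of_nat_add[symmetric] simp del: of_nat_add)
      moreover have "?ok P \<longleftrightarrow> (\<forall>i. Suc i < n \<longrightarrow>
          has_disjoint_ne_pairs (diagram kap) (?t P) (common_columns lam mu i) (p i) (p (Suc i)) \<and>
          has_disjoint_ne_pairs (diagram kap) (?t P) (common_columns nu rho i) (q i) (q (Suc i)))" if "?w P"
      proof -
        have "(\<forall>j e. \<not> violates (demands n p mu) P j e) \<longleftrightarrow> (\<forall>i. Suc i < n \<longrightarrow>
            has_disjoint_ne_pairs (diagram kap) (?t P) (common_columns lam mu i) (p i) (p (Suc i)))"
          unfolding diagram_def
          by (rule demands_iff_ne_pairs[OF kap P])
             (use p1 interleaving_inc[OF il] anti that in auto)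
        moreover have "(\<forall>j e. \<not> violates (demands n q rho) P j e) \<longleftrightarrow> (\<forall>i. Suc i < n \<longrightarrow>
            has_disjoint_ne_pairs (diagram kap) (?t P) (common_columns nu rho i) (q i) (q (Suc i)))"
          unfolding diagram_def
          by (rule demands_iff_ne_pairs[OF kap P])
             (use p1 interleaving_inc[OF il] anti that in auto)
        ultimately show ?thesis unfolding ok_iff by blast
      qed
      moreover have "?t P \<in> ssyt {1..2 * n} (diagram kap)" using bij P by (auto simp: bij_betw_def)
      ultimately show ?thesis by blast
    qed
    have "?t ` {P \<in> ?C. ?ok P \<and> ?w P} = ?R"
    proof (intro equalityI subsetI)
      fix T assume T: "T \<in> ?R"
      hence "T \<in> ?t ` ?C" using bij_betw_imp_surj_on[OF bij] by blast
      then obtain P where "P \<in> ?C" "T = ?t P" by blast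
      thus "T \<in> ?t ` {P \<in> ?C. ?ok P \<and> ?w P}" using T iff by blast
    qed (use iff in blast)
    hence "bij_betw ?t {P \<in> ?C. ?ok P \<and> ?w P} ?R" by (intro bij_betw_subset[OF bij]) auto
    thus ?thesis by (rule bij_betw_same_card)
  qed
  finally show ?thesis .
qed

text \<open>
  Both skew factors contribute a Jacobi--Trudi sum; the two sums, taken over all ways to split the
  monomial, make up one in the interleaved rows, to which the Cauchy identity applies.
\<close>

lemma product_kostka:
  assumes il: "interleaving n p q"
    and part: "partition_of_length n lam" "partition_of_length n mu" "partition_of_length n nu" "partition_of_length n rho"
    and off: "coords n p off = shifted n mu" "coords n q off = shifted n rho"
    and M: "set_mset M \<subseteq> {1..m}"
  shows "series_mult (skew_schur lam mu) (skew_schur nu rho) M =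
    (\<Sum>kap | is_partition kap \<and> psize kap = sum (count M) {1..m}. int (kostka m kap (\<lambda>_. 0) (count M)) *
       tabsum (2 * n) (\<lambda>w. alternant n lam (coords n p (\<lambda>z. off z + w z)) *
                           alternant n nu (coords n q (\<lambda>z. off z + w z))) kap)"
proof -
  let ?g = "\<lambda>w. alternant n lam (coords n p w) * alternant n nu (coords n q w)"
  note ip = partition_of_length_is_partition
  have inj: "inj_on p {..<n}" "inj_on q {..<n}" and disj: "p ` {..<n} \<inter> q ` {..<n} = {}"
    and un: "{1..2 * n} = p ` {..<n} \<union> q ` {..<n}"
    using il by (auto simp: interleaving_def)
  have "series_mult (skew_schur lam mu) (skew_schur nu rho) M =
    (\<Sum>A | A \<subseteq># M. int (kostka m lam mu (count A)) * int (kostka m nu rho (\<lambda>x. count M x - count A x)))"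
    unfolding series_mult_def
  proof (intro sum.cong refl)
    fix A assume "A \<in> {A. A \<subseteq># M}"
    hence A: "set_mset A \<subseteq> {1..m}" "set_mset (M - A) \<subseteq> {1..m}"
      using M by (auto dest: mset_subset_eqD in_diffD)
    have "count (M - A) = (\<lambda>x. count M x - count A x)" by auto
    thus "skew_schur lam mu A * skew_schur nu rho (M - A) =
        int (kostka m lam mu (count A)) * int (kostka m nu rho (\<lambda>x. count M x - count A x))"
      using skew_schur_kostka[OF ip[OF part(1)] ip[OF part(2)] A(1)]
        skew_schur_kostka[OF ip[OF part(3)] ip[OF part(4)] A(2)] by simp
  qed
  also have "\<dots> = (\<Sum>c\<in>subcontents (count M) m.
      int (kostka m lam mu c) * int (kostka m nu rho (\<lambda>x. count M x - c x)))"
  proof (rule sum.reindex_bij_witness[where i = Abs_multiset and j = count], goal_cases)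
    case (1 A)
    show ?case by simp
  next
    case (2 A)
    have "count A x \<le> (if x \<in> {1..m} then count M x else 0)" for x
    proof (cases "x \<in> {1..m}")
      case True
      thus ?thesis using 2 by (simp add: subseteq_mset_def)
    next
      case False
      hence "count M x = 0" using M by (auto simp: not_in_iff[symmetric])
      thus ?thesis using 2 False by (simp add: subseteq_mset_def) (metis le_zero_eq)
    qed
    thus ?case by (simp add: subcontents_def)
  next
    case (3 c)
    have "{x. 0 < c x} \<subseteq> {1..m}" using 3 by (auto simp: subcontents_def) (metis not_less_zero le_zero_eq)+
    hence "finite {x. 0 < c x}" by (rule finite_subset) simp
    thus ?case by simp
  next
    case (4 c)
    have "{x. 0 < c x} \<subseteq> {1..m}" using 4 by (auto simp: subcontents_def) (metis not_less_zero le_zero_eq)+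
    hence "finite {x. 0 < c x}" by (rule finite_subset) simp
    moreover have "c x \<le> count M x" for x
      using 4 by (auto simp: subcontents_def dest!: spec[of _ x] split: if_splits)
    ultimately show ?case by (simp add: subseteq_mset_def)
  qed simp
  also have "\<dots> = (\<Sum>c\<in>subcontents (count M) m.
      hopseq {..<n} c m (alternant n lam) (coords n p off) *
      hopseq {..<n} (\<lambda>x. count M x - c x) m (alternant n nu) (coords n q off))"
    unfolding off using skew_kostka[OF part(1,2)] skew_kostka[OF part(3,4)] by simp
  also have "\<dots> = hopseq {1..2 * n} (count M) m ?g off"
    by (rule hopseq_product[OF inj disj un, symmetric])
  also have "\<dots> = hopseq {1..2 * n} (count M) m (\<lambda>w. ?g (\<lambda>z. off z + w z)) (\<lambda>_. 0)"
    by (subst hopseq_translate[where g = ?g]) simp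
  also have "\<dots> = (\<Sum>kap | is_partition kap \<and> psize kap = sum (count M) {1..m}.
      int (kostka m kap (\<lambda>_. 0) (count M)) * tabsum (2 * n) (\<lambda>w. ?g (\<lambda>z. off z + w z)) kap)"
    by (rule cauchy[symmetric])
  finally show ?thesis .
qed

lemma peelable_size:
  assumes il: "interleaving n (letter_pos W (path_word n k)) (letter_pos N (path_word n k))"
    and kap: "is_partition kap" and anti: "antimono lam" "antimono nu"
    and T: "T \<in> peelable_tableaux n k lam mu nu rho kap"
  shows "psize kap \<le> 2 * n * (lam 0 + nu 0)"
proof -
  let ?D = "diagram kap" and ?p = "letter_pos W (path_word n k)" and ?q = "letter_pos N (path_word n k)"
  have Ts: "T \<in> ssyt {1..2 * n} ?D"
    and c: "\<And>i. i < n \<Longrightarrow> int (card {s \<in> ?D. T s = ?p i}) = int (lam i) - int (mu i) \<and>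
              int (card {s \<in> ?D. T s = ?q i}) = int (nu i) - int (rho i)"
    using T unfolding peelable_tableaux_def Let_def by auto
  have bnd: "card {s \<in> ?D. T s = x} \<le> lam 0 + nu 0" if "x \<in> {1..2 * n}" for x
  proof -
    obtain i where i: "i < n" "x = ?p i \<or> x = ?q i" using il \<open>x \<in> {1..2 * n}\<close> unfolding interleaving_def by blast
    have "lam i \<le> lam 0" "nu i \<le> nu 0" using anti by (auto simp: antimono_def)
    thus ?thesis using i c[OF i(1)] by auto
  qed
  have "psize kap = card ?D"
    unfolding diagram_def by (subst card_skew_diagram_psize[OF _ kap]) (auto simp: le_fun_def)
  also have "?D = (\<Union>x\<in>{1..2 * n}. {s \<in> ?D. T s = x})"
  proof -
    have "T s \<in> {1..2 * n}" if "s \<in> ?D" for s using Ts that by (auto simp: ssyt_def)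
    thus ?thesis by blast
  qed
  also have "card \<dots> \<le> (\<Sum>x\<in>{1..2 * n}. card {s \<in> ?D. T s = x})" by (rule card_UN_le) simp
  also have "\<dots> \<le> (\<Sum>x\<in>{1..2 * n}. lam 0 + nu 0)" by (rule sum_mono[OF bnd])
  finally show ?thesis by simp
qed

theorem corollary5p9:
  fixes n :: nat and k :: int and lam mu nu rho kap :: "nat \<Rightarrow> nat"
  assumes "n \<ge> 1"
    and "partition_of_length n lam" and "partition_of_length n mu"
    and "partition_of_length n nu" and "partition_of_length n rho"
    and "is_partition kap"
    and "1 \<le> \<bar>k\<bar>" and "\<bar>k\<bar> \<le> int n"
  shows "lr_coeff lam mu nu rho kap = int (card (peelable_tableaux n k lam mu nu rho kap))"
proof -
  define p where "p = letter_pos W (path_word n k)"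
  define q where "q = letter_pos N (path_word n k)"
  define c where "c = (\<lambda>kap. if is_partition kap then int (card (peelable_tableaux n k lam mu nu rho kap)) else 0)"
  \<comment> \<open>The two shifted inner partitions, joined into one vector along the word.\<close>
  define off where "off = (\<lambda>z. if z \<in> p ` {..<n} then shifted n mu (the_inv_into {..<n} p z)
                               else shifted n rho (the_inv_into {..<n} q z))"
  have il: "interleaving n p q" unfolding p_def q_def by (rule interleaving_path_word[OF assms(7,8)])
  have inj: "inj_on p {..<n}" "inj_on q {..<n}" and disj: "p ` {..<n} \<inter> q ` {..<n} = {}"
    using il by (auto simp: interleaving_def)
  have anti: "antimono lam" "antimono mu" "antimono nu" "antimono rho"
    using assms by (auto simp: partition_of_length_def)
  have off1: "coords n p off = shifted n mu"
    using inj(1) by (auto simp: coords_def off_def the_inv_into_f_f shifted_def fun_eq_iff)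
  have "q i \<notin> p ` {..<n}" if "i < n" for i using disj that by blast
  hence off2: "coords n q off = shifted n rho"
    using inj(2) by (auto simp: coords_def off_def the_inv_into_f_f shifted_def fun_eq_iff)
  have ct: "c kap = tabsum (2 * n) (\<lambda>w. alternant n lam (coords n p (\<lambda>z. off z + w z)) *
      alternant n nu (coords n q (\<lambda>z. off z + w z))) kap" if "is_partition kap" for kap
    unfolding c_def peelable_tableaux_def Let_def p_def[symmetric] q_def[symmetric]
      tabsum_peelable[OF il that anti off1 off2] using that by simp
  have finc: "finite {kap. c kap \<noteq> 0}"
  proof (rule finite_subset[OF _ finite_partitions_of_size[of "2 * n * (lam 0 + nu 0)"]], clarify)
    fix kap assume nz: "c kap \<noteq> 0"
    hence kap: "is_partition kap" by (auto simp: c_def split: if_splits)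
    have "peelable_tableaux n k lam mu nu rho kap \<noteq> {}" using nz kap by (auto simp: c_def)
    thus "is_partition kap \<and> psize kap \<le> 2 * n * (lam 0 + nu 0)"
      using peelable_size[OF il[unfolded p_def q_def] kap anti(1,3)] kap by blast
  qed
  have "series_mult (skew_schur lam mu) (skew_schur nu rho) M = (\<Sum>kap | c kap \<noteq> 0. c kap * schur kap M)" for M
  proof (cases "0 \<in># M")
    case True
    have "skew_schur lam mu A * skew_schur nu rho (M - A) = 0" if "A \<subseteq># M" for A
    proof (cases "0 \<in># A")
      case False
      hence "0 \<in># M - A" using True by (metis count_diff count_greater_zero_iff diff_zero not_in_iff)
      thus ?thesis using skew_schur_no_0[OF partition_of_length_is_partition[OF assms(4)]] by simp
    qed (use skew_schur_no_0[OF partition_of_length_is_partition[OF assms(2)]] in simp)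
    hence "series_mult (skew_schur lam mu) (skew_schur nu rho) M = 0"
      unfolding series_mult_def by (intro sum.neutral) auto
    moreover have "c kap * schur kap M = 0" for kap
      using skew_schur_no_0[OF _ True, of kap "\<lambda>_. 0"] by (auto simp: c_def schur_def)
    hence "(\<Sum>kap | c kap \<noteq> 0. c kap * schur kap M) = 0" by (intro sum.neutral) blast
    ultimately show ?thesis by simp
  next
    case False
    obtain m where "\<forall>x\<in>set_mset M. x < m" using finite_nat_set_iff_bounded by blast
    hence M: "set_mset M \<subseteq> {1..m}" using False by (force simp: Suc_le_eq intro: gr0I)
    let ?S = "{kap. is_partition kap \<and> psize kap = sum (count M) {1..m}}"
    have sk: "schur kap M = int (kostka m kap (\<lambda>_. 0) (count M))" if "is_partition kap" for kap
      unfolding schur_def by (rule skew_schur_kostka[OF that is_partition_zero M])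
    have "series_mult (skew_schur lam mu) (skew_schur nu rho) M = (\<Sum>kap\<in>?S. c kap * schur kap M)"
      unfolding product_kostka[OF il assms(2-5) off1 off2 M]
      by (intro sum.cong refl) (auto simp: ct sk)
    also have "\<dots> = (\<Sum>kap | c kap \<noteq> 0. c kap * schur kap M)"
    proof (rule sum.mono_neutral_cong)
      fix kap assume "kap \<in> {kap. c kap \<noteq> 0} - ?S"
      hence "is_partition kap" "psize kap \<noteq> sum (count M) {1..m}" by (auto simp: c_def split: if_splits)
      hence "kostka m kap (\<lambda>_. 0) (count M) = 0" using kostka_size[of kap m "\<lambda>_. 0" "count M"] by auto
      thus "c kap * schur kap M = 0" using sk \<open>is_partition kap\<close> by simp
    qed (use finc finite_partitions_exact in auto)
    finally show ?thesis .
  qed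
  hence "schur_expansion (series_mult (skew_schur lam mu) (skew_schur nu rho)) c"
    unfolding schur_expansion_def using finc by (auto simp: c_def split: if_splits)
  from schur_coeff_eq[OF this] show ?thesis unfolding lr_coeff_def using assms(6) by (simp add: c_def)
qed

end
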